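(* Let $d=1$, fix $0<\lambda\le1$, and let A1 and A2 be satisfied at $\theta_0\in\Theta$. Let $u_\epsilon>0$ with $\epsilon^{-1}u_\epsilon\to\infty$ and $\epsilon^{-2}u_\epsilon^{2+\lambda}\to0$ as $\epsilon\to0$. Then, for any estimator $\widehat\theta_\epsilon$, $$\liminf_{\epsilon\to0}\ \sup_{|\theta-\theta_0|<C_\epsilon u_\epsilon}\frac{\mathbf P_\theta\left(|\widehat\theta_\epsilon-\theta|>u_\epsilon\right)}{2\Phi\left(-\epsilon^{-1}I^{1/2}(\theta_0)u_\epsilon\right)}\ge1\qquad( * )$$ for any family of constants $C_\epsilon\to\infty$ as $\epsilon\to0$ (the supremum being over $\theta\in\Theta$). If equality is attained in $( * )$ for $C_\epsilon\to\infty$ with $\epsilon^{-2}C_\epsilon^{2+\lambda}u_\epsilon^{2+\lambda}\to0$ as $\epsilon\to0$, then, for any family of parameters $\theta_\epsilon$ with $|\theta_\epsilon-\theta_0|<C_\epsilon u_\epsilon$, $$\lim_{\epsilon\to0}\left(\Phi\left(-\epsilon^{-1}I^{1/2}(\theta_0)u_\epsilon\right)\right)^{-1}\mathbf E_{\theta_\epsilon}\left[\left|\chi\left(|\widehat\theta_\epsilon-\theta_\epsilon|>u_\epsilon\right)-\chi\left(\left|\epsilon I^{-1/2}(\theta_0)T_0-(\theta_\epsilon-\theta_0)\right|>u_\epsilon\right)\right|\right]=0,$$ where $$T_0=I^{-1/2}(\theta_0)\int_0^1S_\theta(t,\theta_0)\,dw(t),\qquad dw(t)=\epsilon^{-1}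\left(dY_\epsilon(t)-S(t,\theta_0)\,dt\right).$$
   Context: Model: for $\epsilon>0$ one observes $Y_\epsilon(t)$, $t\in(0,1)$, whose law $\mathbf P_\theta$ under the parameter value $\theta$ is that of the process with $dY_\epsilon(t)=S(t,\theta)\,dt+\epsilon\,dW(t)$, $W$ a standard Wiener process, $S(\cdot,\theta)\in L_2(0,1)$ a signal, and $\theta$ in an open set $\Theta\subset\mathbb R^d$ (here $d=1$). $\mathbf E_\theta$ denotes expectation under $\mathbf P_\theta$. The differential $dw$ in $T_0$ is the noise under the true value $\theta_0$, so $T_0$ is a functional of the observation. An estimator $\widehat\theta_\epsilon$ is a measurable function of $Y_\epsilon$. $\Phi$ is the standard normal distribution function and $\chi(A)$ is the indicator of an event $A$. A1 (at $\theta_0$): there is a function $S_\theta(\cdot,\theta_0)$ in $L_2(0,1)$ with $\int_0^1\big(S(t,\theta)-S(t,\theta_0)-(\theta-\theta_0)S_\theta(t,\theta_0)\big)^2dt=o(|\theta-\theta_0|^2)$ as $\theta\to\theta_0$, and the Fisher information $I(\theta_0)=\int_0^1S_\theta(t,\theta_0)^2\,dt$ is positive. A2 (at $\theta_0$, with exponent $\lambda$): as $\theta\to\theta_0$, $\int_0^1\big(S(t,\theta)-S(t,\theta_0)-(\theta-\theta_0)S_\theta(t,\theta_0)\big)^2dt=O(|\theta-\theta_0|^{2+\lambda})$ and $\int_0^1(S(t,\theta)-S(t,\theta_0))^2dt-(\theta-\theta_0)^2I(\theta_0)=O(|\theta-\theta_0|^{2+\lambda})$. "Equality is attained in $( * )$"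 means that the supremum in $( * )$ tends to $1$ as $\epsilon\to0$.
   Formalization: In the second part, equality in ( * ) is assumed for every family C_ε→∞ with ε^{-2}C_ε^{2+λ}u_ε^{2+λ}→0, not just one; for a single family the claim fails near the boundary, e.g. for S(t,θ)=θ and the efficient estimator truncated at θ_0+C_ε u_ε. *)

theory Defs
  imports "HOL-Probability.Probability" "HOL-Library.Landau_Symbols"
begin

subsection \<open>Square integrable functions on the unit interval\<close>

abbreviation unit_leb :: "real measure" where
  "unit_leb \<equiv> lebesgue_on {0<..<1}"

definition L2 :: "(real \<Rightarrow> real) \<Rightarrow> bool" where
  "L2 f \<longleftrightarrow> f \<in> borel_measurable unit_leb \<and> integrable unit_leb (\<lambda>t. (f t)\<^sup>2)"


subsection \<open>The signal plus white noise model\<close>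

text \<open>The Wiener process is needed on the time interval from 0 to 1 only.\<close>

definition wiener_process :: "'a measure \<Rightarrow> (real \<Rightarrow> 'a \<Rightarrow> real) \<Rightarrow> bool" where
  "wiener_process M W \<longleftrightarrow>
     prob_space M \<and>
     (\<forall>t\<in>{0..1}. W t \<in> borel_measurable M) \<and>
     (\<forall>\<omega>\<in>space M. W 0 \<omega> = 0 \<and> continuous_on {0..1} (\<lambda>t. W t \<omega>)) \<and>
     (\<forall>s t. 0 \<le> s \<and> s < t \<and> t \<le> 1 \<longrightarrow>
        distributed M lborel (\<lambda>\<omega>. W t \<omega> - W s \<omega>) (normal_density 0 (sqrt (t - s)))) \<and>
     (\<forall>(t :: nat \<Rightarrow> real) n. 0 \<le> t 0 \<and> (\<forall>i<n. t i \<le> t (Suc i)) \<and> t n \<le> 1 \<longrightarrow>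
        prob_space.indep_vars M (\<lambda>_. borel) (\<lambda>i \<omega>. W (t (Suc i)) \<omega> - W (t i) \<omega>) {..<n})"

text \<open>
  Observations live in the space of continuous paths with the sigma-algebra generated by
  the coordinates. The differential \<open>dY\<close> determines \<open>Y\<close> up to an additive constant only,
  which is fixed by \<open>Y 0 = 0\<close>.
\<close>

definition path_space :: "(real \<Rightarrow> real) measure" where
  "path_space = restrict_space (PiM {0..1} (\<lambda>_. borel)) {y. continuous_on {0..1} y}"

definition drift :: "(real \<Rightarrow> real) \<Rightarrow> real \<Rightarrow> real" where
  "drift f t = (\<integral>s. f s \<partial>(lebesgue_on {0<..<t}))"

definition observation_law ::
    "'a measure \<Rightarrow> (real \<Rightarrow> 'a \<Rightarrow> real) \<Rightarrow> real \<Rightarrow> (real \<Rightarrow> real) \<Rightarrow> (real \<Rightarrow> real) measure" where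
  "observation_law M W \<epsilon> f =
     distr M path_space (\<lambda>\<omega>. \<lambda>t\<in>{0..1}. drift f t + \<epsilon> * W t \<omega>)"

text \<open>The noise \<open>w\<close> with \<open>dw = (dY - f dt) / \<epsilon>\<close> as a functional of the observed path.\<close>

definition noise :: "real \<Rightarrow> (real \<Rightarrow> real) \<Rightarrow> real \<Rightarrow> (real \<Rightarrow> real) \<Rightarrow> real" where
  "noise \<epsilon> f t y = (y t - drift f t) / \<epsilon>"


subsection \<open>Wiener integrals of deterministic functions\<close>

text \<open>
  A triple \<open>(a, b, c)\<close> in a list stands for the summand \<open>c\<close> times the indicator of \<open>{a<..b}\<close>.
\<close>

definition step_fun :: "(real \<times> real \<times> real) list \<Rightarrow> real \<Rightarrow> real" where
  "step_fun ps s = (\<Sum>(a, b, c)\<leftarrow>ps. c * indicator {a<..b} s)"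

definition step_integral ::
    "(real \<times> real \<times> real) list \<Rightarrow> (real \<Rightarrow> 'a \<Rightarrow> real) \<Rightarrow> 'a \<Rightarrow> real" where
  "step_integral ps w y = (\<Sum>(a, b, c)\<leftarrow>ps. c * (w b y - w a y))"

text \<open>
  \<open>Z\<close> is a version of the integral of \<open>f\<close> with respect to \<open>w\<close>: the mean square limit, under \<open>P\<close>,
  of the integrals of step functions converging to \<open>f\<close> in the mean square. It is determined
  up to \<open>P\<close>-null sets.
\<close>

definition has_wiener_integral ::
    "'a measure \<Rightarrow> (real \<Rightarrow> 'a \<Rightarrow> real) \<Rightarrow> (real \<Rightarrow> real) \<Rightarrow> ('a \<Rightarrow> real) \<Rightarrow> bool" where
  "has_wiener_integral P w f Z \<longleftrightarrow>
     Z \<in> borel_measurable P \<and>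
     (\<exists>ps :: nat \<Rightarrow> (real \<times> real \<times> real) list.
        (\<forall>n. \<forall>(a, b, c)\<in>set (ps n). 0 \<le> a \<and> a \<le> b \<and> b \<le> 1) \<and>
        (\<lambda>n. \<integral>\<^sup>+s. ennreal ((f s - step_fun (ps n) s)\<^sup>2) \<partial>unit_leb) \<longlonglongrightarrow> 0 \<and>
        (\<lambda>n. \<integral>\<^sup>+y. ennreal ((Z y - step_integral (ps n) w y)\<^sup>2) \<partial>P) \<longlonglongrightarrow> 0)"


subsection \<open>Regularity conditions\<close>

text \<open>
  \<open>S t \<theta>\<close> is the signal, \<open>Par\<close> the parameter set and \<open>dS\<close> the derivative \<open>S\<^sub>\<theta>(\<cdot>, \<theta>\<^sub>0)\<close> of the
  signal in the mean square.
\<close>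

definition fisher_info :: "(real \<Rightarrow> real) \<Rightarrow> real" where
  "fisher_info dS = (\<integral>t. (dS t)\<^sup>2 \<partial>unit_leb)"

definition cond_A1 ::
    "real set \<Rightarrow> (real \<Rightarrow> real \<Rightarrow> real) \<Rightarrow> real \<Rightarrow> (real \<Rightarrow> real) \<Rightarrow> bool" where
  "cond_A1 Par S \<theta>0 dS \<longleftrightarrow>
     L2 dS \<and>
     (\<lambda>\<theta>. \<integral>t. (S t \<theta> - S t \<theta>0 - (\<theta> - \<theta>0) * dS t)\<^sup>2 \<partial>unit_leb)
        \<in> o[at \<theta>0 within Par](\<lambda>\<theta>. \<bar>\<theta> - \<theta>0\<bar>\<^sup>2) \<and>
     fisher_info dS > 0"

definition cond_A2 ::
    "real \<Rightarrow> real set \<Rightarrow> (real \<Rightarrow> real \<Rightarrow> real) \<Rightarrow> real \<Rightarrow> (real \<Rightarrow> real) \<Rightarrow> bool" where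
  "cond_A2 lam Par S \<theta>0 dS \<longleftrightarrow>
     (\<lambda>\<theta>. \<integral>t. (S t \<theta> - S t \<theta>0 - (\<theta> - \<theta>0) * dS t)\<^sup>2 \<partial>unit_leb)
        \<in> O[at \<theta>0 within Par](\<lambda>\<theta>. \<bar>\<theta> - \<theta>0\<bar> powr (2 + lam)) \<and>
     (\<lambda>\<theta>. (\<integral>t. (S t \<theta> - S t \<theta>0)\<^sup>2 \<partial>unit_leb) - (\<theta> - \<theta>0)\<^sup>2 * fisher_info dS)
        \<in> O[at \<theta>0 within Par](\<lambda>\<theta>. \<bar>\<theta> - \<theta>0\<bar> powr (2 + lam))"


subsection \<open>The normalised worst-case error probability\<close>

definition Phi :: "real \<Rightarrow> real" where
  "Phi x = cdf std_normal_distribution x"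

text \<open>
  \<open>P \<theta>\<close> is the law of the observation at noise level \<open>\<epsilon>\<close>, \<open>est\<close> the estimator, \<open>I\<close> the Fisher
  information, \<open>u\<close> the threshold and \<open>r\<close> the radius of the neighbourhood of \<open>\<theta>0\<close>.
\<close>

definition sup_ratio ::
    "real set \<Rightarrow> (real \<Rightarrow> (real \<Rightarrow> real) measure) \<Rightarrow> ((real \<Rightarrow> real) \<Rightarrow> real) \<Rightarrow>
     real \<Rightarrow> real \<Rightarrow> real \<Rightarrow> real \<Rightarrow> real \<Rightarrow> ereal" where
  "sup_ratio Par P est I \<epsilon> \<theta>0 u r =
     (SUP \<theta>\<in>{\<theta>\<in>Par. \<bar>\<theta> - \<theta>0\<bar> < r}.
        ereal (measure (P \<theta>) {y \<in> space (P \<theta>). \<bar>est y - \<theta>\<bar> > u}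
               / (2 * Phi (- (sqrt I * u / \<epsilon>)))))"

end

theory Submission
  imports Defs
begin

text \<open>
  Take parameters \<open>\<theta>\<^sub>k\<close> spaced by slightly more than \<open>2 u\<close>. An estimate above the midpoint of
  \<open>\<theta>\<^sub>k\<close> and \<open>\<theta>\<^sub>k\<^sub>+\<^sub>1\<close> is an error under \<open>\<theta>\<^sub>k\<close>, an estimate below it is an error under \<open>\<theta>\<^sub>k\<^sub>+\<^sub>1\<close>, so each
  link of the chain is a test between two Gaussian shifts, whose total error is at least
  \<open>2 \<Phi>(- separation)\<close>. The second half of A2 makes the separation so close to that of the linear model
  that this is \<open>2 \<Phi>(- \<surd>I u / \<epsilon>) (1 + o(1))\<close>. A chain of \<open>N + 1\<close> points has \<open>N\<close> links, so the average error
  is at least \<open>N / (N + 1)\<close> times that.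

  For an efficient estimator the total slack along a chain is bounded. As the one-sided errors are
  almost monotone along the chain, the slack is small at every link well inside a long chain. A test with small
  slack is close to the likelihood ratio test, because the likelihood ratio is within \<open>\<delta>\<close> of \<open>1\<close> only
  with probability of order \<open>\<delta> \<Phi>(- separation)\<close>. The test based on the efficient statistic \<open>T\<^sub>0\<close> is almost optimal too,
  hence the error events of the estimator are close to those of \<open>T\<^sub>0\<close>.

  Likelihood ratios are needed only for finitely many observation times: every event is approximated by
  cylinders, and all bounds depend on the separation of the full signals alone.
\<close>

section \<open>Tails of the normal distribution\<close>

text \<open>All error probabilities tend to 0, so every approximation has to be relative to
  \<open>Phi (- level \<epsilon>)\<close>. A shift of order 1/a changes a normal tail at a by a
  constant factor; separations must therefore be known so well that their squares, in units of the
  noise, are off by o(1) only. The condition \<epsilon>^-2 \<rho>^(2 + lam) -> 0 gives exactly this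
  on a neighbourhood of radius \<rho>. No density of one path law with respect to another is
  constructed. Finitely many observation times see a separation b at most the full one, and this
  inequality is enough: it enlarges \<open>Phi (- b)\<close>, so lower bounds survive, and a nearly
  optimal test forces \<open>Phi (- b)\<close> to exceed the full value by little. Efficiency bounds
  the sum of the right and left error at one point, whereas a link adds the right error of one point
  to the left error of the next. The difference is an increment of the left error, so it telescopes.
  The chain is centred at the parameter under study and reaches beyond the given neighbourhood;
  efficiency is invoked on a neighbourhood larger by a constant factor.\<close>

lemma Phi_uminus: "Phi (- x) = measure std_normal_distribution {x..}"
  and Phi_uminus': "Phi (- x) = measure std_normal_distribution {x<..}"
proof -
  interpret N: real_distribution std_normal_distribution by (rule real_dist_normal_dist)
  have "distr std_normal_distribution borel uminus = std_normal_distribution"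
  proof -
    have "distributed std_normal_distribution lborel (\<lambda>x. x) std_normal_density"
      by (auto simp: distributed_def intro!: distr_id2)
    from N.normal_density_affine[OF this, of "-1" 0]
    have "distributed std_normal_distribution lborel uminus std_normal_density" by simp
    then have "distr std_normal_distribution lborel uminus = std_normal_distribution"
      by (simp add: distributed_def)
    moreover have "distr std_normal_distribution lborel uminus = distr std_normal_distribution borel uminus"
      by (rule distr_cong) auto
    ultimately show ?thesis by simp
  qed
  then have "Phi (-x) = measure (distr std_normal_distribution borel uminus) {..-x}"
    by (simp add: Phi_def cdf_def)
  also have "\<dots> = measure std_normal_distribution {x..}"
    by (subst measure_distr) (auto intro!: arg_cong[where f="measure _"])
  finally show 1: "Phi (- x) = measure std_normal_distribution {x..}" .
  have "measure std_normal_distribution {x} = 0"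
  proof -
    have "emeasure std_normal_distribution {x} = 0"
      by (subst emeasure_density) (auto simp: nn_integral_0_iff_AE intro!: AE_I[of _ _ "{x}"])
    then show ?thesis by (simp add: measure_def)
  qed
  moreover have "measure std_normal_distribution {x..} = measure std_normal_distribution ({x} \<union> {x<..})"
    by (rule arg_cong[where f="measure _"]) auto
  moreover have "\<dots> = measure std_normal_distribution {x} + measure std_normal_distribution {x<..}"
    by (rule N.finite_measure_Union) auto
  ultimately show "Phi (- x) = measure std_normal_distribution {x<..}" using 1 by simp
qed

lemma Phi_mono: "x \<le> y \<Longrightarrow> Phi x \<le> Phi y"
proof -
  interpret N: real_distribution std_normal_distribution by (rule real_dist_normal_dist)
  show "x \<le> y \<Longrightarrow> Phi x \<le> Phi y" unfolding Phi_def by (rule N.cdf_nondecreasing)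
qed

lemma Phi_diff:
  assumes "x \<le> y"
  shows "Phi (- x) - Phi (- y) = measure std_normal_distribution {x..<y}"
proof -
  interpret N: real_distribution std_normal_distribution by (rule real_dist_normal_dist)
  have "measure std_normal_distribution {x..} = measure std_normal_distribution ({x..<y} \<union> {y..})"
    using assms by (intro arg_cong[where f="measure _"]) auto
  also have "\<dots> = measure std_normal_distribution {x..<y} + measure std_normal_distribution {y..}"
    by (rule N.finite_measure_Union) auto
  finally show ?thesis by (simp add: Phi_uminus)
qed

lemma std_normal_density_antimono:
  assumes "\<bar>x\<bar> \<le> \<bar>y\<bar>"
  shows "std_normal_density y \<le> std_normal_density x"
  using power_mono[OF assms, of 2] by (simp add: std_normal_density_def divide_right_mono)

lemma measure_normal_le:
  assumes "A \<in> sets borel" "A \<subseteq> {x..y}" "x \<le> y" and c: "0 \<le> c" and "\<And>z. z \<in> A \<Longrightarrow> std_normal_density z \<le> c"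
  shows "measure std_normal_distribution A \<le> c * (y - x)"
proof -
  have "emeasure std_normal_distribution A = (\<integral>\<^sup>+z. ennreal (std_normal_density z) * indicator A z \<partial>lborel)"
    using assms(1) by (subst emeasure_density) auto
  also have "\<dots> \<le> (\<integral>\<^sup>+z. ennreal c * indicator {x..y} z \<partial>lborel)"
    using assms by (intro nn_integral_mono) (auto split: split_indicator intro!: ennreal_leI)
  also have "\<dots> = ennreal (c * (y - x))"
    using assms c by (simp add: nn_integral_cmult ennreal_mult)
  finally show ?thesis
    using c assms(3) by (simp add: measure_def enn2real_leI)
qed

lemma measure_normal_ge:
  assumes "x \<le> y" and c: "0 \<le> c" and "\<And>z. x \<le> z \<Longrightarrow> z < y \<Longrightarrow> c \<le> std_normal_density z"
  shows "c * (y - x) \<le> measure std_normal_distribution {x..<y}"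
proof -
  interpret N: real_distribution std_normal_distribution by (rule real_dist_normal_dist)
  have "ennreal (c * (y - x)) = (\<integral>\<^sup>+z. ennreal c * indicator {x..<y} z \<partial>lborel)"
    using assms c by (simp add: nn_integral_cmult ennreal_mult)
  also have "\<dots> \<le> (\<integral>\<^sup>+z. ennreal (std_normal_density z) * indicator {x..<y} z \<partial>lborel)"
    using assms by (intro nn_integral_mono) (auto split: split_indicator intro!: ennreal_leI)
  also have "\<dots> = emeasure std_normal_distribution {x..<y}"
    by (subst emeasure_density) auto
  finally show ?thesis
    by (simp add: N.emeasure_eq_measure)
qed

lemma Phi_pos: "0 < Phi x"
proof -
  have "0 < std_normal_density (\<bar>x\<bar> + 1) * (1 - 0)"
    by (simp add: normal_density_pos)
  also have "\<dots> = std_normal_density (\<bar>x\<bar> + 1) * ((\<bar>x\<bar> + 1) - \<bar>x\<bar>)" by simp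
  also have "\<dots> \<le> measure std_normal_distribution {\<bar>x\<bar>..<\<bar>x\<bar> + 1}"
    by (intro measure_normal_ge) (auto intro!: std_normal_density_antimono)
  also have "\<dots> = Phi (- \<bar>x\<bar>) - Phi (- (\<bar>x\<bar> + 1))"
    by (rule Phi_diff[symmetric]) simp
  also have "\<dots> \<le> Phi (- \<bar>x\<bar>)"
    by (simp add: Phi_def cdf_def)
  also have "\<dots> \<le> Phi x"
    by (rule Phi_mono) simp
  finally show ?thesis .
qed

text \<open>A Mills bound. The tail beyond b contains an interval of length 1/b on which the density
  loses at most the factor exp (-3/2), because (b + 1/b)^2 \<le> b^2 + 3 for b \<ge> 1.\<close>

lemma density_le_Phi:
  assumes "1 \<le> b"
  shows "std_normal_density b \<le> exp (3/2) * b * Phi (- b)"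
proof -
  have *: "(b + 1 / b)\<^sup>2 \<le> b\<^sup>2 + 3"
  proof -
    have "(b + 1 / b)\<^sup>2 = b\<^sup>2 + 2 + (1 / b)\<^sup>2" using assms by (simp add: power2_sum)
    moreover have "(1 / b)\<^sup>2 \<le> 1" using assms by (simp add: power_le_one)
    ultimately show ?thesis by simp
  qed
  have "std_normal_density b * exp (-3/2) = (1 / sqrt (2 * pi)) * exp (- (b\<^sup>2 + 3) / 2)"
    by (simp add: std_normal_density_def exp_add[symmetric] add_divide_distrib diff_divide_distrib)
  also have "\<dots> \<le> std_normal_density (b + 1 / b)"
    using * by (simp add: std_normal_density_def divide_right_mono)
  finally have "std_normal_density b * exp (-3/2) * ((b + 1 / b) - b) \<le> std_normal_density (b + 1 / b) * ((b + 1 / b) - b)"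
    using assms by (intro mult_right_mono) auto
  also have "\<dots> \<le> measure std_normal_distribution {b..<b + 1 / b}"
    using assms by (intro measure_normal_ge) (auto intro!: std_normal_density_antimono)
  also have "\<dots> = Phi (- b) - Phi (- (b + 1 / b))"
    using assms by (intro Phi_diff[symmetric]) simp
  also have "\<dots> \<le> Phi (- b)"
    using less_imp_le[OF Phi_pos] by simp
  finally have "exp (3/2) * b * (std_normal_density b * exp (-3/2) * (1 / b)) \<le> exp (3/2) * b * Phi (- b)"
    using assms by (intro mult_left_mono) auto
  moreover have "exp (3/2) * b * (std_normal_density b * exp (-3/2) * (1 / b)) = std_normal_density b"
    using assms by (simp add: exp_minus)
  ultimately show ?thesis by simp
qed

text \<open>The mass lost is at most h times the density at a, and the Mills bound turns this into a
  relative loss of order a h.\<close>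

lemma Phi_shift:
  assumes "1 \<le> a" "0 \<le> h"
  shows "(1 - exp (3/2) * (a * h)) * Phi (- a) \<le> Phi (- (a + h))"
proof -
  have "Phi (- a) - Phi (- (a + h)) \<le> std_normal_density a * ((a + h) - a)"
    using assms by (subst Phi_diff, simp, intro measure_normal_le) (auto intro!: std_normal_density_antimono)
  also have "\<dots> \<le> exp (3/2) * a * Phi (- a) * h"
    using density_le_Phi[OF assms(1)] assms(2) by (auto intro: mult_right_mono)
  finally show ?thesis by (simp add: algebra_simps)
qed

text \<open>The product of level and shift has to vanish, since shifts of order 1/a already change
  the tail by a factor. \<open>Phi_shift\<close> is applied at the smaller of the two arguments,
  hence the two cases.\<close>

lemma Phi_ratio_tendsto:
  assumes a: "filterlim a at_top F" and "((\<lambda>x. a x * (b x - a x)) \<longlongrightarrow> 0) F"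
  shows "((\<lambda>x. Phi (- b x) / Phi (- a x)) \<longlongrightarrow> 1) F"
proof -
  define c where "c x = min (a x) (b x)" for x
  define h where "h x = \<bar>b x - a x\<bar>" for x
  \<comment> \<open>The bound 2 leaves room for the case b x < a x: with \<bar>b x - a x\<bar> < 1
    it yields 1 \<le> b x, as \<open>Phi_shift\<close> requires.\<close>
  have big: "\<forall>\<^sub>F x in F. 2 \<le> a x"
    using a by (simp add: filterlim_at_top)
  have lim: "((\<lambda>x. 2 * exp (3/2) * \<bar>a x * (b x - a x)\<bar>) \<longlongrightarrow> 0) F"
    using tendsto_mult_left[OF tendsto_rabs[OF assms(2)], of "2 * exp (3/2)"] by simp
  have small: "\<forall>\<^sub>F x in F. 2 * exp (3/2) * \<bar>a x * (b x - a x)\<bar> < 1/2"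
    using order_tendstoD(2)[OF lim, of "1/2"] by simp
  have "\<forall>\<^sub>F x in F. \<bar>Phi (- b x) / Phi (- a x) - 1\<bar> \<le> 2 * (2 * exp (3/2) * \<bar>a x * (b x - a x)\<bar>)"
    using big small
  proof eventually_elim
    case (elim x)
    have 0: "2 * (exp (3/2) * \<bar>a x * (b x - a x)\<bar>) < 1/2" using elim by simp
    have e: "1 \<le> exp (3/2 :: real)" by simp
    have "\<bar>b x - a x\<bar> * 1 \<le> \<bar>b x - a x\<bar> * (a x * exp (3/2))"
      using elim mult_mono[of 1 "a x" 1 "exp (3/2)"] by (intro mult_left_mono) auto
    also have "\<dots> = exp (3/2) * \<bar>a x * (b x - a x)\<bar>" using elim by (simp add: abs_mult)
    finally have h1: "\<bar>b x - a x\<bar> < 1" using 0 by simp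
    show ?case
    proof (cases "a x \<le> b x")
      case True
      have "(1 - exp (3/2) * (a x * (b x - a x))) * Phi (- a x) \<le> Phi (- b x)"
        using Phi_shift[of "a x" "b x - a x"] True elim by simp
      then have "1 - exp (3/2) * (a x * (b x - a x)) \<le> Phi (- b x) / Phi (- a x)"
        by (simp add: pos_le_divide_eq Phi_pos)
      moreover have "Phi (- b x) / Phi (- a x) \<le> 1"
        using Phi_mono[of "- b x" "- a x"] True by (simp add: Phi_pos)
      moreover have "0 \<le> exp (3/2) * (a x * (b x - a x))" using True elim by simp
      moreover have "\<bar>a x * (b x - a x)\<bar> = a x * (b x - a x)" using True elim by simp
      ultimately show ?thesis by simp
    next
      case False
      define e where "e = exp (3/2) * \<bar>a x * (b x - a x)\<bar>"
      have e: "0 \<le> e" "e < 1/4" using 0 by (auto simp: e_def)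
      have "(1 - exp (3/2) * (b x * (a x - b x))) * Phi (- b x) \<le> Phi (- a x)"
        using Phi_shift[of "b x" "a x - b x"] False elim h1 by simp
      moreover have "exp (3/2) * (b x * (a x - b x)) \<le> e"
        unfolding e_def abs_mult using False elim by (intro mult_left_mono mult_mono) auto
      ultimately have "(1 - e) * Phi (- b x) \<le> Phi (- a x)"
        by (smt (verit) mult_right_mono Phi_pos)
      then have "Phi (- b x) / Phi (- a x) \<le> 1 / (1 - e)"
        using e Phi_pos[of "- a x"] by (simp add: field_simps)
      also have "\<dots> \<le> 1 + 2 * e"
      proof -
        have "1 \<le> (1 + 2 * e) * (1 - e)" using mult_nonneg_nonneg[of e "1 - 2 * e"] e by (simp add: algebra_simps)
        then show ?thesis using e by (simp add: divide_le_eq)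
      qed
      finally have "Phi (- b x) / Phi (- a x) \<le> 1 + 2 * e" .
      moreover have "1 \<le> Phi (- b x) / Phi (- a x)"
        using Phi_mono[of "- a x" "- b x"] False by (simp add: Phi_pos)
      ultimately show ?thesis using e by (simp add: e_def)
    qed
  qed
  then have "((\<lambda>x. Phi (- b x) / Phi (- a x) - 1) \<longlongrightarrow> 0) F"
    unfolding real_norm_def[symmetric]
    by (rule Lim_null_comparison) (use tendsto_mult_left[OF lim, of 2] in simp)
  then show ?thesis by (simp add: LIM_zero_iff)
qed

text \<open>Expansions of the signal control squared distances, so the criterion is restated for
  squares: a \<bar>b - a\<bar> \<le> (b + a) \<bar>b - a\<bar> when b \<ge> 0.\<close>

lemma Phi_ratio_tendsto_sq:
  assumes a: "filterlim a at_top F" and "\<forall>\<^sub>F x in F. 0 \<le> b x" and "((\<lambda>x. (b x)\<^sup>2 - (a x)\<^sup>2) \<longlongrightarrow> 0) F"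
  shows "((\<lambda>x. Phi (- b x) / Phi (- a x)) \<longlongrightarrow> 1) F"
proof (rule Phi_ratio_tendsto[OF a])
  have "\<forall>\<^sub>F x in F. 0 \<le> a x"
    using a by (simp add: filterlim_at_top)
  with assms(2) have "\<forall>\<^sub>F x in F. norm (a x * (b x - a x)) \<le> \<bar>(b x)\<^sup>2 - (a x)\<^sup>2\<bar>"
  proof eventually_elim
    case (elim x)
    have "a x * \<bar>b x - a x\<bar> \<le> (b x + a x) * \<bar>b x - a x\<bar>" using elim by (intro mult_right_mono) auto
    moreover have "\<bar>(b x)\<^sup>2 - (a x)\<^sup>2\<bar> = (b x + a x) * \<bar>b x - a x\<bar>"
      using elim by (simp add: abs_mult power2_eq_square square_diff_square_factored)
    ultimately show ?case using elim by (simp add: abs_mult)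
  qed
  then show "((\<lambda>x. a x * (b x - a x)) \<longlongrightarrow> 0) F"
    by (rule Lim_null_comparison) (use tendsto_rabs[OF assms(3)] in simp)
qed

section \<open>Testing with a log-normal likelihood ratio\<close>

context prob_space
begin

lemma integrable_indicator_event[simp]: "A \<in> events \<Longrightarrow> integrable M (indicat_real A)"
  by (simp add: integrable_indicator_iff emeasure_eq_measure)

lemma prob_std_normal:
  assumes "distributed M lborel \<xi> std_normal_density" "B \<in> sets borel"
  shows "prob {x \<in> space M. \<xi> x \<in> B} = measure std_normal_distribution B"
proof -
  have "prob {x \<in> space M. \<xi> x \<in> B} = measure (distr M lborel \<xi>) B"
    using assms by (subst measure_distr) (auto simp: distributed_def intro!: arg_cong[where f=prob])
  then show ?thesis using assms(1) by (simp add: distributed_def)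
qed

text \<open>One-dimensional Cameron-Martin: the exponential weight moves the mean of a standard
  normal variable to c.\<close>

lemma nn_integral_tilt:
  assumes \<xi>: "distributed M lborel \<xi> std_normal_density" and B: "B \<in> sets borel"
  shows "(\<integral>\<^sup>+x. ennreal (indicator B (\<xi> x - c) * exp (c * \<xi> x - c\<^sup>2 / 2)) \<partial>M) = emeasure std_normal_distribution B"
proof -
  note B[measurable]
  have "(\<integral>\<^sup>+x. ennreal (indicator B (\<xi> x - c) * exp (c * \<xi> x - c\<^sup>2 / 2)) \<partial>M)
      = (\<integral>\<^sup>+x. std_normal_density x * ennreal (indicator B (x - c) * exp (c * x - c\<^sup>2 / 2)) \<partial>lborel)"
    by (rule distributed_nn_integral[OF \<xi>, symmetric]) simp
  also have "\<dots> = (\<integral>\<^sup>+x. ennreal (std_normal_density (x - c)) * indicator B (x - c) \<partial>lborel)"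
  proof (rule nn_integral_cong)
    fix x
    have "std_normal_density x * exp (c * x - c\<^sup>2 / 2) = std_normal_density (x - c)"
      by (simp add: std_normal_density_def exp_add[symmetric] power2_diff field_simps)
    then show "std_normal_density x * ennreal (indicator B (x - c) * exp (c * x - c\<^sup>2 / 2))
        = ennreal (std_normal_density (x - c)) * indicator B (x - c)"
      by (auto simp: ennreal_mult'[symmetric] split: split_indicator)
  qed
  also have "\<dots> = (\<integral>\<^sup>+x. ennreal (std_normal_density x) * indicator B x \<partial>lborel)"
    by (subst (2) nn_integral_real_affine[where c=1 and t="-c"]) auto
  also have "\<dots> = emeasure std_normal_distribution B"
    by (subst emeasure_density) auto
  finally show ?thesis .
qed

context
  fixes \<xi> :: "'a \<Rightarrow> real" and b :: real
  assumes \<xi>: "distributed M lborel \<xi> std_normal_density" and b: "0 \<le> b"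
begin

text \<open>The likelihood ratio of two unit-variance normal laws whose means are 2b apart. It
  crosses 1 at \<xi> = b, halfway between the means, so both errors of the likelihood ratio test
  equal \<open>Phi (- b)\<close>.\<close>

abbreviation (input) LR :: "'a \<Rightarrow> real" where
  "LR x \<equiv> exp (2 * b * \<xi> x - 2 * b\<^sup>2)"

lemma rv_\<xi>: "\<xi> \<in> borel_measurable M"
  using \<xi> by (simp add: distributed_def)

lemma integrable_LR: "integrable M LR"
proof -
  note rv_\<xi>[measurable]
  interpret N: real_distribution std_normal_distribution by (rule real_dist_normal_dist)
  have "(\<integral>\<^sup>+x. ennreal (LR x) \<partial>M) = emeasure std_normal_distribution UNIV"
    using nn_integral_tilt[OF \<xi>, of UNIV "2 * b"] by (simp add: power_mult_distrib)
  also have "\<dots> < \<infinity>" by (simp add: N.emeasure_eq_measure)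
  finally show ?thesis by (intro integrableI_nonneg) auto
qed

lemma integrable_LR_on: "A \<in> events \<Longrightarrow> integrable M (\<lambda>x. indicator A x * LR x)"
  using integrable_real_mult_indicator[OF _ integrable_LR] by (simp add: mult.commute)

lemma LR_acceptance: "(\<integral>x. indicator {x\<in>space M. \<xi> x \<le> b} x * LR x \<partial>M) = Phi (- b)"
proof -
  note rv_\<xi>[measurable]
  interpret N: real_distribution std_normal_distribution by (rule real_dist_normal_dist)
  have "ennreal (\<integral>x. indicator {x\<in>space M. \<xi> x \<le> b} x * LR x \<partial>M)
      = (\<integral>\<^sup>+x. ennreal (indicator {x\<in>space M. \<xi> x \<le> b} x * LR x) \<partial>M)"
    by (intro nn_integral_eq_integral[symmetric] integrable_LR_on) auto
  also have "\<dots> = (\<integral>\<^sup>+x. ennreal (indicator {..-b} (\<xi> x - 2 * b) * exp (2 * b * \<xi> x - (2 * b)\<^sup>2 / 2)) \<partial>M)"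
    by (intro nn_integral_cong) (auto simp: power_mult_distrib split: split_indicator)
  also have "\<dots> = emeasure std_normal_distribution {..-b}"
    by (rule nn_integral_tilt[OF \<xi>]) simp
  also have "\<dots> = ennreal (Phi (- b))"
    by (simp add: Phi_def cdf_def N.emeasure_eq_measure)
  finally show ?thesis
    using less_imp_le[OF Phi_pos] by (subst (asm) ennreal_inj) auto
qed

text \<open>Neyman-Pearson with the exact excess. Pointwise, a test pays at least min(1, LR), and it
  pays \<bar>1 - LR\<bar> more exactly where it disagrees with the likelihood ratio test. Dropping
  the excess gives the lower bound; keeping it gives stability.\<close>

lemma LR_test_decomposition:
  assumes A[measurable]: "A \<in> events"
  shows "prob A + (\<integral>x. indicator (space M - A) x * LR x \<partial>M)
    = 2 * Phi (- b) + (\<integral>x. indicator (sym_diff A {x\<in>space M. b < \<xi> x}) x * \<bar>1 - LR x\<bar> \<partial>M)"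
    and "integrable M (\<lambda>x. indicator (sym_diff A {x\<in>space M. b < \<xi> x}) x * \<bar>1 - LR x\<bar>)"
proof -
  note rv_\<xi>[measurable]
  note integrable_LR[simp]
  let ?N = "{x\<in>space M. b < \<xi> x}" and ?N' = "{x\<in>space M. \<xi> x \<le> b}"
  have int: "integrable M (\<lambda>x. \<bar>1 - LR x\<bar>)" by auto
  have [measurable]: "sym_diff A ?N \<in> events" by measurable
  from integrable_real_mult_indicator[OF this int]
  show 1: "integrable M (\<lambda>x. indicator (sym_diff A ?N) x * \<bar>1 - LR x\<bar>)"
    by (simp add: mult.commute)
  have pt: "indicator A x + indicator (space M - A) x * LR x
      = indicator ?N x + indicator ?N' x * LR x + indicator (sym_diff A ?N) x * \<bar>1 - LR x\<bar>"
    if "x \<in> space M" for x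
  proof -
    have "b < \<xi> x \<Longrightarrow> 1 \<le> LR x" using b by (simp add: power2_eq_square mult_left_mono)
    moreover have "\<xi> x \<le> b \<Longrightarrow> LR x \<le> 1" using b by (simp add: power2_eq_square mult_left_mono)
    ultimately show ?thesis using that by (auto split: split_indicator)
  qed
  have "prob A + (\<integral>x. indicator (space M - A) x * LR x \<partial>M)
      = (\<integral>x. indicator A x + indicator (space M - A) x * LR x \<partial>M)"
    using integrable_LR_on[of "space M - A"]
    by (subst Bochner_Integration.integral_add) auto
  also have "\<dots> = (\<integral>x. indicator ?N x + indicator ?N' x * LR x + indicator (sym_diff A ?N) x * \<bar>1 - LR x\<bar> \<partial>M)"
    by (intro Bochner_Integration.integral_cong refl pt)
  also have "\<dots> = prob ?N + (\<integral>x. indicator ?N' x * LR x \<partial>M) + (\<integral>x. indicator (sym_diff A ?N) x * \<bar>1 - LR x\<bar> \<partial>M)"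
    using integrable_LR_on[of "?N'"] 1 
    by (subst Bochner_Integration.integral_add, simp add: integrable_real_indicator, simp,
        subst Bochner_Integration.integral_add) auto
  also have "prob ?N = Phi (- b)"
    using prob_std_normal[OF \<xi>, of "{b<..}"] by (simp add: Phi_uminus')
  finally show "prob A + (\<integral>x. indicator (space M - A) x * LR x \<partial>M)
    = 2 * Phi (- b) + (\<integral>x. indicator (sym_diff A ?N) x * \<bar>1 - LR x\<bar> \<partial>M)"
    by (simp add: LR_acceptance)
qed

lemma LR_test_lower:
  assumes "A \<in> events"
  shows "2 * Phi (- b) \<le> prob A + (\<integral>x. indicator (space M - A) x * LR x \<partial>M)"
  unfolding LR_test_decomposition(1)[OF assms] by (auto intro!: Bochner_Integration.integral_nonneg)

text \<open>The event is a band around \<xi> = b of half-width d/(2b). Moving from b to b - r raises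
  the density at most by exp (1/2), and the width d/b cancels the factor b of
  \<open>density_le_Phi\<close>; the constant is exp (3/2) exp (1/2). So the band has small
  probability even relative to the error probability.\<close>

lemma prob_LR_near_1:
  assumes "1 \<le> b" "0 < d" "d \<le> 1"
  shows "prob {x\<in>space M. \<bar>2 * b * \<xi> x - 2 * b\<^sup>2\<bar> \<le> d} \<le> exp 2 * d * Phi (- b)"
proof -
  note rv_\<xi>[measurable]
  define r where "r = d / (2 * b)"
  have r: "0 < r" "2 * b * r = d"
    using assms by (auto simp: r_def field_simps)
  have "r \<le> 1 / (2 * 1)" unfolding r_def using assms by (intro frac_le) auto
  then have "r \<le> b" using assms by simp
  have eq: "\<bar>2 * b * z - 2 * b\<^sup>2\<bar> \<le> d \<longleftrightarrow> z \<in> {b - r..b + r}" for z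
  proof -
    have "\<bar>2 * b * z - 2 * b\<^sup>2\<bar> \<le> d \<longleftrightarrow> 2 * b * \<bar>z - b\<bar> \<le> 2 * b * r"
    proof -
      have "2 * b * z - 2 * b\<^sup>2 = 2 * b * (z - b)" by (simp add: algebra_simps power2_eq_square)
      then show ?thesis using assms r by (simp add: abs_mult)
    qed
    also have "\<dots> \<longleftrightarrow> \<bar>z - b\<bar> \<le> r" using assms by simp
    finally show ?thesis by auto
  qed
  have "prob {x\<in>space M. \<bar>2 * b * \<xi> x - 2 * b\<^sup>2\<bar> \<le> d} = measure std_normal_distribution {b - r..b + r}"
    unfolding eq by (rule prob_std_normal[OF \<xi>]) simp
  also have "\<dots> \<le> std_normal_density (b - r) * ((b + r) - (b - r))"
    using r \<open>r \<le> b\<close> by (intro measure_normal_le) (auto intro!: std_normal_density_antimono)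
  also have "\<dots> \<le> (std_normal_density b * exp (1/2)) * (d / b)"
  proof (rule mult_mono)
    have "(b - r)\<^sup>2 = b\<^sup>2 + r\<^sup>2 - d" using r by (simp add: power2_diff)
    then have "b\<^sup>2 - 1 \<le> (b - r)\<^sup>2" using assms zero_le_power2[of r] by linarith
    then have "- (b - r)\<^sup>2 / 2 \<le> - b\<^sup>2 / 2 + 1 / 2" by simp
    then have "exp (- (b - r)\<^sup>2 / 2) \<le> exp (- b\<^sup>2 / 2) * exp (1 / 2)"
      by (simp add: exp_add[symmetric])
    then show "std_normal_density (b - r) \<le> std_normal_density b * exp (1/2)"
      by (simp add: std_normal_density_def divide_right_mono)
    show "b + r - (b - r) \<le> d / b" using assms by (simp add: r_def)
  qed (use r in auto)
  also have "\<dots> \<le> (exp (3/2) * b * Phi (- b) * exp (1/2)) * (d / b)"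
    using assms density_le_Phi[OF assms(1)] by (intro mult_right_mono) auto
  also have "\<dots> = exp 2 * d * Phi (- b)"
  proof -
    have "exp (3/2) * exp (1/2) = exp (2 :: real)" by (simp add: exp_add[symmetric])
    then show ?thesis using assms by (simp add: field_simps)
  qed
  finally show ?thesis .
qed

text \<open>Disagreement within the band around LR = 1 costs almost nothing but is improbable.
  Outside the band each unit of disagreement costs at least d/2 of excess, so a Markov bound with
  the slack s applies.\<close>

lemma LR_test_stability:
  assumes A[measurable]: "A \<in> events" and "1 \<le> b" "0 < d" "d \<le> 1"
    and slack: "prob A + (\<integral>x. indicator (space M - A) x * LR x \<partial>M) \<le> 2 * Phi (- b) + s"
  shows "prob (sym_diff A {x\<in>space M. b < \<xi> x}) \<le> exp 2 * d * Phi (- b) + 2 / d * s"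
proof -
  note rv_\<xi>[measurable]
  let ?D = "sym_diff A {x\<in>space M. b < \<xi> x}"
  let ?E = "{x\<in>space M. \<bar>2 * b * \<xi> x - 2 * b\<^sup>2\<bar> \<le> d}"
  have [measurable]: "?D \<in> events" by measurable
  have s: "(\<integral>x. indicator ?D x * \<bar>1 - LR x\<bar> \<partial>M) \<le> s"
    using slack unfolding LR_test_decomposition(1)[OF A] by simp
  note int = LR_test_decomposition(2)[OF A]
  have pt: "indicator ?D x \<le> indicator ?E x + 2 / d * (indicator ?D x * \<bar>1 - LR x\<bar>)"
    if "x \<in> space M" for x
  proof (cases "x \<in> ?E")
    case False
    define z where "z = 2 * b * \<xi> x - 2 * b\<^sup>2"
    have "d < \<bar>z\<bar>" using False that by (auto simp: z_def)
    \<comment> \<open>For positive z convexity even gives d; the factor 1/2 comes from the negative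
      side, where 1 - exp (-d) \<ge> d/(1 + d) and d \<le> 1.\<close>
    have "d / 2 \<le> \<bar>1 - exp z\<bar>"
    proof (cases "0 \<le> z")
      case True
      then have "d \<le> exp z - 1" using exp_ge_add_one_self[of z] \<open>d < \<bar>z\<bar>\<close> by linarith
      then show ?thesis using assms(3) by linarith
    next
      case False
      have "exp z \<le> exp (- d)" using False \<open>d < \<bar>z\<bar>\<close> by simp
      also have "\<dots> \<le> 1 / (1 + d)"
        using exp_ge_add_one_self[of d] assms by (simp add: exp_minus field_simps)
      also have "\<dots> \<le> 1 - d / 2" using assms mult_right_mono[of d 1 d] by (simp add: field_simps)
      finally show ?thesis using assms(3) by linarith
    qed
    then have "1 \<le> 2 / d * \<bar>1 - exp z\<bar>" using assms by (simp add: field_simps)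
    then show ?thesis by (auto simp: z_def split: split_indicator)
  qed (use assms in \<open>auto split: split_indicator\<close>)
  have "prob ?D = (\<integral>x. indicator ?D x \<partial>M)" by simp
  also have "\<dots> \<le> (\<integral>x. indicator ?E x + 2 / d * (indicator ?D x * \<bar>1 - LR x\<bar>) \<partial>M)"
    using int pt by (intro integral_mono Bochner_Integration.integrable_add) auto
  also have "\<dots> = prob ?E + 2 / d * (\<integral>x. indicator ?D x * \<bar>1 - LR x\<bar> \<partial>M)"
    using int by (subst Bochner_Integration.integral_add) auto
  also have "\<dots> \<le> exp 2 * d * Phi (- b) + 2 / d * s"
    using assms s prob_LR_near_1 by (intro add_mono mult_left_mono) auto
  finally show ?thesis .
qed

text \<open>Cauchy-Schwarz with the second moment exp (4 b^2) of the likelihood ratio. The bound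
  depends on b only, so it survives refinement of the observation times.\<close>

lemma LR_integral_le:
  assumes A[measurable]: "A \<in> events"
  shows "(\<integral>x. indicator A x * LR x \<partial>M) \<le> exp (2 * b\<^sup>2) * sqrt (prob A)"
proof -
  note rv_\<xi>[measurable]
  interpret N: real_distribution std_normal_distribution by (rule real_dist_normal_dist)
  have "(\<integral>\<^sup>+x. ennreal (LR x)^2 \<partial>M)
      = (\<integral>\<^sup>+x. ennreal (exp (4 * b\<^sup>2)) * ennreal (indicator UNIV (\<xi> x - 4 * b) * exp (4 * b * \<xi> x - (4 * b)\<^sup>2 / 2)) \<partial>M)"
    by (intro nn_integral_cong)
      (simp add: ennreal_mult'[symmetric] power2_eq_square exp_add[symmetric])
  also have "\<dots> = ennreal (exp (4 * b\<^sup>2))"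
    using N.emeasure_space_1 by (subst nn_integral_cmult, simp, subst nn_integral_tilt[OF \<xi>]) auto
  finally have L2: "(\<integral>\<^sup>+x. ennreal (LR x)^2 \<partial>M) = ennreal (exp (4 * b\<^sup>2))" .
  have "(ennreal (\<integral>x. indicator A x * LR x \<partial>M))^2 = (\<integral>\<^sup>+x. ennreal (indicator A x * LR x) \<partial>M)^2"
    by (subst nn_integral_eq_integral[OF integrable_LR_on]) auto
  also have "(\<integral>\<^sup>+x. ennreal (indicator A x * LR x) \<partial>M) = (\<integral>\<^sup>+x. indicator A x * ennreal (LR x) \<partial>M)"
    by (intro nn_integral_cong) (auto split: split_indicator)
  also have "\<dots>^2 \<le> (\<integral>\<^sup>+x. (indicator A x)^2 \<partial>M) * (\<integral>\<^sup>+x. ennreal (LR x)^2 \<partial>M)"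
    by (rule Cauchy_Schwarz_nn_integral) auto
  also have "(\<integral>\<^sup>+x. (indicator A x)^2 \<partial>M) = ennreal (prob A)"
  proof -
    have "(\<integral>\<^sup>+x. (indicator A x)^2 \<partial>M) = (\<integral>\<^sup>+x. indicator A x \<partial>M)"
      by (intro nn_integral_cong) (auto split: split_indicator)
    then show ?thesis by (simp add: emeasure_eq_measure)
  qed
  also have "ennreal (prob A) * (\<integral>\<^sup>+x. ennreal (LR x)^2 \<partial>M) = ennreal ((exp (2 * b\<^sup>2) * sqrt (prob A))\<^sup>2)"
    unfolding L2 by (simp add: ennreal_mult'[symmetric] power_mult_distrib exp_double[symmetric] mult.commute)
  finally have "(\<integral>x. indicator A x * LR x \<partial>M)^2 \<le> (exp (2 * b\<^sup>2) * sqrt (prob A))\<^sup>2"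
    by (simp add: ennreal_power)
  then show ?thesis by (rule power2_le_imp_le) simp
qed

end
end

section \<open>Square integrable functions and their drifts\<close>

definition ip :: "(real \<Rightarrow> real) \<Rightarrow> (real \<Rightarrow> real) \<Rightarrow> real" where
  "ip f g = (\<integral>t. f t * g t \<partial>unit_leb)"

lemma finite_measure_unit_leb: "finite_measure unit_leb"
  by (rule finite_measure_lebesgue_on) simp

lemma L2_measurable[measurable_dest]: "L2 f \<Longrightarrow> f \<in> borel_measurable unit_leb"
  by (simp add: L2_def)

lemma L2_integrable_mult:
  assumes "L2 f" "L2 g"
  shows "integrable unit_leb (\<lambda>t. f t * g t)"
proof (rule Bochner_Integration.integrable_bound)
  show "integrable unit_leb (\<lambda>t. (f t)\<^sup>2 + (g t)\<^sup>2)"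
    using assms by (simp add: L2_def)
  show "AE t in unit_leb. norm (f t * g t) \<le> norm ((f t)\<^sup>2 + (g t)\<^sup>2)"
  proof (rule AE_I2)
    fix t
    have "2 * (\<bar>f t\<bar> * \<bar>g t\<bar>) \<le> (f t)\<^sup>2 + (g t)\<^sup>2"
      using sum_squares_bound[of "\<bar>f t\<bar>" "\<bar>g t\<bar>"] by simp
    moreover have "0 \<le> \<bar>f t\<bar> * \<bar>g t\<bar>" by simp
    ultimately show "norm (f t * g t) \<le> norm ((f t)\<^sup>2 + (g t)\<^sup>2)"
      unfolding real_norm_def abs_mult by linarith
  qed
qed (use assms in measurable)

lemma L2_const[simp]: "L2 (\<lambda>t. c)"
  using finite_measure.integrable_const[OF finite_measure_unit_leb] by (simp add: L2_def)

lemma L2_cmult: "L2 f \<Longrightarrow> L2 (\<lambda>t. c * f t)"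
  by (auto simp: L2_def power_mult_distrib)

lemma L2_add:
  assumes "L2 f" "L2 g"
  shows "L2 (\<lambda>t. f t + g t)"
proof -
  have "integrable unit_leb (\<lambda>t. (f t)\<^sup>2 + (g t)\<^sup>2 + 2 * (f t * g t))"
    using assms L2_integrable_mult[OF assms] by (simp add: L2_def)
  moreover have "(\<lambda>t. (f t)\<^sup>2 + (g t)\<^sup>2 + 2 * (f t * g t)) = (\<lambda>t. (f t + g t)\<^sup>2)"
    by (simp add: power2_sum mult.assoc)
  moreover have "(\<lambda>t. f t + g t) \<in> borel_measurable unit_leb" using assms by measurable
  ultimately show ?thesis unfolding L2_def by metis
qed

lemma L2_diff: "L2 f \<Longrightarrow> L2 g \<Longrightarrow> L2 (\<lambda>t. f t - g t)"
  using L2_add[of f "\<lambda>t. (-1) * g t"] L2_cmult[of g "-1"] by simp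

lemma L2_sum: "(\<And>i. i \<in> J \<Longrightarrow> L2 (f i)) \<Longrightarrow> L2 (\<lambda>t. \<Sum>i\<in>J. f i t)"
  by (induction J rule: infinite_finite_induct) (auto intro: L2_add)

lemma L2_indicator[simp]: "L2 (indicator {a<..b})"
proof -
  have *: "(indicator {a<..b} :: real \<Rightarrow> real) \<in> borel_measurable unit_leb"
    by (intro measurable_restrict_space1 measurable_completion) simp
  have "integrable unit_leb (\<lambda>t. (indicator {a<..b} t :: real)\<^sup>2)"
    by (rule finite_measure.integrable_const_bound[OF finite_measure_unit_leb, where B=1])
      (use * in \<open>auto split: split_indicator\<close>)
  with * show ?thesis by (simp add: L2_def)
qed

lemma ip_commute: "ip f g = ip g f"
  by (simp add: ip_def mult.commute)

lemma ip_self: "ip f f = (\<integral>t. (f t)\<^sup>2 \<partial>unit_leb)"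
  by (simp add: ip_def power2_eq_square)

lemma ip_self_nonneg: "0 \<le> ip f f"
  by (simp add: ip_def)

lemma ip_add_right: "L2 f \<Longrightarrow> L2 g \<Longrightarrow> L2 h \<Longrightarrow> ip f (\<lambda>t. g t + h t) = ip f g + ip f h"
  by (simp add: ip_def distrib_left L2_integrable_mult)

lemma ip_diff_right: "L2 f \<Longrightarrow> L2 g \<Longrightarrow> L2 h \<Longrightarrow> ip f (\<lambda>t. g t - h t) = ip f g - ip f h"
  by (simp add: ip_def right_diff_distrib L2_integrable_mult)

lemma ip_cmult_right: "ip f (\<lambda>t. c * g t) = c * ip f g"
  by (simp add: ip_def mult.left_commute)

lemma ip_sum_right: "L2 f \<Longrightarrow> (\<And>i. i \<in> J \<Longrightarrow> L2 (g i)) \<Longrightarrow> ip f (\<lambda>t. \<Sum>i\<in>J. g i t) = (\<Sum>i\<in>J. ip f (g i))"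
  by (simp add: ip_def sum_distrib_left L2_integrable_mult)

lemmas ip_add_left = ip_add_right[unfolded ip_commute[of _ "\<lambda>t. _ t + _ t"]]
  and ip_cmult_left = ip_cmult_right[unfolded ip_commute[of _ "\<lambda>t. _ * _ t"]]

lemma ip_diff_left: "L2 f \<Longrightarrow> L2 g \<Longrightarrow> L2 h \<Longrightarrow> ip (\<lambda>t. g t - h t) f = ip g f - ip h f"
  using ip_diff_right[of f g h] by (simp add: ip_commute)

lemma ip_Cauchy_Schwarz:
  assumes "L2 f" "L2 g"
  shows "(ip f g)\<^sup>2 \<le> ip f f * ip g g"
proof -
  define A B C where "A = ip f f" and "B = ip g g" and "C = ip f g"
  have quad: "0 \<le> x\<^sup>2 * A + 2 * x * y * C + y\<^sup>2 * B" for x y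
  proof -
    have "0 \<le> (\<integral>t. (x * f t + y * g t)\<^sup>2 \<partial>unit_leb)" by simp
    also have "\<dots> = (\<integral>t. x\<^sup>2 * (f t * f t) + 2 * x * y * (f t * g t) + y\<^sup>2 * (g t * g t) \<partial>unit_leb)"
      by (intro Bochner_Integration.integral_cong) (auto simp: power2_eq_square algebra_simps)
    also have "\<dots> = x\<^sup>2 * A + 2 * x * y * C + y\<^sup>2 * B"
      using assms by (simp add: L2_integrable_mult A_def B_def C_def ip_def)
    finally show ?thesis .
  qed
  have AB: "0 \<le> A" "0 \<le> B" by (simp_all add: A_def B_def ip_self_nonneg)
  show ?thesis
  proof (cases "B = 0")
    case True
    have "C = 0"
    proof (rule ccontr)
      assume "C \<noteq> 0"
      \<comment> \<open>With B = 0 the form is linear in y, and this y makes it equal to -1.\<close>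
      then show False using quad[of 1 "- (A + 1) / (2 * C)"] True by (simp add: field_simps)
    qed
    then show ?thesis using True by (simp flip: A_def B_def C_def)
  next
    case False
    have "0 \<le> B * (A * B - C\<^sup>2)" using quad[of B "- C"] by (simp add: power2_eq_square algebra_simps)
    then have "0 \<le> A * B - C\<^sup>2" using False AB by (simp add: zero_le_mult_iff)
    then show ?thesis by (simp flip: A_def B_def C_def)
  qed
qed

lemma abs_ip_le: "L2 f \<Longrightarrow> L2 g \<Longrightarrow> \<bar>ip f g\<bar> \<le> sqrt (ip f f) * sqrt (ip g g)"
  using real_sqrt_le_mono[OF ip_Cauchy_Schwarz[of f g]] by (simp add: real_sqrt_mult)

lemma ip_indicators:
  assumes "0 \<le> s" "s \<le> t" "t \<le> 1"
  shows "ip (indicator {s<..t}) (indicator {s<..t}) = t - s"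
proof -
  have "ip (indicator {s<..t}) (indicator {s<..t}) = (\<integral>x. indicator {0<..<1} x * indicator {s<..t} x \<partial>lebesgue)"
    unfolding ip_def by (subst integral_restrict_space)
      (auto intro!: Bochner_Integration.integral_cong split: split_indicator)
  also have "\<dots> = (\<integral>x. indicator {s<..<t} x \<partial>lebesgue)"
  proof (rule integral_cong_AE)
    have ae: "AE x in lebesgue. x \<notin> {t}" by (rule AE_not_in) simp
     show "AE x in lebesgue. indicator {0<..<1} x * indicator {s<..t} x = (indicator {s<..<t} x :: real)"
      by (rule AE_mp[OF ae]) (use assms in \<open>auto split: split_indicator\<close>)
    have [measurable]: "(indicator A :: real \<Rightarrow> real) \<in> borel_measurable lebesgue" if "A \<in> sets borel" for A
      using that by (intro measurable_completion) simp
    show "(\<lambda>x. indicator {0<..<1} x * indicator {s<..t} x :: real) \<in> borel_measurable lebesgue"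
      and "(indicator {s<..<t} :: real \<Rightarrow> real) \<in> borel_measurable lebesgue"
      by simp_all
  qed
  also have "\<dots> = t - s" using assms by simp
  finally show ?thesis .
qed

text \<open>The bridge from paths to the Hilbert space: values of a drift become inner products. The
  interval is half-open so that the indicators of neighbouring cells add up without overlap.\<close>

lemma drift_eq_ip:
  assumes "L2 f" "0 \<le> t" "t \<le> 1"
  shows "drift f t = ip f (indicator {0<..t})"
proof -
  have "drift f t = (\<integral>x. indicator {0<..<t} x *\<^sub>R f x \<partial>lebesgue)"
    unfolding drift_def by (subst integral_restrict_space) auto
  also have "\<dots> = (\<integral>x. indicator {0<..<1} x *\<^sub>R (f x * indicator {0<..t} x) \<partial>lebesgue)"
  proof (rule integral_cong_AE)
    have ae: "AE x in lebesgue. x \<notin> {t}" by (rule AE_not_in) simp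
     show "AE x in lebesgue. indicator {0<..<t} x *\<^sub>R f x = indicator {0<..<1} x *\<^sub>R (f x * indicator {0<..t} x)"
      by (rule AE_mp[OF ae]) (use assms(2,3) in \<open>auto split: split_indicator\<close>)
    have f: "(\<lambda>x. indicator {0<..<1} x *\<^sub>R f x) \<in> borel_measurable lebesgue"
      using L2_measurable[OF assms(1)] by (subst (asm) borel_measurable_restrict_space_iff) auto
    have [measurable]: "(indicator A :: real \<Rightarrow> real) \<in> borel_measurable lebesgue" if "A \<in> sets borel" for A
      using that by (intro measurable_completion) simp
    have "(\<lambda>x. indicator {0<..t} x * (indicator {0<..<1} x *\<^sub>R f x)) \<in> borel_measurable lebesgue"
      by (intro borel_measurable_times f) simp
    then show "(\<lambda>x. indicator {0<..<1} x *\<^sub>R (f x * indicator {0<..t} x)) \<in> borel_measurable lebesgue"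
      by (simp add: ac_simps)
    have "(\<lambda>x. indicator {0<..<t} x * (indicator {0<..<1} x *\<^sub>R f x)) \<in> borel_measurable lebesgue"
      by (intro borel_measurable_times f) simp
    moreover have "(\<lambda>x. indicator {0<..<t} x * (indicator {0<..<1} x *\<^sub>R f x)) = (\<lambda>x. indicator {0<..<t} x *\<^sub>R f x)"
      using assms(2,3) by (auto split: split_indicator)
    ultimately show "(\<lambda>x. indicator {0<..<t} x *\<^sub>R f x) \<in> borel_measurable lebesgue" by simp
  qed
  also have "\<dots> = ip f (indicator {0<..t})"
    unfolding ip_def by (subst integral_restrict_space) auto
  finally show ?thesis .
qed

lemma drift_increment:
  assumes "L2 f" "0 \<le> s" "s \<le> t" "t \<le> 1"
  shows "drift f t - drift f s = ip f (indicator {s<..t})"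
proof -
  have "(\<lambda>x. indicator {0<..t} x - indicator {0<..s} x) = (indicator {s<..t} :: real \<Rightarrow> real)"
    using assms by (auto split: split_indicator)
  then have "ip f (indicator {s<..t}) = ip f (indicator {0<..t}) - ip f (indicator {0<..s})"
    using ip_diff_right[OF assms(1) L2_indicator L2_indicator, of 0 t 0 s] by simp
  then show ?thesis using assms by (simp add: drift_eq_ip)
qed

lemma drift_0[simp]: "drift f 0 = 0"
  by (simp add: drift_def integral_restrict_space)

lemma drift_diff: "L2 f \<Longrightarrow> L2 g \<Longrightarrow> 0 \<le> t \<Longrightarrow> t \<le> 1 \<Longrightarrow> drift (\<lambda>x. f x - g x) t = drift f t - drift g t"
  by (simp add: drift_eq_ip L2_diff ip_diff_left)

text \<open>Cauchy-Schwarz makes the drift Hoelder continuous of order 1/2, which puts the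
  observation into the space of continuous paths.\<close>

lemma continuous_on_drift:
  assumes "L2 f"
  shows "continuous_on {0..1} (drift f)"
proof -
  have *: "\<bar>drift f t - drift f s\<bar> \<le> sqrt (ip f f) * sqrt \<bar>t - s\<bar>" if "s \<in> {0..1}" "t \<in> {0..1}" for s t
  proof -
    have "\<bar>drift f t - drift f s\<bar> \<le> sqrt (ip f f) * sqrt \<bar>t - s\<bar>" if "0 \<le> s" "s \<le> t" "t \<le> 1" for s t
      using abs_ip_le[OF assms L2_indicator, of s t] that assms by (simp add: drift_increment ip_indicators)
    from this[of s t] this[of t s] that show ?thesis
      by (cases "s \<le> t") (auto simp: abs_minus_commute)
  qed
  show ?thesis unfolding continuous_on_def
  proof (intro ballI)
    fix s :: real assume s: "s \<in> {0..1}"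
    have "((\<lambda>t. sqrt (ip f f) * sqrt \<bar>t - s\<bar>) \<longlongrightarrow> sqrt (ip f f) * sqrt \<bar>s - s\<bar>) (at s within {0..1})"
      by (intro tendsto_intros)
    then have lim: "((\<lambda>t. sqrt (ip f f) * sqrt \<bar>t - s\<bar>) \<longlongrightarrow> 0) (at s within {0..1})" by simp
    have "\<forall>\<^sub>F t in at s within {0..1}. norm (drift f t - drift f s) \<le> sqrt (ip f f) * sqrt \<bar>t - s\<bar>"
      unfolding eventually_at_filter using *[OF s] by auto
    from Lim_null_comparison[OF this lim]
    show "(drift f \<longlongrightarrow> drift f s) (at s within {0..1})" by (simp add: LIM_zero_iff)
  qed
qed

section \<open>Step functions on a partition and the energy seen through increments\<close>

context
  fixes n :: nat and t :: "nat \<Rightarrow> real"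
  assumes t: "\<And>i. i < n \<Longrightarrow> t i < t (Suc i)" "t 0 = 0" "t n \<le> 1"
begin

abbreviation (input) step :: "(nat \<Rightarrow> real) \<Rightarrow> real \<Rightarrow> real" where
  "step c s \<equiv> (\<Sum>i<n. c i * indicator {t i<..t (Suc i)} s)"

lemma partition_mono: "i \<le> j \<Longrightarrow> j \<le> n \<Longrightarrow> t i \<le> t j"
proof (induction rule: dec_induct)
  case (step m)
  then show ?case using t(1)[of m] by simp
qed simp

lemma partition_strict: "i < j \<Longrightarrow> j \<le> n \<Longrightarrow> t i < t j"
  using t(1)[of i] partition_mono[of "Suc i" j] by simp

lemma partition_bounds: "i \<le> n \<Longrightarrow> 0 \<le> t i \<and> t i \<le> 1"
  using partition_mono[of 0 i] partition_mono[of i n] t by auto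

lemma L2_step: "L2 (step c)"
  by (intro L2_sum L2_cmult L2_indicator)

lemma ip_step:
  assumes "L2 h"
  shows "ip h (step c) = (\<Sum>i<n. c i * (drift h (t (Suc i)) - drift h (t i)))"
proof -
  have "ip h (step c) = (\<Sum>i<n. c i * ip h (indicator {t i<..t (Suc i)}))"
    using assms by (subst ip_sum_right) (auto intro: L2_cmult simp: ip_cmult_right)
  also have "\<dots> = (\<Sum>i<n. c i * (drift h (t (Suc i)) - drift h (t i)))"
  proof (intro sum.cong refl)
    fix i assume "i \<in> {..<n}"
    then show "c i * ip h (indicator {t i<..t (Suc i)}) = c i * (drift h (t (Suc i)) - drift h (t i))"
      using partition_bounds[of i] partition_bounds[of "Suc i"] t(1)[of i]
      by (subst drift_increment[OF assms]) auto
  qed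
  finally show ?thesis .
qed

lemma disjoint_cells: "i < n \<Longrightarrow> j < n \<Longrightarrow> x \<in> {t i<..t (Suc i)} \<Longrightarrow> x \<in> {t j<..t (Suc j)} \<Longrightarrow> i = j"
  using partition_mono[of "Suc i" j] partition_mono[of "Suc j" i]
  by (cases i j rule: linorder_cases) auto

lemma step_on_cell:
  assumes "j < n" and x: "x \<in> {t j<..t (Suc j)}"
  shows "step c x = c j"
proof -
  have "step c x = (\<Sum>i<n. if i = j then c j else 0)"
  proof (intro sum.cong refl)
    fix i assume "i \<in> {..<n}"
    then have "i = j" if "x \<in> {t i<..t (Suc i)}"
      using disjoint_cells[OF _ assms(1) that x] by simp
    then show "c i * indicator {t i<..t (Suc i)} x = (if i = j then c j else 0)"
      using x by (cases "i = j") (auto simp: indicator_def simp del: greaterThanAtMost_iff)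
  qed
  then show ?thesis using assms(1) by (simp add: sum.delta)
qed

lemma step_increment:
  assumes "j < n"
  shows "drift (step c) (t (Suc j)) - drift (step c) (t j) = c j * (t (Suc j) - t j)"
proof -
  have "drift (step c) (t (Suc j)) - drift (step c) (t j) = ip (step c) (indicator {t j<..t (Suc j)})"
    using assms partition_bounds[of j] partition_bounds[of "Suc j"] t(1)[of j]
    by (intro drift_increment L2_step) auto
  also have "\<dots> = ip (indicator {t j<..t (Suc j)}) (\<lambda>x. c j * indicator {t j<..t (Suc j)} x)"
    unfolding ip_def
  proof (intro Bochner_Integration.integral_cong refl)
    fix x
    note step_on_cell[OF assms, of x c]
    then show "step c x * indicator {t j<..t (Suc j)} x = indicator {t j<..t (Suc j)} x * (c j * indicator {t j<..t (Suc j)} x)"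
      by (cases "x \<in> {t j<..t (Suc j)}") (simp_all only: indicator_simps not_False_eq_True not_True_eq_False simp_thms mult_zero_left mult_zero_right mult_1_left mult_1_right)
  qed
  also have "\<dots> = c j * (t (Suc j) - t j)"
    using assms partition_bounds[of j] partition_bounds[of "Suc j"] t(1)[of j]
    by (simp add: ip_cmult_right ip_indicators)
  finally show ?thesis .
qed

lemma ip_step_step: "ip (step c) (step c) = (\<Sum>i<n. (c i)\<^sup>2 * (t (Suc i) - t i))"
  unfolding ip_step[OF L2_step]
  by (intro sum.cong refl) (unfold lessThan_iff step_increment power2_eq_square mult.assoc, rule refl)

text \<open>Bessel's inequality: the left side is the squared norm of the projection of h onto the
  step functions of the partition. The step function of mean slopes has this number both as its
  squared norm and as its inner product with h. Hence observing at finitely many times never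
  separates two signals better than the whole path does.\<close>

lemma sum_increments_le:
  assumes "L2 h"
  shows "(\<Sum>i<n. (drift h (t (Suc i)) - drift h (t i))\<^sup>2 / (t (Suc i) - t i)) \<le> ip h h"
proof -
  define c where "c i = (drift h (t (Suc i)) - drift h (t i)) / (t (Suc i) - t i)" for i
  let ?V = "\<Sum>i<n. (drift h (t (Suc i)) - drift h (t i))\<^sup>2 / (t (Suc i) - t i)"
  have 1: "ip h (step c) = ?V"
    unfolding ip_step[OF assms] by (simp add: c_def power2_eq_square)
  have 2: "ip (step c) (step c) = ?V"
    unfolding ip_step_step
  proof (intro sum.cong refl)
    fix i assume "i \<in> {..<n}"
    then have "t (Suc i) - t i \<noteq> 0" using t(1)[of i] by simp
    then show "(c i)\<^sup>2 * (t (Suc i) - t i) = (drift h (t (Suc i)) - drift h (t i))\<^sup>2 / (t (Suc i) - t i)"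
      by (simp add: c_def power2_eq_square)
  qed
  have "0 \<le> ?V" using ip_self_nonneg[of "step c"] unfolding 2 .
  moreover have "?V * ?V \<le> ?V * ip h h"
    using ip_Cauchy_Schwarz[OF assms L2_step[of c]] unfolding 1 2 by (simp add: power2_eq_square mult.commute)
  ultimately show ?thesis
    using ip_self_nonneg[of h] mult_le_cancel_left_pos[of ?V ?V "ip h h"] by (cases "?V = 0") auto
qed

end

section \<open>Likelihood ratios on finitely many observation times\<close>

lemma space_path_space: "y \<in> space path_space \<longleftrightarrow> y \<in> extensional {0..1} \<and> continuous_on {0..1} y"
  by (auto simp: path_space_def space_restrict_space space_PiM PiE_def)

lemma measurable_coordinate: "t \<in> {0..1} \<Longrightarrow> (\<lambda>y. y t) \<in> borel_measurable path_space"
  unfolding path_space_def by (intro measurable_restrict_space1 measurable_component_singleton)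

locale white_noise =
  fixes M :: "'a measure" and W :: "real \<Rightarrow> 'a \<Rightarrow> real" and \<epsilon> :: real
  assumes W: "wiener_process M W" and \<epsilon>: "0 < \<epsilon>"

sublocale white_noise \<subseteq> prob_space M
  using W by (simp add: wiener_process_def)

context white_noise
begin

abbreviation law :: "(real \<Rightarrow> real) \<Rightarrow> (real \<Rightarrow> real) measure" where
  "law \<equiv> observation_law M W \<epsilon>"

definition path :: "(real \<Rightarrow> real) \<Rightarrow> 'a \<Rightarrow> real \<Rightarrow> real" where
  "path f \<omega> = (\<lambda>t\<in>{0..1}. drift f t + \<epsilon> * W t \<omega>)"

lemma W_measurable[measurable]: "t \<in> {0..1} \<Longrightarrow> W t \<in> borel_measurable M"
  using W by (simp add: wiener_process_def)

lemma path_measurable: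
  assumes "L2 f"
  shows "path f \<in> measurable M path_space"
  unfolding path_space_def
proof (rule measurable_restrict_space2)
  show "path f \<in> space M \<rightarrow> {y. continuous_on {0..1} y}"
  proof
    fix \<omega> assume "\<omega> \<in> space M"
    then have "continuous_on {0..1} (\<lambda>t. drift f t + \<epsilon> * W t \<omega>)"
      using W by (intro continuous_intros continuous_on_drift[OF assms]) (simp add: wiener_process_def)
    then show "path f \<omega> \<in> {y. continuous_on {0..1} y}"
      by (simp add: path_def cong: continuous_on_cong_simp)
  qed
  show "path f \<in> measurable M (Pi\<^sub>M {0..1} (\<lambda>_. borel))"
    unfolding path_def[abs_def] by (intro measurable_restrict borel_measurable_add borel_measurable_times) auto
qed

lemma law_eq: "law f = distr M path_space (path f)"
  by (simp add: observation_law_def path_def[abs_def])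

lemma sets_law[simp]: "sets (law f) = sets path_space"
  and space_law[simp]: "space (law f) = space path_space"
  by (simp_all add: law_eq)

lemma measurable_law[simp]: "measurable (law f) N = measurable path_space N"
  by (rule measurable_cong_sets) auto

lemma prob_space_law: "L2 f \<Longrightarrow> prob_space (law f)"
  unfolding law_eq by (rule prob_space_distr) (rule path_measurable)

lemma distributed_law:
  assumes "L2 f" "Y \<in> borel_measurable path_space"
  shows "distributed (law f) lborel Y D \<longleftrightarrow> distributed M lborel (\<lambda>\<omega>. Y (path f \<omega>)) D"
proof -
  have "distr (law f) lborel Y = distr M lborel (Y \<circ> path f)"
    unfolding law_eq using assms by (intro distr_distr path_measurable) auto
  moreover have "(\<lambda>\<omega>. Y (path f \<omega>)) \<in> measurable M lborel"
    using measurable_compose[OF path_measurable[OF assms(1)] assms(2)] by simp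
  ultimately show ?thesis using assms by (simp add: distributed_def comp_def)
qed

text \<open>Increments determine a path at the partition points only up to its starting value; this
  removes the ambiguity almost surely.\<close>

lemma AE_law_0:
  assumes "L2 f"
  shows "AE y in law f. y 0 = 0"
proof -
  have "(\<lambda>y. y 0) -` {0} \<inter> space path_space \<in> sets path_space"
    by (rule measurable_sets[OF measurable_coordinate]) auto
  moreover have "(\<lambda>y. y 0) -` {0} \<inter> space path_space = {y \<in> space path_space. y 0 = 0}" by auto
  ultimately have "{y \<in> space path_space. y 0 = 0} \<in> sets path_space" by simp
  then show ?thesis
    using W unfolding law_eq
    by (subst AE_distr_iff[OF path_measurable[OF assms]]) (auto simp: path_def wiener_process_def)
qed

lemma increment_distributed:
  assumes "0 \<le> s" "s < t" "t \<le> 1"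
  shows "distributed M lborel (\<lambda>\<omega>. W t \<omega> - W s \<omega>) (normal_density 0 (sqrt (t - s)))"
  using W assms unfolding wiener_process_def by blast

definition incr :: "nat \<Rightarrow> (nat \<Rightarrow> real) \<Rightarrow> (real \<Rightarrow> real) \<Rightarrow> nat \<Rightarrow> real" where
  "incr n t y = (\<lambda>i\<in>{..<n}. y (t (Suc i)) - y (t i))"

context
  fixes n :: nat and t :: "nat \<Rightarrow> real"
  assumes t: "\<And>i. i < n \<Longrightarrow> t i < t (Suc i)" "t 0 = 0" "t n \<le> 1"
begin

lemma indep_increments: "indep_vars (\<lambda>_. borel) (\<lambda>i \<omega>. W (t (Suc i)) \<omega> - W (t i) \<omega>) {..<n}"
proof -
  have "0 \<le> t 0 \<and> (\<forall>i<n. t i \<le> t (Suc i)) \<and> t n \<le> 1" using t by (auto intro: less_imp_le)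
  then show ?thesis using W unfolding wiener_process_def by blast
qed

lemma cell_bounds: "i < n \<Longrightarrow> 0 \<le> t i \<and> t i < t (Suc i) \<and> t (Suc i) \<le> 1"
  using partition_bounds[of n t i, OF t] partition_bounds[of n t "Suc i", OF t] t(1)[of i] by auto

lemma weighted_increments_normal:
  assumes "\<exists>i<n. c i \<noteq> 0"
  shows "distributed M lborel (\<lambda>\<omega>. \<Sum>i<n. c i * (W (t (Suc i)) \<omega> - W (t i) \<omega>))
    (normal_density 0 (sqrt (\<Sum>i<n. (c i)\<^sup>2 * (t (Suc i) - t i))))"
proof -
  \<comment> \<open>A normal density needs positive variance, so the summands with zero coefficient
    are dropped before independent normal variables are added.\<close>
  define J where "J = {i\<in>{..<n}. c i \<noteq> 0}"
  have J: "finite J" "J \<noteq> {}" using assms by (auto simp: J_def)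
  have "distributed M lborel (\<lambda>\<omega>. \<Sum>i\<in>J. c i * (W (t (Suc i)) \<omega> - W (t i) \<omega>))
     (normal_density (\<Sum>i\<in>J. 0) (sqrt (\<Sum>i\<in>J. (\<bar>c i\<bar> * sqrt (t (Suc i) - t i))\<^sup>2)))"
  proof (rule sum_indep_normal[OF J])
    have "indep_vars (\<lambda>_. borel) (\<lambda>i \<omega>. W (t (Suc i)) \<omega> - W (t i) \<omega>) J"
      by (rule indep_vars_subset[OF indep_increments]) (auto simp: J_def)
    then show "indep_vars (\<lambda>_. borel) (\<lambda>i \<omega>. c i * (W (t (Suc i)) \<omega> - W (t i) \<omega>)) J"
      by (rule indep_vars_compose2) simp
    fix i assume i: "i \<in> J"
    then show "0 < \<bar>c i\<bar> * sqrt (t (Suc i) - t i)" using t(1)[of i] by (simp add: J_def)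
    show "distributed M lborel (\<lambda>\<omega>. c i * (W (t (Suc i)) \<omega> - W (t i) \<omega>)) (normal_density 0 (\<bar>c i\<bar> * sqrt (t (Suc i) - t i)))"
      using normal_density_affine[OF increment_distributed[of "t i" "t (Suc i)"], of "c i" 0] i cell_bounds[of i]
      by (simp add: J_def)
  qed
  moreover have "(\<Sum>i\<in>J. c i * (W (t (Suc i)) \<omega> - W (t i) \<omega>)) = (\<Sum>i<n. c i * (W (t (Suc i)) \<omega> - W (t i) \<omega>))" for \<omega>
    by (rule sum.mono_neutral_left) (auto simp: J_def)
  moreover have "(\<Sum>i\<in>J. (\<bar>c i\<bar> * sqrt (t (Suc i) - t i))\<^sup>2) = (\<Sum>i\<in>J. (c i)\<^sup>2 * (t (Suc i) - t i))"
    using t(1) by (intro sum.cong refl) (auto simp: J_def power_mult_distrib intro: less_imp_le)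
  moreover have "(\<Sum>i\<in>J. (c i)\<^sup>2 * (t (Suc i) - t i)) = (\<Sum>i<n. (c i)\<^sup>2 * (t (Suc i) - t i))"
    by (rule sum.mono_neutral_left) (auto simp: J_def)
  ultimately show ?thesis by simp
qed

lemma incr_measurable: "incr n t \<in> measurable path_space (Pi\<^sub>M {..<n} (\<lambda>_. borel))"
  unfolding incr_def[abs_def] using cell_bounds
  by (intro measurable_restrict borel_measurable_diff measurable_coordinate) force+

lemma incr_path: "i < n \<Longrightarrow> incr n t (path f \<omega>) i = incr n t (drift f) i + \<epsilon> * (W (t (Suc i)) \<omega> - W (t i) \<omega>)"
  using cell_bounds[of i] by (simp add: incr_def path_def algebra_simps)

abbreviation (input) cell_law :: "(real \<Rightarrow> real) \<Rightarrow> nat \<Rightarrow> real measure" where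
  "cell_law f i \<equiv> density lborel (normal_density (incr n t (drift f) i) (\<epsilon> * sqrt (t (Suc i) - t i)))"

lemma distr_incr:
  assumes "L2 f" "0 < n"
  shows "distr (law f) (Pi\<^sub>M {..<n} (\<lambda>_. borel)) (incr n t) = Pi\<^sub>M {..<n} (cell_law f)"
proof -
  let ?X = "\<lambda>i \<omega>. incr n t (drift f) i + \<epsilon> * (W (t (Suc i)) \<omega> - W (t i) \<omega>)"
  have ind: "indep_vars (\<lambda>_. borel) ?X {..<n}"
    by (rule indep_vars_compose2[OF indep_increments]) simp
  have "distr (law f) (Pi\<^sub>M {..<n} (\<lambda>_. borel)) (incr n t) = distr M (Pi\<^sub>M {..<n} (\<lambda>_. borel)) (incr n t \<circ> path f)"
    unfolding law_eq by (intro distr_distr incr_measurable path_measurable assms)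
  also have "incr n t \<circ> path f = (\<lambda>\<omega>. \<lambda>i\<in>{..<n}. ?X i \<omega>)"
    by (rule ext)+ (simp add: incr_path, simp add: incr_def)
  also have "distr M (Pi\<^sub>M {..<n} (\<lambda>_. borel)) (\<lambda>\<omega>. \<lambda>i\<in>{..<n}. ?X i \<omega>) = Pi\<^sub>M {..<n} (\<lambda>i. distr M borel (?X i))"
    using ind assms(2) by (intro indep_vars_iff_distr_eq_PiM'[THEN iffD1]) (auto simp: indep_vars_def)
  also have "\<dots> = Pi\<^sub>M {..<n} (cell_law f)"
  proof (rule PiM_cong)
    fix i assume "i \<in> {..<n}"
    then have i: "0 \<le> t i" "t i < t (Suc i)" "t (Suc i) \<le> 1" using cell_bounds[of i] by auto
    then have "0 < sqrt (t (Suc i) - t i)" "\<epsilon> \<noteq> 0" using \<epsilon> by auto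
    from normal_density_affine[OF increment_distributed[OF i] this, of "incr n t (drift f) i"]
    have "distributed M lborel (?X i) (normal_density (incr n t (drift f) i) (\<epsilon> * sqrt (t (Suc i) - t i)))"
      using \<epsilon> by simp
    then show "distr M borel (?X i) = cell_law f i"
      using distr_cong[of M M borel lborel "?X i" "?X i"] by (simp add: distributed_def)
  qed simp
  finally show ?thesis .
qed

text \<open>In each cell completing the square gives the Gaussian likelihood ratio for a shift of
  the mean by \<open>m i\<close>; the ratios multiply because the increments are independent.
  Comparison on product boxes suffices.\<close>

lemma PiM_cell_law_change:
  fixes f g
  defines "m \<equiv> \<lambda>i. incr n t (drift g) i - incr n t (drift f) i"
  defines "l \<equiv> \<lambda>i z. exp (m i * (z - incr n t (drift f) i) / (\<epsilon>\<^sup>2 * (t (Suc i) - t i)) - (m i)\<^sup>2 / (2 * \<epsilon>\<^sup>2 * (t (Suc i) - t i)))"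
  shows "density (Pi\<^sub>M {..<n} (cell_law f)) (\<lambda>x. \<Prod>i<n. ennreal (l i (x i))) = Pi\<^sub>M {..<n} (cell_law g)"
proof -
  \<comment> \<open>\<open>product_sigma_finite\<close> asks for every index, also for those outside
    the partition, where the cell width may be zero or negative. A zero scale makes the density
    vanish, and the sign of the scale is immaterial because only its square enters.\<close>
  have sigma: "sigma_finite_measure (cell_law h i)" for h i
  proof (cases "i < n")
    case True
    then have "prob_space (cell_law h i)"
      using t(1) \<epsilon> by (intro prob_space_normal_density) auto
    then show ?thesis by (metis prob_space.finite_measure finite_measure.sigma_finite_measure)
  next
    case False
    have "finite_measure (cell_law h i)" if "\<epsilon> * sqrt (t (Suc i) - t i) = 0"
    proof -
      have "normal_density (incr n t (drift h) i) 0 = (\<lambda>_. 0)" by (simp add: normal_density_def fun_eq_iff)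
      then show ?thesis unfolding that by (intro finite_measureI) (simp add: emeasure_density)
    qed
    moreover have "finite_measure (cell_law h i)" if *: "\<epsilon> * sqrt (t (Suc i) - t i) \<noteq> 0"
    proof -
      have "normal_density (incr n t (drift h) i) (\<epsilon> * sqrt (t (Suc i) - t i)) = normal_density (incr n t (drift h) i) \<bar>\<epsilon> * sqrt (t (Suc i) - t i)\<bar>"
        by (simp add: normal_density_def fun_eq_iff)
      moreover have "prob_space (density lborel (normal_density (incr n t (drift h) i) \<bar>\<epsilon> * sqrt (t (Suc i) - t i)\<bar>))"
        using * by (intro prob_space_normal_density) simp
      ultimately show ?thesis by (metis prob_space.finite_measure)
    qed
    ultimately have "finite_measure (cell_law h i)" by blast
    then show ?thesis by (rule finite_measure.sigma_finite_measure)
  qed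
  interpret F: product_sigma_finite "cell_law f" by (simp add: product_sigma_finite_def sigma)
  interpret G: product_sigma_finite "cell_law g" by (simp add: product_sigma_finite_def sigma)
  have l_meas[measurable]: "l i \<in> borel_measurable borel" for i unfolding l_def by simp
  have cell: "emeasure (cell_law g i) B = (\<integral>\<^sup>+z. ennreal (l i z) * indicator B z \<partial>cell_law f i)"
    if "i < n" "B \<in> sets borel" for i B
  proof -
    have D: "0 < \<epsilon>\<^sup>2 * (t (Suc i) - t i)" using t(1)[OF that(1)] \<epsilon> by simp
    define v where "v = \<epsilon>\<^sup>2 * (t (Suc i) - t i)"
    have v: "0 < v" "(\<epsilon> * sqrt (t (Suc i) - t i))\<^sup>2 = v" 
      using D t(1)[OF that(1)] by (auto simp: v_def power_mult_distrib)
    have eq: "normal_density (incr n t (drift f) i) (\<epsilon> * sqrt (t (Suc i) - t i)) z * l i z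
        = normal_density (incr n t (drift g) i) (\<epsilon> * sqrt (t (Suc i) - t i)) z" for z
    proof -
      have "- (z - incr n t (drift f) i)\<^sup>2 / (2 * v) + (m i * (z - incr n t (drift f) i) / v - (m i)\<^sup>2 / (2 * v))
          = - (z - incr n t (drift g) i)\<^sup>2 / (2 * v)"
        using v(1) by (simp add: m_def field_simps power2_eq_square)
      then show ?thesis
        unfolding normal_density_def l_def v(2) by (simp add: exp_add[symmetric] v_def mult.assoc)
    qed
    have "(\<integral>\<^sup>+z. ennreal (l i z) * indicator B z \<partial>cell_law f i)
      = (\<integral>\<^sup>+z. ennreal (normal_density (incr n t (drift f) i) (\<epsilon> * sqrt (t (Suc i) - t i)) z) * (ennreal (l i z) * indicator B z) \<partial>lborel)"
      using that by (subst nn_integral_density) auto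
    also have "\<dots> = (\<integral>\<^sup>+z. ennreal (normal_density (incr n t (drift g) i) (\<epsilon> * sqrt (t (Suc i) - t i)) z) * indicator B z \<partial>lborel)"
      by (simp add: eq[symmetric] ennreal_mult' mult.assoc)
    also have "\<dots> = emeasure (cell_law g i) B"
      using that by (subst emeasure_density) auto
    finally show ?thesis by simp
  qed
  have sets_eq: "sets (Pi\<^sub>M {..<n} (cell_law h)) = sets (Pi\<^sub>M {..<n} (\<lambda>_. borel))" for h
    by (rule sets_PiM_cong) auto
  have l_comp: "(\<lambda>x. l i (x i)) \<in> borel_measurable (Pi\<^sub>M {..<n} (cell_law f))" if "i \<in> {..<n}" for i
    by (rule measurable_compose[OF measurable_component_singleton[OF that]]) simp
  show ?thesis
  proof (rule G.PiM_eqI)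
    show "sets (density (Pi\<^sub>M {..<n} (cell_law f)) (\<lambda>x. \<Prod>i<n. ennreal (l i (x i)))) = sets (Pi\<^sub>M {..<n} (cell_law g))"
      by (simp add: sets_eq)
    fix A :: "nat \<Rightarrow> real set" assume A: "\<And>i. i \<in> {..<n} \<Longrightarrow> A i \<in> sets (cell_law g i)"
    then have A': "i < n \<Longrightarrow> A i \<in> sets borel" for i by simp
    have "Pi\<^sub>E {..<n} A \<in> sets (Pi\<^sub>M {..<n} (cell_law f))"
      using A' by (intro sets_PiM_I_finite) auto
    then have "emeasure (density (Pi\<^sub>M {..<n} (cell_law f)) (\<lambda>x. \<Prod>i<n. ennreal (l i (x i)))) (Pi\<^sub>E {..<n} A)
        = (\<integral>\<^sup>+x. (\<Prod>i<n. ennreal (l i (x i))) * indicator (Pi\<^sub>E {..<n} A) x \<partial>Pi\<^sub>M {..<n} (cell_law f))"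
      by (intro emeasure_density borel_measurable_prod_ennreal measurable_compose[OF _ measurable_ennreal] l_comp) auto
    also have "\<dots> = (\<integral>\<^sup>+x. (\<Prod>i<n. ennreal (l i (x i)) * indicator (A i) (x i)) \<partial>Pi\<^sub>M {..<n} (cell_law f))"
    proof (rule nn_integral_cong)
      fix x assume "x \<in> space (Pi\<^sub>M {..<n} (cell_law f))"
      then have "indicator (Pi\<^sub>E {..<n} A) x = (\<Prod>i<n. indicator (A i) (x i) :: ennreal)"
        by (auto simp: indicator_def space_PiM PiE_iff prod_zero_iff split: if_splits)
      then show "(\<Prod>i<n. ennreal (l i (x i))) * indicator (Pi\<^sub>E {..<n} A) x = (\<Prod>i<n. ennreal (l i (x i)) * indicator (A i) (x i))"
        by (simp add: prod.distrib)
    qed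
    also have "\<dots> = (\<Prod>i<n. \<integral>\<^sup>+z. ennreal (l i z) * indicator (A i) z \<partial>cell_law f i)"
      using A' by (intro F.product_nn_integral_prod) auto
    also have "\<dots> = (\<Prod>i<n. emeasure (cell_law g i) (A i))"
      using A' by (intro prod.cong) (auto simp: cell)
    finally show "emeasure (density (Pi\<^sub>M {..<n} (cell_law f)) (\<lambda>x. \<Prod>i<n. ennreal (l i (x i)))) (Pi\<^sub>E {..<n} A)
       = (\<Prod>i<n. emeasure (cell_law g i) (A i))" .
  qed simp
qed

end
end

section \<open>The likelihood ratio of the discretised observation\<close>

context white_noise
begin

text \<open>Half the distance of the signals in units of the noise, normalised so that the best test
  between them errs with probability \<open>Phi (- separation f g)\<close> on each side.\<close>

abbreviation separation :: "(real \<Rightarrow> real) \<Rightarrow> (real \<Rightarrow> real) \<Rightarrow> real" where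
  "separation f g \<equiv> sqrt (ip (\<lambda>x. g x - f x) (\<lambda>x. g x - f x)) / (2 * \<epsilon>)"

text \<open>Here b is the separation visible through the events considered. Bounding it by the full
  separation is enough, because it enters only through monotone expressions; of \<xi> nothing but
  its law matters. The formula is asked only for a class of events, so no density on the whole path
  space is required.\<close>

definition has_LR_on :: "(real \<Rightarrow> real) \<Rightarrow> (real \<Rightarrow> real) \<Rightarrow> (real \<Rightarrow> real) set set \<Rightarrow> bool" where
  "has_LR_on f g \<A> \<longleftrightarrow>
    (\<exists>\<xi> b. distributed (law f) lborel \<xi> std_normal_density \<and> 0 \<le> b \<and> b \<le> separation f g \<and>
      (\<forall>A\<in>\<A>. measure (law g) A = (\<integral>y. indicator A y * exp (2 * b * \<xi> y - 2 * b\<^sup>2) \<partial>law f)))"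

definition incr_event :: "nat \<Rightarrow> (nat \<Rightarrow> real) \<Rightarrow> (nat \<Rightarrow> real) set \<Rightarrow> (real \<Rightarrow> real) set" where
  "incr_event n t E = incr n t -` E \<inter> space path_space"

context
  fixes n :: nat and t :: "nat \<Rightarrow> real"
  assumes t: "\<And>i. i < n \<Longrightarrow> t i < t (Suc i)" "t 0 = 0" "t n \<le> 1"
begin

lemmas meas_incr = incr_measurable[of n t, OF t]

lemma emeasure_incr_event:
  fixes f g
  defines "m \<equiv> \<lambda>i. incr n t (drift g) i - incr n t (drift f) i"
  defines "L \<equiv> \<lambda>x. exp (\<Sum>i<n. m i * (x i - incr n t (drift f) i) / (\<epsilon>\<^sup>2 * (t (Suc i) - t i)) - (m i)\<^sup>2 / (2 * \<epsilon>\<^sup>2 * (t (Suc i) - t i)))"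
  assumes f: "L2 f" and g: "L2 g" and n: "0 < n" and E: "E \<in> sets (Pi\<^sub>M {..<n} (\<lambda>_. borel))"
  shows "emeasure (law g) (incr_event n t E) = (\<integral>\<^sup>+y. ennreal (indicator (incr_event n t E) y * L (incr n t y)) \<partial>law f)"
proof -
  note change = PiM_cell_law_change[of n t f g, OF t]
  have L: "(\<Prod>i<n. ennreal (exp (m i * (x i - incr n t (drift f) i) / (\<epsilon>\<^sup>2 * (t (Suc i) - t i)) - (m i)\<^sup>2 / (2 * \<epsilon>\<^sup>2 * (t (Suc i) - t i))))) = ennreal (L x)" for x
    by (simp add: L_def exp_sum prod_ennreal)
  have Lm[measurable]: "L \<in> borel_measurable (Pi\<^sub>M {..<n} (\<lambda>_. borel))"
    unfolding L_def by (intro borel_measurable_exp borel_measurable_sum borel_measurable_diff borel_measurable_divide borel_measurable_times borel_measurable_const measurable_component_singleton measurable_compose[OF _ borel_measurable_exp]) auto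
  note E[measurable]
  have "emeasure (law g) (incr_event n t E) = emeasure (distr (law g) (Pi\<^sub>M {..<n} (\<lambda>_. borel)) (incr n t)) E"
    using meas_incr E by (subst emeasure_distr) (auto simp: incr_event_def)
  also have "distr (law g) (Pi\<^sub>M {..<n} (\<lambda>_. borel)) (incr n t)
      = density (distr (law f) (Pi\<^sub>M {..<n} (\<lambda>_. borel)) (incr n t)) (\<lambda>x. ennreal (L x))"
    using distr_incr[of n t, OF t g n] distr_incr[of n t, OF t f n] change
    unfolding L[unfolded m_def] by simp
  also have "emeasure \<dots> E = (\<integral>\<^sup>+x. ennreal (L x) * indicator E x \<partial>distr (law f) (Pi\<^sub>M {..<n} (\<lambda>_. borel)) (incr n t))"
    by (subst emeasure_density) auto
  also have "\<dots> = (\<integral>\<^sup>+y. ennreal (L (incr n t y)) * indicator E (incr n t y) \<partial>law f)"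
    using meas_incr by (subst nn_integral_distr) auto
  also have "\<dots> = (\<integral>\<^sup>+y. ennreal (indicator (incr_event n t E) y * L (incr n t y)) \<partial>law f)"
    by (intro nn_integral_cong) (auto simp: incr_event_def split: split_indicator)
  finally show ?thesis .
qed

text \<open>The log-likelihood ratio is affine in the increments. Normalising its linear part gives
  \<xi>, its variance gives b, and \<open>sum_increments_le\<close> bounds b by the separation of
  the full signals.\<close>

lemma has_LR_on_incr_events:
  assumes f: "L2 f" and g: "L2 g" and n: "0 < n"
  shows "has_LR_on f g (incr_event n t ` sets (Pi\<^sub>M {..<n} (\<lambda>_. borel)))"
proof -
  interpret F: prob_space "law f" by (rule prob_space_law[OF f])
  interpret G: prob_space "law g" by (rule prob_space_law[OF g])
  define D where "D i = t (Suc i) - t i" for i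
  have D: "i < n \<Longrightarrow> 0 < D i" for i using t(1) by (simp add: D_def)
  define m where "m i = incr n t (drift g) i - incr n t (drift f) i" for i
  define V where "V = (\<Sum>i<n. (m i)\<^sup>2 / D i)"
  have V: "0 \<le> V" unfolding V_def using D by (intro sum_nonneg divide_nonneg_pos) auto
  define b where "b = sqrt V / (2 * \<epsilon>)"
  have b: "0 \<le> b" using V \<epsilon> by (simp add: b_def)
  \<comment> \<open>If V = 0 the two discretised laws coincide and the likelihood ratio is 1. A
    standard normal \<xi> is still demanded, so arbitrary nonzero weights are taken; they are
    multiplied by b = 0.\<close>
  define c where "c i = (if V = 0 then 1 else m i / D i)" for i
  define U where "U = (\<Sum>i<n. (c i)\<^sup>2 * D i)"
  have U_eq: "U = V" if "V \<noteq> 0"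
    unfolding U_def V_def using that D
    by (intro sum.cong refl) (auto simp: c_def power2_eq_square)
  have c_nz: "\<exists>i<n. c i \<noteq> 0"
  proof (cases "V = 0")
    case True then show ?thesis using n by (auto simp: c_def)
  next
    case False
    then have "\<exists>i<n. (m i)\<^sup>2 / D i \<noteq> 0" unfolding V_def by (meson lessThan_iff sum.neutral)
    then show ?thesis using False by (auto simp: c_def)
  qed
  have U: "0 < U"
  proof -
    obtain i where i: "i < n" "c i \<noteq> 0" using c_nz by auto
    then have "0 < (c i)\<^sup>2 * D i" using D by simp
    also have "\<dots> \<le> U" unfolding U_def using i D by (intro member_le_sum) (auto intro!: mult_nonneg_nonneg less_imp_le[OF D])
    finally show ?thesis .
  qed
  define \<xi> where "\<xi> y = (\<Sum>i<n. c i * (incr n t y i - incr n t (drift f) i)) / (\<epsilon> * sqrt U)" for y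
  have \<xi>_meas: "\<xi> \<in> borel_measurable path_space"
    unfolding \<xi>_def
    by (intro borel_measurable_divide borel_measurable_sum borel_measurable_times borel_measurable_diff
        borel_measurable_const measurable_compose[OF meas_incr measurable_component_singleton]) auto
  have \<xi>_path: "\<xi> (path f \<omega>) = (\<Sum>i<n. c i * (W (t (Suc i)) \<omega> - W (t i) \<omega>)) / sqrt U" for \<omega>
  proof -
    have "(\<Sum>i<n. c i * (incr n t (path f \<omega>) i - incr n t (drift f) i)) = \<epsilon> * (\<Sum>i<n. c i * (W (t (Suc i)) \<omega> - W (t i) \<omega>))"
      unfolding sum_distrib_left by (intro sum.cong refl) (simp add: incr_path[of n t, OF t])
    then show ?thesis using \<epsilon> by (simp add: \<xi>_def)
  qed
  have \<xi>: "distributed (law f) lborel \<xi> std_normal_density"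
    unfolding distributed_law[OF f \<xi>_meas] \<xi>_path
    using weighted_increments_normal[of n t, OF t c_nz] normal_standard_normal_convert[of "sqrt U" _ 0] U
    by (simp add: U_def D_def)
  have sep: "b \<le> separation f g"
  proof -
    have "V \<le> ip (\<lambda>x. g x - f x) (\<lambda>x. g x - f x)"
    proof -
      have "V = (\<Sum>i<n. (drift (\<lambda>x. g x - f x) (t (Suc i)) - drift (\<lambda>x. g x - f x) (t i))\<^sup>2 / (t (Suc i) - t i))"
        unfolding V_def
      proof (intro sum.cong refl)
        fix i assume "i \<in> {..<n}"
        then show "(m i)\<^sup>2 / D i = (drift (\<lambda>x. g x - f x) (t (Suc i)) - drift (\<lambda>x. g x - f x) (t i))\<^sup>2 / (t (Suc i) - t i)"
          using cell_bounds[of n t i, OF t] by (simp add: m_def D_def incr_def drift_diff[OF g f] algebra_simps)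
      qed
      also have "\<dots> \<le> ip (\<lambda>x. g x - f x) (\<lambda>x. g x - f x)"
        by (rule sum_increments_le[of n t, OF t L2_diff[OF g f]])
      finally show ?thesis .
    qed
    then show ?thesis using \<epsilon> by (simp add: b_def divide_right_mono)
  qed
  have exponent: "(\<Sum>i<n. m i * (incr n t y i - incr n t (drift f) i) / (\<epsilon>\<^sup>2 * (t (Suc i) - t i)) - (m i)\<^sup>2 / (2 * \<epsilon>\<^sup>2 * (t (Suc i) - t i)))
      = 2 * b * \<xi> y - 2 * b\<^sup>2" for y
  proof -
    have "2 * b\<^sup>2 = V / (2 * \<epsilon>\<^sup>2)" using V by (simp add: b_def power_divide power_mult_distrib)
    moreover have "(\<Sum>i<n. (m i)\<^sup>2 / (2 * \<epsilon>\<^sup>2 * (t (Suc i) - t i))) = V / (2 * \<epsilon>\<^sup>2)"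
      unfolding V_def sum_divide_distrib by (simp add: D_def mult.commute)
    moreover have "(\<Sum>i<n. m i * (incr n t y i - incr n t (drift f) i) / (\<epsilon>\<^sup>2 * (t (Suc i) - t i))) = 2 * b * \<xi> y"
    proof (cases "V = 0")
      case True
      have "m i = 0" if "i < n" for i
      proof -
        have "\<forall>i\<in>{..<n}. (m i)\<^sup>2 / D i = 0"
          using True unfolding V_def by (subst (asm) sum_nonneg_eq_0_iff) (auto intro!: divide_nonneg_pos D)
        then show ?thesis using that D[of i] by auto
      qed
      then show ?thesis using True by (simp add: b_def)
    next
      case False
      have "2 * b * \<xi> y = (\<Sum>i<n. c i * (incr n t y i - incr n t (drift f) i)) / \<epsilon>\<^sup>2"
        using False U_eq V \<epsilon> by (simp add: b_def \<xi>_def power2_eq_square)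
      also have "\<dots> = (\<Sum>i<n. m i * (incr n t y i - incr n t (drift f) i) / (\<epsilon>\<^sup>2 * (t (Suc i) - t i)))"
        unfolding sum_divide_distrib using False by (intro sum.cong refl) (simp add: c_def D_def field_simps)
      finally show ?thesis by simp
    qed
    ultimately show ?thesis by (simp add: sum_subtractf)
  qed
  show ?thesis
    unfolding has_LR_on_def
  proof (intro exI conjI ballI)
    fix A assume "A \<in> incr_event n t ` sets (Pi\<^sub>M {..<n} (\<lambda>_. borel))"
    then obtain E where E: "E \<in> sets (Pi\<^sub>M {..<n} (\<lambda>_. borel))" "A = incr_event n t E" by auto
    then have A: "A \<in> sets path_space"
      using measurable_sets[OF meas_incr] by (simp add: incr_event_def)
    have "ennreal (measure (law g) A) = (\<integral>\<^sup>+y. ennreal (indicator A y * exp (2 * b * \<xi> y - 2 * b\<^sup>2)) \<partial>law f)"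
      using emeasure_incr_event[OF f g n E(1)] by (simp add: E(2) G.emeasure_eq_measure exponent[unfolded m_def])
    also have "\<dots> = ennreal (\<integral>y. indicator A y * exp (2 * b * \<xi> y - 2 * b\<^sup>2) \<partial>law f)"
      using A by (intro nn_integral_eq_integral F.integrable_LR_on[OF \<xi> b]) auto
    finally show "measure (law g) A = (\<integral>y. indicator A y * exp (2 * b * \<xi> y - 2 * b\<^sup>2) \<partial>law f)"
      by (subst (asm) ennreal_inj) auto
  qed fact+
qed

end
end

section \<open>Approximation of events by cylinders\<close>

lemma finite_subset_partition:
  assumes "finite T" "T \<subseteq> {0..1::real}"
  obtains n t where "0 < n" "\<And>i. i < n \<Longrightarrow> t i < t (Suc i)" "t 0 = 0" "t n = 1" "T \<subseteq> t ` {..n}"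
proof -
  define U where "U = insert 0 (insert 1 T)"
  define xs where "xs = sorted_list_of_set U"
  have fin: "finite U" using assms by (simp add: U_def)
  then have set: "set xs = U" and sorted: "sorted_wrt (<) xs"
    by (simp_all add: xs_def strict_sorted_list_of_set)
  have U01: "U \<subseteq> {0..1}" using assms by (auto simp: U_def)
  have len: "2 \<le> length xs"
  proof -
    have "card {0, 1 :: real} \<le> card U" using fin by (intro card_mono) (auto simp: U_def)
    then show ?thesis by (simp add: xs_def)
  qed
  define n where "n = length xs - 1"
  have step: "xs ! i < xs ! Suc i" if "i < n" for i
    using that sorted by (simp add: n_def sorted_wrt_nth_less)
  have all: "U = (\<lambda>i. xs ! i) ` {..n}"
    using len unfolding set[symmetric] set_conv_nth n_def by force
  have mono: "i \<le> j \<Longrightarrow> j \<le> n \<Longrightarrow> xs ! i \<le> xs ! j" for i j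
    using len sorted_wrt_nth_less[OF sorted, of i j]
    by (cases "i = j") (auto simp: n_def intro!: less_imp_le)
  have "xs ! 0 = 0"
  proof -
    have "0 \<in> U" by (simp add: U_def)
    then obtain i where i: "i \<le> n" "0 = xs ! i" unfolding all by auto
    then have "xs ! 0 \<le> 0" using mono[of 0 i] by simp
    moreover have "xs ! 0 \<in> U" using all by auto
    ultimately show ?thesis using U01 by force
  qed
  moreover have "xs ! n = 1"
  proof -
    have "1 \<in> U" by (simp add: U_def)
    then obtain i where i: "i \<le> n" "1 = xs ! i" unfolding all by auto
    then have "1 \<le> xs ! n" using mono[of i n] by simp
    moreover have "xs ! n \<in> U" using all by auto
    ultimately show ?thesis using U01 by force
  qed
  moreover have "T \<subseteq> (\<lambda>i. xs ! i) ` {..n}" using all by (auto simp: U_def)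
  ultimately show ?thesis
    using that[of n "\<lambda>i. xs ! i"] step len by (simp add: n_def)
qed

definition cylinders :: "real set \<Rightarrow> (real \<Rightarrow> real) set set" where
  "cylinders T = sets (vimage_algebra (space path_space) (\<lambda>y. restrict y T) (Pi\<^sub>M T (\<lambda>_. borel)))"

lemma cylinders_iff: "A \<in> cylinders T \<longleftrightarrow> (\<exists>E\<in>sets (Pi\<^sub>M T (\<lambda>_. borel)). A = (\<lambda>y. restrict y T) -` E \<inter> space path_space)"
  unfolding cylinders_def by (subst sets_vimage_algebra2) (auto simp: space_PiM)

lemma cylinders_Diff: "A \<in> cylinders T \<Longrightarrow> space path_space - A \<in> cylinders T"
  unfolding cylinders_def using sets.compl_sets[of A "vimage_algebra (space path_space) (\<lambda>y. restrict y T) (Pi\<^sub>M T (\<lambda>_. borel))"] by simp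

lemma cylinders_Un: "A \<in> cylinders T \<Longrightarrow> B \<in> cylinders T \<Longrightarrow> A \<union> B \<in> cylinders T"
  unfolding cylinders_def by (rule sets.Un)

lemma cylinders_empty: "{} \<in> cylinders T"
  unfolding cylinders_def by simp

lemma cylinders_mono:
  assumes "S \<subseteq> T"
  shows "cylinders S \<subseteq> cylinders T"
proof
  fix A assume "A \<in> cylinders S"
  then obtain E where E: "E \<in> sets (Pi\<^sub>M S (\<lambda>_. borel))" "A = (\<lambda>y. restrict y S) -` E \<inter> space path_space"
    by (auto simp: cylinders_iff)
  have "(\<lambda>x. restrict x S) -` E \<inter> space (Pi\<^sub>M T (\<lambda>_. borel :: real measure)) \<in> sets (Pi\<^sub>M T (\<lambda>_. borel))"
    using measurable_restrict_subset[OF assms] E(1) by (rule measurable_sets)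
  moreover have "A = (\<lambda>y. restrict y T) -` ((\<lambda>x. restrict x S) -` E \<inter> space (Pi\<^sub>M T (\<lambda>_. borel :: real measure))) \<inter> space path_space"
    using assms unfolding E(2) by (auto simp: space_PiM Int_absorb1)
  ultimately show "A \<in> cylinders T" unfolding cylinders_iff by blast
qed

lemma cylinders_measurable:
  assumes "T \<subseteq> {0..1}" "A \<in> cylinders T"
  shows "A \<in> sets path_space"
proof -
  have "(\<lambda>y. restrict y T) \<in> measurable path_space (Pi\<^sub>M T (\<lambda>_. borel))"
    using assms(1) by (intro measurable_restrict measurable_coordinate) auto
  then show ?thesis using assms(2) measurable_sets unfolding cylinders_iff by blast
qed

text \<open>The events that can be approximated form a sigma-algebra containing the one-coordinate
  events. One cylinder has to serve both measures, because a test is judged under both hypotheses at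
  once.\<close>

lemma cylinder_approximation:
  assumes \<mu>: "finite_measure \<mu>" "sets \<mu> = sets path_space"
    and \<nu>: "finite_measure \<nu>" "sets \<nu> = sets path_space"
    and A: "A \<in> sets path_space" and "0 < e"
  shows "\<exists>T B. finite T \<and> T \<subseteq> {0..1} \<and> B \<in> cylinders T \<and>
    measure \<mu> (sym_diff A B) < e \<and> measure \<nu> (sym_diff A B) < e"
proof -
  let ?\<Omega> = "space path_space"
  define appr where "appr A \<longleftrightarrow> A \<in> sets path_space \<and> (\<forall>e>0. \<exists>T B. finite T \<and> T \<subseteq> {0..1} \<and> B \<in> cylinders T \<and>
    measure \<mu> (sym_diff A B) < e \<and> measure \<nu> (sym_diff A B) < e)" for A
  have apprD: "\<exists>T B. finite T \<and> T \<subseteq> {0..1} \<and> B \<in> cylinders T \<and>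
    measure \<mu> (sym_diff A B) < e \<and> measure \<nu> (sym_diff A B) < e" if "appr A" "0 < e" for A e
    using that by (simp add: appr_def)
  have appr_sets: "A \<in> sets path_space" if "appr A" for A
    using that by (simp add: appr_def)
  have appr_exact: "appr A" if "finite T" "T \<subseteq> {0..1}" "A \<in> cylinders T" for A T
    using that cylinders_measurable[of T A] unfolding appr_def
    by (intro conjI allI impI exI[of _ T] exI[of _ A]) auto
  have union_le: "measure \<kappa> (sym_diff A C) \<le> measure \<kappa> (sym_diff A B) + measure \<kappa> (sym_diff B C)"
    if "finite_measure \<kappa>" "sets \<kappa> = sets path_space" "A \<in> sets path_space" "B \<in> sets path_space" "C \<in> sets path_space" for \<kappa> A B C
  proof -
    interpret finite_measure \<kappa> by fact
    have "measure \<kappa> (sym_diff A C) \<le> measure \<kappa> (sym_diff A B \<union> sym_diff B C)"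
      using that by (intro finite_measure_mono) auto
    also have "\<dots> \<le> measure \<kappa> (sym_diff A B) + measure \<kappa> (sym_diff B C)"
      using that by (intro measure_Un_le) auto
    finally show ?thesis .
  qed
  have appr_Un: "appr (A \<union> B)" if A: "appr A" and B: "appr B" for A B
    unfolding appr_def
  proof (intro conjI allI impI)
    show AB: "A \<union> B \<in> sets path_space" using appr_sets[OF A] appr_sets[OF B] by auto
    fix e :: real assume "0 < e"
    then have e2: "0 < e / 2" by simp
    obtain S C where
      S: "finite S" "S \<subseteq> {0..1}" "C \<in> cylinders S" "measure \<mu> (sym_diff A C) < e / 2" "measure \<nu> (sym_diff A C) < e / 2"
      using apprD[OF A e2] by (elim exE conjE) (rule that)
    obtain T D where
      T: "finite T" "T \<subseteq> {0..1}" "D \<in> cylinders T" "measure \<mu> (sym_diff B D) < e / 2" "measure \<nu> (sym_diff B D) < e / 2"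
      using apprD[OF B e2] by (elim exE conjE) (rule that)
    note m = cylinders_measurable[OF S(2,3)] cylinders_measurable[OF T(2,3)]
    have AB': "A \<in> sets path_space" "B \<in> sets path_space" by (intro appr_sets A B)+
    have le: "measure \<kappa> (sym_diff (A \<union> B) (C \<union> D)) \<le> measure \<kappa> (sym_diff A C) + measure \<kappa> (sym_diff B D)"
      if "finite_measure \<kappa>" "sets \<kappa> = sets path_space" for \<kappa>
    proof -
      interpret finite_measure \<kappa> by fact
      have "measure \<kappa> (sym_diff (A \<union> B) (C \<union> D)) \<le> measure \<kappa> (sym_diff A C \<union> sym_diff B D)"
        by (rule finite_measure_mono, blast, unfold that(2), intro sets.Un sets.Diff AB' m)
      also have "\<dots> \<le> measure \<kappa> (sym_diff A C) + measure \<kappa> (sym_diff B D)"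
        by (rule measure_Un_le; unfold that(2), intro sets.Un sets.Diff AB' m)
      finally show ?thesis .
    qed
    have "C \<union> D \<in> cylinders (S \<union> T)"
      using cylinders_mono[of S "S \<union> T"] cylinders_mono[of T "S \<union> T"] S T by (intro cylinders_Un) auto
    then show "\<exists>T B'. finite T \<and> T \<subseteq> {0..1} \<and> B' \<in> cylinders T \<and>
        measure \<mu> (sym_diff (A \<union> B) B') < e \<and> measure \<nu> (sym_diff (A \<union> B) B') < e"
      using le[OF \<mu>] le[OF \<nu>] S T by (intro exI[of _ "S \<union> T"] exI[of _ "C \<union> D"]) auto
  qed
  \<comment> \<open>The sigma-algebra on paths is the trace of a product sigma-algebra, so the
    induction runs over the generators of the product and intersects with the continuous paths at
    each stage.\<close>
  have appr_all: "appr (?\<Omega> \<inter> A)" if "A \<in> sigma_sets (\<Pi>\<^sub>E i\<in>{0..1}. space borel)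
      {{f \<in> \<Pi>\<^sub>E i\<in>{0..1}. space borel. f i \<in> B} | i B. i \<in> {0..1::real} \<and> B \<in> sets (borel :: real measure)}" for A
    using that
  proof (induction rule: sigma_sets.induct)
    case (Basic a)
    then obtain i B where a: "a = {f \<in> \<Pi>\<^sub>E i\<in>{0..1}. space borel. f i \<in> B}" "i \<in> {0..1}" "B \<in> sets borel"
      by blast
    have "?\<Omega> \<inter> a = (\<lambda>y. restrict y {i}) -` (Pi\<^sub>E {i} (\<lambda>_. B)) \<inter> ?\<Omega>"
      using a(2) unfolding a(1) by (auto simp: space_path_space PiE_iff)
    moreover have "Pi\<^sub>E {i} (\<lambda>_. B) \<in> sets (Pi\<^sub>M {i} (\<lambda>_. borel))"
      using a(3) by (intro sets_PiM_I_finite) auto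
    ultimately show ?case using a(2) by (intro appr_exact[of "{i}"]) (auto simp: cylinders_iff)
  next
    case Empty
    then show ?case using appr_exact[of "{}" "{}"] cylinders_empty by simp
  next
    case (Compl a)
    have eq: "?\<Omega> \<inter> ((\<Pi>\<^sub>E i\<in>{0..1}. space borel) - a) = ?\<Omega> - (?\<Omega> \<inter> a)"
      by (auto simp: space_path_space PiE_def)
    show ?case unfolding eq appr_def
    proof (intro conjI allI impI)
      show "?\<Omega> - ?\<Omega> \<inter> a \<in> sets path_space" using appr_sets[OF Compl.IH] by (intro sets.Diff) auto
      fix e :: real assume "0 < e"
      obtain T B where T: "finite T" "T \<subseteq> {0..1}" "B \<in> cylinders T"
        and B: "measure \<mu> (sym_diff (?\<Omega> \<inter> a) B) < e" "measure \<nu> (sym_diff (?\<Omega> \<inter> a) B) < e"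
        using apprD[OF Compl.IH \<open>0 < e\<close>] by (elim exE conjE) (rule that)
      have "sym_diff (?\<Omega> - ?\<Omega> \<inter> a) (?\<Omega> - B) = sym_diff (?\<Omega> \<inter> a) B"
        using sets.sets_into_space[OF cylinders_measurable[OF T(2,3)]] by auto
      then show "\<exists>T B. finite T \<and> T \<subseteq> {0..1} \<and> B \<in> cylinders T \<and>
          measure \<mu> (sym_diff (?\<Omega> - ?\<Omega> \<inter> a) B) < e \<and> measure \<nu> (sym_diff (?\<Omega> - ?\<Omega> \<inter> a) B) < e"
        using T B cylinders_Diff[OF T(3)] by (intro exI[of _ T] exI[of _ "?\<Omega> - B"]) auto
    qed
  next
    case (Union a)
    \<comment> \<open>A countable union is first truncated by continuity from below, under both
      measures with the same n; only the finite union is then replaced by a cylinder. Each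
      replacement costs e/2.\<close>
    define D where "D n = (\<Union>i<n. ?\<Omega> \<inter> a i)" for n :: nat
    have D: "appr (D n)" for n
    proof (induction n)
      case 0
      then show ?case using appr_exact[of "{}" "{}"] cylinders_empty by (simp add: D_def)
    next
      case (Suc n)
      have "D (Suc n) = D n \<union> (?\<Omega> \<inter> a n)" by (auto simp: D_def less_Suc_eq)
      then show ?case using appr_Un[OF Suc Union.IH[of n]] by simp
    qed
    then have D_sets: "D n \<in> sets path_space" for n by (rule appr_sets)
    have lim: "\<forall>\<^sub>F n in sequentially. measure \<kappa> (sym_diff (\<Union>n. D n) (D n)) < e"
      if "finite_measure \<kappa>" "sets \<kappa> = sets path_space" "0 < e" for \<kappa> e
    proof -
      interpret finite_measure \<kappa> by fact
      have "(\<lambda>n. measure \<kappa> (D n)) \<longlonglongrightarrow> measure \<kappa> (\<Union>n. D n)"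
      proof (rule finite_Lim_measure_incseq)
        show "range D \<subseteq> sets \<kappa>" using D_sets that by auto
        show "incseq D" unfolding incseq_def D_def using less_le_trans by (intro allI impI UN_mono) auto
      qed
      then have "(\<lambda>n. measure \<kappa> (\<Union>n. D n) - measure \<kappa> (D n)) \<longlonglongrightarrow> 0"
        using tendsto_diff[OF tendsto_const[of "measure \<kappa> (\<Union>n. D n)"]] by fastforce
      moreover have "measure \<kappa> (sym_diff (\<Union>n. D n) (D n)) = measure \<kappa> (\<Union>n. D n) - measure \<kappa> (D n)" for n
      proof -
        have "sym_diff (\<Union>n. D n) (D n) = (\<Union>n. D n) - D n" by auto
        then show ?thesis using D_sets that by (simp add: finite_measure_Diff UN_upper)
      qed
      ultimately show ?thesis using that(3) by (auto dest: order_tendstoD(2))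
    qed
    have eq: "?\<Omega> \<inter> (\<Union>i. a i) = (\<Union>n. D n)" by (auto simp: D_def)
    have U_sets: "(\<Union>n. D n) \<in> sets path_space" using D_sets by auto
    show ?case unfolding eq appr_def
    proof (intro conjI allI impI U_sets)
      fix e :: real assume e: "0 < e"
      then have e2: "0 < e / 2" by simp
      from eventually_conj[OF lim[OF \<mu> e2] lim[OF \<nu> e2]]
      obtain n where n: "measure \<mu> (sym_diff (\<Union>n. D n) (D n)) < e / 2" "measure \<nu> (sym_diff (\<Union>n. D n) (D n)) < e / 2"
        by (auto dest: eventually_happens)
      obtain T B where T: "finite T" "T \<subseteq> {0..1}" "B \<in> cylinders T"
        and B: "measure \<mu> (sym_diff (D n) B) < e / 2" "measure \<nu> (sym_diff (D n) B) < e / 2"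
        using apprD[OF D[of n] e2] by (elim exE conjE) (rule that)
      show "\<exists>T B. finite T \<and> T \<subseteq> {0..1} \<and> B \<in> cylinders T \<and>
          measure \<mu> (sym_diff (\<Union>n. D n) B) < e \<and> measure \<nu> (sym_diff (\<Union>n. D n) B) < e"
        using union_le[OF \<mu> U_sets D_sets[of n] cylinders_measurable[OF T(2,3)]]
          union_le[OF \<nu> U_sets D_sets[of n] cylinders_measurable[OF T(2,3)]] n B T
        by (intro exI[of _ T] exI[of _ B]) auto
    qed
  qed
  have "\<exists>A'. A' \<in> sets (Pi\<^sub>M {0..1::real} (\<lambda>_. borel :: real measure)) \<and> A = {y. continuous_on {0..1} y} \<inter> A'"
    using A by (auto simp: path_space_def sets_restrict_space)
  then obtain A' where A': "A' \<in> sets (Pi\<^sub>M {0..1::real} (\<lambda>_. borel :: real measure))" "A = {y. continuous_on {0..1} y} \<inter> A'"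
    by blast
  have "A' \<subseteq> (\<Pi>\<^sub>E i\<in>{0..1}. UNIV)" using sets.sets_into_space[OF A'(1)] by (simp add: space_PiM)
  then have "A = ?\<Omega> \<inter> A'" unfolding A'(2) by (auto simp: space_path_space PiE_iff)
  moreover have "appr (?\<Omega> \<inter> A')" using A'(1) unfolding sets_PiM_single by (rule appr_all)
  ultimately have "appr A" by simp
  then show ?thesis using \<open>0 < e\<close> unfolding appr_def by blast
qed

section \<open>Testing two signals in white noise\<close>

context white_noise
begin

text \<open>The times in T are completed to a partition from 0 to 1. On paths starting at 0, which
  carry both laws, a cylinder over T is an event about the increments of that partition.\<close>

lemma has_LR_on_cylinders:
  assumes f: "L2 f" and g: "L2 g" and T: "finite T" "T \<subseteq> {0..1}"
  shows "has_LR_on f g (cylinders T)"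
proof -
  obtain n t where n: "0 < n" and t: "\<And>i. i < n \<Longrightarrow> t i < t (Suc i)" "t 0 = 0" "t n = 1" and Tt: "T \<subseteq> t ` {..n}"
    using finite_subset_partition[OF T] by blast
  note t' = t(1,2) t(3)[THEN eq_refl]
  \<comment> \<open>Partial sums recover the values at T from the increments: the cells that end no
    later than s are those to the left of s.\<close>
  define G where "G x = (\<lambda>s\<in>T. \<Sum>i<n. (if t (Suc i) \<le> s then x i else 0))" for x :: "nat \<Rightarrow> real"
  have G_meas: "G \<in> measurable (Pi\<^sub>M {..<n} (\<lambda>_. borel)) (Pi\<^sub>M T (\<lambda>_. borel))"
    unfolding G_def
  proof (intro measurable_restrict borel_measurable_sum)
    fix s i assume "i \<in> {..<n}"
    then show "(\<lambda>x. if t (Suc i) \<le> s then x i else 0) \<in> borel_measurable (Pi\<^sub>M {..<n} (\<lambda>_. borel :: real measure))"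
      by (cases "t (Suc i) \<le> s") (auto intro: measurable_component_singleton)
  qed
  have G_incr: "G (incr n t y) = restrict y T" if "y 0 = 0" for y
  proof
    fix s
    show "G (incr n t y) s = restrict y T s"
    proof (cases "s \<in> T")
      case True
      then obtain k where k: "k \<le> n" "s = t k" using Tt by auto
      have iff: "t (Suc i) \<le> t k \<longleftrightarrow> i < k" if "i < n" for i
        using partition_mono[of n t "Suc i" k, OF t'] partition_strict[of n t k "Suc i", OF t'] that k(1)
        by (cases "i < k") (auto simp: not_less)
      have "G (incr n t y) s = (\<Sum>i<n. (if i < k then y (t (Suc i)) - y (t i) else 0))"
        using True unfolding G_def k(2) by (auto simp: iff incr_def intro!: sum.cong)
      also have "\<dots> = (\<Sum>i<k. y (t (Suc i)) - y (t i))"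
        using k(1) by (intro sum.mono_neutral_cong_right) auto
      also have "\<dots> = y (t k)" using that t(2) sum_lessThan_telescope[of "\<lambda>i. y (t i)" k] by simp
      finally show ?thesis using True k by simp
    qed (simp add: G_def)
  qed
  obtain \<xi> b where \<xi>: "distributed (law f) lborel \<xi> std_normal_density" and b: "0 \<le> b" "b \<le> separation f g"
    and LR: "\<And>A. A \<in> incr_event n t ` sets (Pi\<^sub>M {..<n} (\<lambda>_. borel)) \<Longrightarrow>
      measure (law g) A = (\<integral>y. indicator A y * exp (2 * b * \<xi> y - 2 * b\<^sup>2) \<partial>law f)"
    using has_LR_on_incr_events[of n t f g, OF t' f g n] unfolding has_LR_on_def by blast
  have \<xi>_meas: "\<xi> \<in> borel_measurable path_space" using \<xi> by (simp add: distributed_def)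
  show ?thesis
    unfolding has_LR_on_def
  proof (intro exI conjI ballI)
    fix A assume A: "A \<in> cylinders T"
    from A[unfolded cylinders_iff] obtain E
      where E: "E \<in> sets (Pi\<^sub>M T (\<lambda>_. borel))" "A = (\<lambda>y. restrict y T) -` E \<inter> space path_space"
      by (elim bexE) (rule that)
    note A = cylinders_measurable[OF T(2) A]
    define B where "B = incr_event n t (G -` E \<inter> space (Pi\<^sub>M {..<n} (\<lambda>_. borel)))"
    have GE: "G -` E \<inter> space (Pi\<^sub>M {..<n} (\<lambda>_. borel)) \<in> sets (Pi\<^sub>M {..<n} (\<lambda>_. borel))"
      using G_meas E(1) by (rule measurable_sets)
    have B: "B \<in> sets path_space"
      unfolding B_def incr_event_def using incr_measurable[of n t, OF t'] GE by (rule measurable_sets)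
    have AB: "y \<in> A \<longleftrightarrow> y \<in> B" if "y 0 = 0" for y
      using G_incr[of y] that unfolding E(2) B_def incr_event_def by (auto simp: space_PiM incr_def)
    have "AE y in law g. y \<in> A \<longleftrightarrow> y \<in> B"
      using AE_law_0[OF g] by (rule AE_mp) (use AB in auto)
    then have "measure (law g) A = measure (law g) B"
      using A B by (intro measure_eq_AE) auto
    also have "\<dots> = (\<integral>y. indicator B y * exp (2 * b * \<xi> y - 2 * b\<^sup>2) \<partial>law f)"
      by (rule LR) (use GE in \<open>auto simp: B_def\<close>)
    also have "\<dots> = (\<integral>y. indicator A y * exp (2 * b * \<xi> y - 2 * b\<^sup>2) \<partial>law f)"
    proof (rule integral_cong_AE)
      show "AE y in law f. indicator B y * exp (2 * b * \<xi> y - 2 * b\<^sup>2) = indicator A y * exp (2 * b * \<xi> y - 2 * b\<^sup>2)"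
        using AE_law_0[OF f] by (rule AE_mp) (use AB in \<open>auto simp: indicator_def\<close>)
    qed (use A B \<xi>_meas in simp_all)
    finally show "measure (law g) A = (\<integral>y. indicator A y * exp (2 * b * \<xi> y - 2 * b\<^sup>2) \<partial>law f)" .
  qed fact+
qed

context
  fixes f g assumes f: "L2 f" and g: "L2 g"
begin

interpretation F: prob_space "law f" by (rule prob_space_law[OF f])
interpretation G: prob_space "law g" by (rule prob_space_law[OF g])

lemma law_approximation:
  assumes "A \<in> sets path_space" "0 < e"
  obtains T B where "finite T" "T \<subseteq> {0..1}" "B \<in> cylinders T" "B \<in> sets path_space"
    "measure (law f) (sym_diff A B) < e" "measure (law g) (sym_diff A B) < e"
  using cylinder_approximation[OF F.finite_measure_axioms sets_law G.finite_measure_axioms sets_law assms]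
  by (elim exE conjE) (rule that, assumption+, rule cylinders_measurable, assumption+)

lemma test_error_approx:
  assumes "A \<in> sets path_space" "B \<in> sets path_space"
    "measure (law f) (sym_diff A B) < e" "measure (law g) (sym_diff A B) < e"
  shows "measure (law f) B + measure (law g) (space path_space - B)
    \<le> measure (law f) A + measure (law g) (space path_space - A) + 2 * e"
proof -
  have "measure (law f) B \<le> measure (law f) (A \<union> sym_diff A B)"
    using assms by (intro F.finite_measure_mono) auto
  also have "\<dots> \<le> measure (law f) A + measure (law f) (sym_diff A B)"
    using assms by (intro measure_Un_le) auto
  finally have 1: "measure (law f) B \<le> measure (law f) A + e" using assms by simp
  have "measure (law g) (space path_space - B) \<le> measure (law g) ((space path_space - A) \<union> sym_diff A B)"
    using assms by (intro G.finite_measure_mono) auto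
  also have "\<dots> \<le> measure (law g) (space path_space - A) + measure (law g) (sym_diff A B)"
    using assms by (intro measure_Un_le) auto
  finally have 2: "measure (law g) (space path_space - B) \<le> measure (law g) (space path_space - A) + e"
    using assms by simp
  from 1 2 show ?thesis by simp
qed

text \<open>Coarse observation only makes testing harder: \<open>Phi (- b)\<close> is at least
  \<open>Phi (- separation f g)\<close>. The bound is therefore free of the observation times and
  passes to the limit of approximating cylinders.\<close>

lemma test_lower:
  assumes A: "A \<in> sets path_space"
  shows "2 * Phi (- separation f g) \<le> measure (law f) A + measure (law g) (space path_space - A)"
proof (rule field_le_epsilon)
  fix e :: real assume "0 < e"
  then have e2: "0 < e / 2" by simp
  obtain T B where T: "finite T" "T \<subseteq> {0..1}" and B: "B \<in> cylinders T" "B \<in> sets path_space"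
    "measure (law f) (sym_diff A B) < e / 2" "measure (law g) (sym_diff A B) < e / 2"
    using law_approximation[OF A e2] by blast
  obtain \<xi> b where \<xi>: "distributed (law f) lborel \<xi> std_normal_density" "0 \<le> b" and b: "b \<le> separation f g"
    and LR: "\<And>A. A \<in> cylinders T \<Longrightarrow> measure (law g) A = (\<integral>y. indicator A y * exp (2 * b * \<xi> y - 2 * b\<^sup>2) \<partial>law f)"
    using has_LR_on_cylinders[OF f g T] unfolding has_LR_on_def by blast
  have "2 * Phi (- separation f g) \<le> 2 * Phi (- b)" using b by (simp add: Phi_mono)
  also have "\<dots> \<le> measure (law f) B + measure (law g) (space path_space - B)"
    using F.LR_test_lower[OF \<xi>, of B] B LR[OF cylinders_Diff[OF B(1)]] by simp
  also have "\<dots> \<le> measure (law f) A + measure (law g) (space path_space - A) + e"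
    using test_error_approx[OF A B(2-4)] by simp
  finally show "2 * Phi (- separation f g) \<le> measure (law f) A + measure (law g) (space path_space - A) + e" .
qed

text \<open>Both tests are replaced by cylinders over common times and compared with the same
  likelihood ratio test there, which then drops out by the triangle inequality. Slack is measured
  against \<open>Phi (- separation f g)\<close>, which is at most \<open>Phi (- b)\<close>, so it is
  slack for the discretised problem as well.\<close>

lemma test_stability:
  assumes A: "A \<in> sets path_space" and B: "B \<in> sets path_space"
    and far: "3 * Phi (- separation f g) < 2 * Phi (- 1)" and r: "0 < r" "r \<le> 1 / 2" and d: "0 < d" "d \<le> 1"
    and slackA: "measure (law f) A + measure (law g) (space path_space - A) \<le> (2 + r) * Phi (- separation f g)"
    and slackB: "measure (law f) B + measure (law g) (space path_space - B) \<le> (2 + r) * Phi (- separation f g)"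
  shows "measure (law f) (sym_diff A B) \<le> (4 * exp 2 * d + 8 * r / d + r) * Phi (- separation f g)"
proof -
  define p where "p = Phi (- separation f g)"
  have p: "0 < p" by (simp add: p_def Phi_pos)
  \<comment> \<open>Passing to cylinders adds at most 2 e = r p to a total error, which turns the
    slack r into 2 r.\<close>
  define e where "e = r * p / 2"
  have e: "0 < e" using r p by (simp add: e_def)
  obtain S A' where S: "finite S" "S \<subseteq> {0..1}" and A': "A' \<in> cylinders S" "A' \<in> sets path_space"
    "measure (law f) (sym_diff A A') < e" "measure (law g) (sym_diff A A') < e"
    using law_approximation[OF A e] by blast
  obtain T B' where T: "finite T" "T \<subseteq> {0..1}" and B': "B' \<in> cylinders T" "B' \<in> sets path_space"
    "measure (law f) (sym_diff B B') < e" "measure (law g) (sym_diff B B') < e"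
    using law_approximation[OF B e] by blast
  have ST: "finite (S \<union> T)" "S \<union> T \<subseteq> {0..1}" using S T by auto
  obtain \<xi> b where \<xi>: "distributed (law f) lborel \<xi> std_normal_density" "0 \<le> b" and b: "b \<le> separation f g"
    and LR: "\<And>A. A \<in> cylinders (S \<union> T) \<Longrightarrow> measure (law g) A = (\<integral>y. indicator A y * exp (2 * b * \<xi> y - 2 * b\<^sup>2) \<partial>law f)"
    using has_LR_on_cylinders[OF f g ST] unfolding has_LR_on_def by blast
  let ?N = "{y\<in>space (law f). b < \<xi> y}"
  have cyl: "A' \<in> cylinders (S \<union> T)" "B' \<in> cylinders (S \<union> T)"
    using cylinders_mono[of S "S \<union> T"] cylinders_mono[of T "S \<union> T"] A'(1) B'(1) by auto
  have N: "?N \<in> sets path_space"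
    using \<xi>(1) by (auto simp: distributed_def)
  have pb: "p \<le> Phi (- b)" using b by (simp add: p_def Phi_mono)
  have near: "measure (law f) (sym_diff C ?N) \<le> (2 * exp 2 * d + 4 * r / d) * p"
    if C: "C \<in> cylinders (S \<union> T)" "C \<in> sets path_space"
      and slack: "measure (law f) C + measure (law g) (space path_space - C) \<le> (2 + 2 * r) * p" for C
  proof -
    have LRC: "measure (law g) (space path_space - C) = (\<integral>y. indicator (space (law f) - C) y * exp (2 * b * \<xi> y - 2 * b\<^sup>2) \<partial>law f)"
      using LR[OF cylinders_Diff[OF C(1)]] by simp
    have low: "2 * Phi (- b) \<le> (2 + 2 * r) * p"
      using F.LR_test_lower[OF \<xi>, of C] C(2) slack unfolding LRC by simp
    have "(2 + 2 * r) * p \<le> 3 * p" using r p by (intro mult_right_mono) auto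
    with low have le3: "2 * Phi (- b) \<le> 3 * p" by linarith
    \<comment> \<open>The discretised separation b has only an upper bound by construction. The good
      test itself shows that b is not small: its error bounds \<open>Phi (- b)\<close> by 3/2 p,
      which \<open>far\<close> puts below \<open>Phi (- 1)\<close>.\<close>
    have "1 \<le> b"
    proof (rule ccontr)
      assume "\<not> 1 \<le> b"
      then have "Phi (- 1) \<le> Phi (- b)" by (intro Phi_mono) simp
      then show False using le3 far by (simp add: p_def)
    qed
    have "measure (law f) C + (\<integral>y. indicator (space (law f) - C) y * exp (2 * b * \<xi> y - 2 * b\<^sup>2) \<partial>law f) \<le> 2 * Phi (- b) + 2 * r * p"
      using slack pb unfolding LRC by (simp add: algebra_simps)
    then have "measure (law f) (sym_diff C ?N) \<le> exp 2 * d * Phi (- b) + 2 / d * (2 * r * p)"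
      using C(2) \<open>1 \<le> b\<close> d by (intro F.LR_test_stability[OF \<xi>]) auto
    also have "exp 2 * d * Phi (- b) \<le> exp 2 * d * (2 * p)"
      using le3 p d by (intro mult_left_mono) auto
    finally show ?thesis by (simp add: algebra_simps)
  qed
  have rp: "(2 + 2 * r) * p = (2 + r) * p + 2 * e" by (simp add: e_def algebra_simps)
  have nA: "measure (law f) (sym_diff A' ?N) \<le> (2 * exp 2 * d + 4 * r / d) * p"
    using test_error_approx[OF A A'(2-4)] slackA rp unfolding p_def[symmetric] by (intro near[OF cyl(1) A'(2)]) linarith
  have nB: "measure (law f) (sym_diff B' ?N) \<le> (2 * exp 2 * d + 4 * r / d) * p"
    using test_error_approx[OF B B'(2-4)] slackB rp unfolding p_def[symmetric] by (intro near[OF cyl(2) B'(2)]) linarith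
  have "measure (law f) (sym_diff A B) \<le> measure (law f) ((sym_diff A A' \<union> sym_diff B B') \<union> (sym_diff A' ?N \<union> sym_diff B' ?N))"
    using A B A' B' N by (intro F.finite_measure_mono) (auto simp del: space_law)
  also have "\<dots> \<le> measure (law f) (sym_diff A A' \<union> sym_diff B B') + measure (law f) (sym_diff A' ?N \<union> sym_diff B' ?N)"
    using A B A' B' N by (intro measure_Un_le) (auto simp del: space_law)
  finally have le: "measure (law f) (sym_diff A B) \<le> measure (law f) (sym_diff A A' \<union> sym_diff B B') + measure (law f) (sym_diff A' ?N \<union> sym_diff B' ?N)" .
  have le1: "measure (law f) (sym_diff A A' \<union> sym_diff B B') \<le> measure (law f) (sym_diff A A') + measure (law f) (sym_diff B B')"
    using A B A' B' N by (intro measure_Un_le) (auto simp del: space_law)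
  have le2: "measure (law f) (sym_diff A' ?N \<union> sym_diff B' ?N) \<le> measure (law f) (sym_diff A' ?N) + measure (law f) (sym_diff B' ?N)"
    using A B A' B' N by (intro measure_Un_le) (auto simp del: space_law)
  define q where "q = (2 * exp 2 * d + 4 * r / d) * p"
  have "measure (law f) (sym_diff A B) \<le> 2 * e + 2 * q"
    using le le1 le2 A'(3) B'(3) nA[folded q_def] nB[folded q_def] by linarith
  also have "\<dots> = (4 * exp 2 * d + 8 * r / d + r) * p"
    by (simp add: e_def q_def algebra_simps)
  finally show ?thesis by (simp add: p_def)
qed

text \<open>A quantitative absolute continuity, obtained on cylinders with a constant that depends
  on the full separation only. It carries convergence in probability from one signal to
  another.\<close>

lemma law_absolutely_continuous:
  assumes A: "A \<in> sets path_space"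
  shows "measure (law g) A \<le> exp (2 * (separation f g)\<^sup>2) * sqrt (measure (law f) A)"
proof -
  let ?K = "exp (2 * (separation f g)\<^sup>2)"
  have le: "measure (law g) A \<le> ?K * sqrt (measure (law f) A + e) + e" if e: "0 < e" for e
  proof -
    obtain T B where T: "finite T" "T \<subseteq> {0..1}" and B: "B \<in> cylinders T" "B \<in> sets path_space"
      "measure (law f) (sym_diff A B) < e" "measure (law g) (sym_diff A B) < e"
      using law_approximation[OF A e] by blast
    obtain \<xi> b where \<xi>: "distributed (law f) lborel \<xi> std_normal_density" "0 \<le> b" and b: "b \<le> separation f g"
      and LR: "\<And>A. A \<in> cylinders T \<Longrightarrow> measure (law g) A = (\<integral>y. indicator A y * exp (2 * b * \<xi> y - 2 * b\<^sup>2) \<partial>law f)"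
      using has_LR_on_cylinders[OF f g T] unfolding has_LR_on_def by blast
    have "measure (law g) A \<le> measure (law g) (B \<union> sym_diff A B)"
      using A B by (intro G.finite_measure_mono) auto
    also have "\<dots> \<le> measure (law g) B + measure (law g) (sym_diff A B)"
      using A B by (intro measure_Un_le) auto
    finally have le: "measure (law g) A \<le> measure (law g) B + measure (law g) (sym_diff A B)" .
    have "measure (law g) B \<le> exp (2 * b\<^sup>2) * sqrt (measure (law f) B)"
      using F.LR_integral_le[OF \<xi>, of B] B(2) LR[OF B(1)] by simp
    also have "\<dots> \<le> ?K * sqrt (measure (law f) A + e)"
    proof (rule mult_mono)
      show "exp (2 * b\<^sup>2) \<le> ?K" using b \<xi>(2) by (simp add: power_mono del: times_divide_eq_right)
      have "measure (law f) B \<le> measure (law f) (A \<union> sym_diff A B)"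
        using A B by (intro F.finite_measure_mono) auto
      also have "\<dots> \<le> measure (law f) A + measure (law f) (sym_diff A B)"
        using A B by (intro measure_Un_le) auto
      finally show "sqrt (measure (law f) B) \<le> sqrt (measure (law f) A + e)" using B(3) by simp
    qed auto
    finally show ?thesis using B(4) le by linarith
  qed
  have lim: "((\<lambda>e. ?K * sqrt (measure (law f) A + e) + e) \<longlongrightarrow> ?K * sqrt (measure (law f) A + 0) + 0) (at_right 0)"
    by (intro tendsto_intros)
  show ?thesis
    using tendsto_lowerbound[OF lim, of "measure (law g) A"] le
    by (simp add: eventually_at_filter)
qed

end
end

section \<open>The law of the Wiener integral under a shifted signal\<close>

lemma std_normal_density_le_1: "std_normal_density x \<le> 1"
proof -
  have "1 \<le> sqrt (2 * pi)" using pi_gt3 by simp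
  then have "1 / sqrt (2 * pi) \<le> 1" by simp
  moreover have "exp (- x\<^sup>2 / 2) \<le> 1" by simp
  ultimately show ?thesis unfolding std_normal_density_def
    by (meson exp_ge_zero mult_le_one)
qed

lemma Phi_Lipschitz: "\<bar>Phi x - Phi y\<bar> \<le> \<bar>x - y\<bar>"
proof -
  have *: "\<bar>Phi x - Phi y\<bar> \<le> \<bar>x - y\<bar>" if "x \<le> y" for x y
  proof -
    have "Phi y - Phi x = measure std_normal_distribution {- y..<- x}"
      using Phi_diff[of "- y" "- x"] that by simp
    also have "\<dots> \<le> 1 * (- x - (- y))"
      using that by (intro measure_normal_le) (auto intro: std_normal_density_le_1)
    finally show ?thesis using that Phi_mono[OF that] by simp
  qed
  show ?thesis using *[of x y] *[of y x] by (cases "x \<le> y") (auto simp: abs_minus_commute)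
qed

lemma isCont_Phi: "isCont Phi x"
  unfolding isCont_def
proof (rule LIM_I)
  fix r :: real assume "0 < r"
  then show "\<exists>s>0. \<forall>y. y \<noteq> x \<and> norm (y - x) < s \<longrightarrow> norm (Phi y - Phi x) < r"
    using Phi_Lipschitz by (intro exI[of _ r]) (auto intro: le_less_trans)
qed

lemma step_fun_Nil[simp]: "step_fun [] s = 0"
  and step_fun_Cons[simp]: "step_fun ((a, b, c) # ps) s = c * indicator {a<..b} s + step_fun ps s"
  by (simp_all add: step_fun_def)

lemma step_integral_Nil[simp]: "step_integral [] w y = 0"
  and step_integral_Cons[simp]: "step_integral ((a, b, c) # ps) w y = c * (w b y - w a y) + step_integral ps w y"
  by (simp_all add: step_integral_def)

abbreviation step_list :: "(real \<times> real \<times> real) list \<Rightarrow> bool" where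
  "step_list ps \<equiv> (\<forall>(a, b, c)\<in>set ps. 0 \<le> a \<and> a \<le> b \<and> b \<le> 1)"

lemma L2_step_fun: "L2 (step_fun ps)"
proof (induction ps)
  case Nil
  have "step_fun [] = (\<lambda>_. 0)" by (simp add: fun_eq_iff)
  then show ?case by simp
next
  case (Cons p ps)
  obtain a b c where p: "p = (a, b, c)" by (cases p)
  have "step_fun (p # ps) = (\<lambda>s. c * indicator {a<..b} s + step_fun ps s)" by (simp add: p fun_eq_iff)
  then show ?case using L2_add[OF L2_cmult[OF L2_indicator] Cons.IH] by metis
qed

lemma ip_step_fun:
  assumes "L2 h" "step_list ps"
  shows "ip h (step_fun ps) = (\<Sum>(a, b, c)\<leftarrow>ps. c * (drift h b - drift h a))"
  using assms(2)
proof (induction ps)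
  case Nil
  have "step_fun [] = (\<lambda>_. 0)" by (simp add: fun_eq_iff)
  then show ?case by (simp add: ip_def)
next
  case (Cons p ps)
  obtain a b c where p: "p = (a, b, c)" by (cases p)
  have "step_fun (p # ps) = (\<lambda>s. c * indicator {a<..b} s + step_fun ps s)" by (simp add: p fun_eq_iff)
  then have eq: "ip h (step_fun (p # ps)) = c * ip h (indicator {a<..b}) + ip h (step_fun ps)"
    using assms(1) by (simp add: ip_add_right L2_cmult L2_step_fun ip_cmult_right)
  have IH: "ip h (step_fun ps) = (\<Sum>(a, b, c)\<leftarrow>ps. c * (drift h b - drift h a))" using Cons by simp
  have "drift h b - drift h a = ip h (indicator {a<..b})"
    using Cons.prems by (intro drift_increment[OF assms(1)]) (auto simp: p)
  then show ?case unfolding eq IH by (simp add: p)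
qed

lemma partition_cell:
  fixes t :: "nat \<Rightarrow> real"
  assumes "t 0 < x" "x \<le> t n"
  obtains i where "i < n" "x \<in> {t i<..t (Suc i)}"
proof -
  define j where "j = (LEAST j. x \<le> t j)"
  have j: "x \<le> t j" "j \<le> n" unfolding j_def using assms(2) by (auto intro: LeastI Least_le)
  have "j \<noteq> 0" using j assms(1) by (intro notI) auto
  then obtain i where i: "j = Suc i" by (cases j) auto
  have "\<not> x \<le> t i" using not_less_Least[of i "\<lambda>j. x \<le> t j"] i by (simp add: j_def)
  then show ?thesis using that[of i] i j by auto
qed

context
  fixes n :: nat and t :: "nat \<Rightarrow> real"
  assumes t: "\<And>i. i < n \<Longrightarrow> t i < t (Suc i)" "t 0 = 0" "t n \<le> 1"
begin

lemma partition_le_iff: "i \<le> n \<Longrightarrow> j \<le> n \<Longrightarrow> t i \<le> t j \<longleftrightarrow> i \<le> j"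
  using partition_mono[of n t i j, OF t] partition_strict[of n t j i, OF t] by (cases "i \<le> j") auto

lemma partition_less_iff: "i \<le> n \<Longrightarrow> j \<le> n \<Longrightarrow> t i < t j \<longleftrightarrow> i < j"
  using partition_le_iff[of j i] by (auto simp: not_le[symmetric])

lemma step_fun_on_cell:
  assumes "i < n" "x \<in> {t i<..t (Suc i)}" "(\<Union>(a, b, c)\<in>set ps. {a, b}) \<subseteq> t ` {..n}"
  shows "step_fun ps x = step_fun ps (t (Suc i))"
  using assms(3)
proof (induction ps)
  case (Cons p ps)
  obtain a b c where p: "p = (a, b, c)" by (cases p)
  obtain k l where k: "a = t k" "k \<le> n" and l: "b = t l" "l \<le> n" using Cons.prems p by auto
  have "a < x \<longleftrightarrow> a < t (Suc i)"
  proof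
    assume "a < t (Suc i)"
    then have "k \<le> i" using partition_less_iff[of k "Suc i"] assms(1) k by auto
    then show "a < x" using partition_le_iff[of k i] assms(1,2) k by auto
  qed (use assms(2) in auto)
  moreover have "x \<le> b \<longleftrightarrow> t (Suc i) \<le> b"
  proof
    assume "x \<le> b"
    then have "t i < t l" using assms(2) l by auto
    then show "t (Suc i) \<le> b" using partition_less_iff[of i l] partition_le_iff[of "Suc i" l] assms(1) l by auto
  qed (use assms(2) in auto)
  ultimately show ?case using Cons by (auto simp: p indicator_def)
qed simp

lemma step_integral_partition:
  assumes "step_list ps" "(\<Union>(a, b, c)\<in>set ps. {a, b}) \<subseteq> t ` {..n}"
  shows "step_integral ps w y = (\<Sum>i<n. step_fun ps (t (Suc i)) * (w (t (Suc i)) y - w (t i) y))"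
  using assms
proof (induction ps)
  case (Cons p ps)
  obtain a b c where p: "p = (a, b, c)" by (cases p)
  obtain k l where k: "a = t k" "k \<le> n" and l: "b = t l" "l \<le> n" using Cons.prems p by auto
  have kl: "k \<le> l" using partition_le_iff[of k l] k l Cons.prems p by auto
  have "(\<Sum>i<n. c * indicator {a<..b} (t (Suc i)) * (w (t (Suc i)) y - w (t i) y))
      = (\<Sum>i\<in>{k..<l}. c * (w (t (Suc i)) y - w (t i) y))"
  proof (rule sum.mono_neutral_cong_right)
    show "{k..<l} \<subseteq> {..<n}" using l by auto
    show "\<forall>i\<in>{..<n} - {k..<l}. c * indicator {a<..b} (t (Suc i)) * (w (t (Suc i)) y - w (t i) y) = 0"
      using k l partition_less_iff[of k] partition_le_iff[of _ l] by (auto simp: indicator_def)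
    show "c * indicator {a<..b} (t (Suc i)) * (w (t (Suc i)) y - w (t i) y) = c * (w (t (Suc i)) y - w (t i) y)"
      if "i \<in> {k..<l}" for i
      using that k l partition_less_iff[of k "Suc i"] partition_le_iff[of "Suc i" l] by (auto simp: indicator_def)
  qed simp
  also have "\<dots> = c * (w b y - w a y)"
    using sum_Suc_diff'[OF kl, of "\<lambda>i. w (t i) y"] k l by (simp add: sum_distrib_left[symmetric])
  finally show ?case using Cons by (simp add: p distrib_right sum.distrib)
qed simp

end

section \<open>Step integrals and Wiener integrals under a signal other than the reference
  signal\<close>

context white_noise
begin

text \<open>The intervals in the list may overlap, so the increments in the sum need not be
  independent. On a common refinement the step function is constant on cells and the sum becomes a
  weighted sum of independent increments.\<close>

lemma step_integral_normal:
  assumes ps: "step_list ps" and pos: "0 < ip (step_fun ps) (step_fun ps)"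
  shows "distributed M lborel (step_integral ps W) (normal_density 0 (sqrt (ip (step_fun ps) (step_fun ps))))"
proof -
  define T where "T = (\<Union>(a, b, c)\<in>set ps. {a, b})"
  have T: "finite T" "T \<subseteq> {0..1}" using ps by (fastforce simp: T_def)+
  obtain n t where n: "0 < n" and t: "\<And>i. i < n \<Longrightarrow> t i < t (Suc i)" "t 0 = 0" "t n = 1" and Tt: "T \<subseteq> t ` {..n}"
    using finite_subset_partition[OF T] by blast
  note t' = t(1,2) t(3)[THEN eq_refl]
  define c where "c i = step_fun ps (t (Suc i))" for i
  have "ip (step_fun ps) (step_fun ps) = ip (\<lambda>s. \<Sum>i<n. c i * indicator {t i<..t (Suc i)} s) (\<lambda>s. \<Sum>i<n. c i * indicator {t i<..t (Suc i)} s)"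
    unfolding ip_def
  proof (rule Bochner_Integration.integral_cong[OF refl])
    fix x assume "x \<in> space unit_leb"
    then have "t 0 < x" "x \<le> t n" using t by auto
    then obtain i where i: "i < n" "x \<in> {t i<..t (Suc i)}" by (rule partition_cell)
    have "step_fun ps x = (\<Sum>i<n. c i * indicator {t i<..t (Suc i)} x)"
      using step_on_cell[of n t, OF t' i, of c] step_fun_on_cell[of n t, OF t' i Tt[unfolded T_def]]
      unfolding c_def by (rule trans[OF _ sym, rotated])
    then show "step_fun ps x * step_fun ps x = (\<Sum>i<n. c i * indicator {t i<..t (Suc i)} x) * (\<Sum>i<n. c i * indicator {t i<..t (Suc i)} x)"
      by (simp only:)
  qed
  also have "\<dots> = (\<Sum>i<n. (c i)\<^sup>2 * (t (Suc i) - t i))"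
    by (rule ip_step_step[of n t, OF t'])
  finally have ip: "ip (step_fun ps) (step_fun ps) = (\<Sum>i<n. (c i)\<^sup>2 * (t (Suc i) - t i))" .
  have "\<exists>i<n. c i \<noteq> 0"
  proof (rule ccontr)
    assume "\<not> (\<exists>i<n. c i \<noteq> 0)"
    then show False using pos unfolding ip by simp
  qed
  then have D: "distributed M lborel (\<lambda>\<omega>. \<Sum>i<n. c i * (W (t (Suc i)) \<omega> - W (t i) \<omega>))
      (normal_density 0 (sqrt (\<Sum>i<n. (c i)\<^sup>2 * (t (Suc i) - t i))))"
    by (rule weighted_increments_normal[rotated 3]) (use t' in auto)
  have "step_integral ps W = (\<lambda>\<omega>. \<Sum>i<n. c i * (W (t (Suc i)) \<omega> - W (t i) \<omega>))"
    unfolding c_def by (rule ext) (rule step_integral_partition[of n t, OF t' ps Tt[unfolded T_def]])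
  with D show ?thesis unfolding ip by simp
qed

lemma step_integral_path:
  assumes f: "L2 f" and g: "L2 g" and ps: "step_list ps"
  shows "step_integral ps (noise \<epsilon> f) (path g \<omega>) = ip (\<lambda>x. g x - f x) (step_fun ps) / \<epsilon> + step_integral ps W \<omega>"
  unfolding ip_step_fun[OF L2_diff[OF g f] ps] using ps
proof (induction ps)
  case (Cons p ps)
  obtain a b c where p: "p = (a, b, c)" by (cases p)
  have "noise \<epsilon> f b (path g \<omega>) - noise \<epsilon> f a (path g \<omega>) =
      (drift (\<lambda>x. g x - f x) b - drift (\<lambda>x. g x - f x) a) / \<epsilon> + (W b \<omega> - W a \<omega>)"
    using Cons.prems \<epsilon> by (simp add: p noise_def path_def drift_diff[OF g f] field_simps)
  then have "c * (noise \<epsilon> f b (path g \<omega>) - noise \<epsilon> f a (path g \<omega>)) =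
      c * (drift (\<lambda>x. g x - f x) b - drift (\<lambda>x. g x - f x) a) / \<epsilon> + c * (W b \<omega> - W a \<omega>)"
    by (simp add: distrib_left)
  then show ?case using Cons by (simp add: p add_divide_distrib)
qed simp

lemma step_integral_measurable:
  assumes "step_list ps"
  shows "step_integral ps (noise \<epsilon> f) \<in> borel_measurable path_space"
  using assms
proof (induction ps)
  case Nil
  have "step_integral [] (noise \<epsilon> f) = (\<lambda>_. 0)" by (simp add: fun_eq_iff)
  then show ?case by simp
next
  case (Cons p ps)
  obtain a b c where p: "p = (a, b, c)" by (cases p)
  have [measurable]: "noise \<epsilon> f s \<in> borel_measurable path_space" if "s \<in> {0..1}" for s
    unfolding noise_def[abs_def] using measurable_coordinate[OF that] by measurable
  have "a \<in> {0..1}" "b \<in> {0..1}" using Cons.prems p by auto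
  note [measurable] = \<open>a \<in> {0..1}\<close> \<open>b \<in> {0..1}\<close>
  have "step_integral ps (noise \<epsilon> f) \<in> borel_measurable path_space" using Cons by simp
  moreover have "step_integral (p # ps) (noise \<epsilon> f) = (\<lambda>y. c * (noise \<epsilon> f b y - noise \<epsilon> f a y) + step_integral ps (noise \<epsilon> f) y)"
    by (simp add: p fun_eq_iff)
  ultimately show ?case by simp
qed

text \<open>Replacing the signal f by g adds a deterministic mean to the integral and leaves its
  variance unchanged. The sign c covers the upper and the lower tail at once.\<close>

lemma step_integral_tail:
  assumes f: "L2 f" and g: "L2 g" and ps: "step_list ps" and pos: "0 < ip (step_fun ps) (step_fun ps)"
    and c: "\<bar>c\<bar> = 1"
  shows "measure (law g) {y \<in> space path_space. x \<le> c * step_integral ps (noise \<epsilon> f) y}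
    = Phi ((c * (ip (\<lambda>x. g x - f x) (step_fun ps) / \<epsilon>) - x) / sqrt (ip (step_fun ps) (step_fun ps)))"
proof -
  define v where "v = ip (step_fun ps) (step_fun ps)"
  define m where "m = ip (\<lambda>x. g x - f x) (step_fun ps) / \<epsilon>"
  have sv: "0 < sqrt v" using pos by (simp add: v_def)
  have c0: "c \<noteq> 0" using c by auto
  have "distributed M lborel (\<lambda>\<omega>. c * m + c * step_integral ps W \<omega>) (normal_density (c * m) (sqrt v))"
    using normal_density_affine[OF step_integral_normal[OF ps pos] _ c0, of "c * m"] sv c by (simp add: v_def)
  then have N: "distributed M lborel (\<lambda>\<omega>. ((c * m + c * step_integral ps W \<omega>) - c * m) / sqrt v) std_normal_density"
    by (simp only: normal_standard_normal_convert[OF sv])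
  note J[measurable] = step_integral_measurable[OF ps, of f]
  have A: "{y \<in> space path_space. x \<le> c * step_integral ps (noise \<epsilon> f) y} \<in> sets path_space"
    by measurable
  have "measure (law g) {y \<in> space path_space. x \<le> c * step_integral ps (noise \<epsilon> f) y}
    = prob (path g -` {y \<in> space path_space. x \<le> c * step_integral ps (noise \<epsilon> f) y} \<inter> space M)"
    unfolding law_eq by (rule measure_distr[OF path_measurable[OF g] A])
  also have "path g -` {y \<in> space path_space. x \<le> c * step_integral ps (noise \<epsilon> f) y} \<inter> space M
      = {\<omega> \<in> space M. ((c * m + c * step_integral ps W \<omega>) - c * m) / sqrt v \<in> {(x - c * m) / sqrt v..}}"
    using measurable_space[OF path_measurable[OF g]] sv
    by (auto simp: step_integral_path[OF f g ps] m_def[symmetric] divide_le_cancel distrib_left)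
  also have "prob \<dots> = measure std_normal_distribution {(x - c * m) / sqrt v..}"
    by (rule prob_std_normal[OF N]) simp
  also have "\<dots> = Phi ((c * m - x) / sqrt v)"
    by (simp add: Phi_uminus[symmetric] minus_divide_left)
  finally show ?thesis by (simp add: m_def v_def)
qed

text \<open>The approximation of Z by step integrals holds in mean square under \<open>law f\<close>
  only; \<open>law_absolutely_continuous\<close> makes it an approximation in probability under
  \<open>law g\<close>. An upper bound is enough, since the matching lower bound for a test built
  from Z comes from \<open>test_lower\<close>.\<close>

lemma wiener_integral_tail:
  assumes f: "L2 f" and g: "L2 g" and \<phi>: "L2 \<phi>" "0 < ip \<phi> \<phi>" and c: "\<bar>c\<bar> = 1"
    and Z: "has_wiener_integral (law f) (noise \<epsilon> f) \<phi> Z"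
  shows "measure (law g) {y \<in> space path_space. x \<le> c * Z y}
    \<le> Phi ((c * (ip (\<lambda>x. g x - f x) \<phi> / \<epsilon>) - x) / sqrt (ip \<phi> \<phi>))"
proof -
  interpret F: prob_space "law f" by (rule prob_space_law[OF f])
  interpret G: prob_space "law g" by (rule prob_space_law[OF g])
  have c_abs: "c * z - c * z' \<le> \<bar>z - z'\<bar>" for z z'
  proof -
    have "c * z - c * z' = c * (z - z')" by (simp add: right_diff_distrib)
    also have "\<dots> \<le> \<bar>c * (z - z')\<bar>" by simp
    finally show ?thesis by (simp add: abs_mult c)
  qed
  have Zm[measurable]: "Z \<in> borel_measurable path_space" using Z by (simp add: has_wiener_integral_def)
  obtain ps where ps: "\<And>n. step_list (ps n)"
    and lim\<phi>: "(\<lambda>n. \<integral>\<^sup>+s. ennreal ((\<phi> s - step_fun (ps n) s)\<^sup>2) \<partial>unit_leb) \<longlonglongrightarrow> 0"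
    and limZ: "(\<lambda>n. \<integral>\<^sup>+y. ennreal ((Z y - step_integral (ps n) (noise \<epsilon> f) y)\<^sup>2) \<partial>law f) \<longlonglongrightarrow> 0"
    using Z unfolding has_wiener_integral_def by blast
  define s where "s n = step_fun (ps n)" for n
  define J where "J n = step_integral (ps n) (noise \<epsilon> f)" for n
  have s: "L2 (s n)" for n by (simp add: s_def L2_step_fun)
  have Jm[measurable]: "J n \<in> borel_measurable path_space" for n
    unfolding J_def by (rule step_integral_measurable[OF ps])
  define a where "a n = ip (\<lambda>x. \<phi> x - s n x) (\<lambda>x. \<phi> x - s n x)" for n
  have "(\<integral>\<^sup>+x. ennreal ((\<phi> x - step_fun (ps n) x)\<^sup>2) \<partial>unit_leb) = ennreal (a n)" for n
    unfolding a_def ip_self s_def[symmetric]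
    using L2_diff[OF \<phi>(1) s[of n]] by (intro nn_integral_eq_integral) (auto simp: L2_def)
  with lim\<phi> have "(\<lambda>n. ennreal (a n)) \<longlonglongrightarrow> ennreal 0" by simp
  then have a: "a \<longlonglongrightarrow> 0"
    by (subst (asm) tendsto_ennreal_iff) (auto simp: a_def ip_self_nonneg)
  have ip_lim: "(\<lambda>n. ip h (s n)) \<longlonglongrightarrow> ip h \<phi>" if h: "L2 h" for h
  proof -
    have lim: "(\<lambda>n. sqrt (ip h h) * sqrt (a n)) \<longlonglongrightarrow> 0"
      using tendsto_mult_left[OF tendsto_real_sqrt[OF a], of "sqrt (ip h h)"] by simp
    have "norm (ip h \<phi> - ip h (s n)) \<le> sqrt (ip h h) * sqrt (a n)" for n
      using abs_ip_le[OF h L2_diff[OF \<phi>(1) s[of n]]] ip_diff_right[OF h \<phi>(1) s[of n]] by (simp add: a_def)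
    then have "(\<lambda>n. ip h \<phi> - ip h (s n)) \<longlonglongrightarrow> 0"
      by (intro Lim_null_comparison[OF _ lim]) simp
    from tendsto_diff[OF tendsto_const[of "ip h \<phi>"] this] show ?thesis by simp
  qed
  have v_lim: "(\<lambda>n. ip (s n) (s n)) \<longlonglongrightarrow> ip \<phi> \<phi>"
  proof -
    have "ip (s n) (s n) = a n + 2 * ip \<phi> (s n) - ip \<phi> \<phi>" for n
      using \<phi>(1) s[of n] unfolding a_def
      by (simp add: ip_diff_right L2_diff ip_diff_left ip_commute[of "s n" \<phi>])
    moreover have "(\<lambda>n. a n + 2 * ip \<phi> (s n) - ip \<phi> \<phi>) \<longlonglongrightarrow> 0 + 2 * ip \<phi> \<phi> - ip \<phi> \<phi>"
      by (intro tendsto_intros a ip_lim \<phi>)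
    ultimately show ?thesis by simp
  qed
  \<comment> \<open>If x \<le> c Z, then c J is at least x - e or Z and J differ by at least e. The
    second event disappears as the step functions converge; the margin e is removed afterwards by
    continuity of \<open>Phi\<close>.\<close>
  have bound: "measure (law g) {y \<in> space path_space. x \<le> c * Z y}
      \<le> Phi ((c * (ip (\<lambda>x. g x - f x) \<phi> / \<epsilon>) - (x - e)) / sqrt (ip \<phi> \<phi>))" if e: "0 < e" for e
  proof -
    define D where "D n = {y \<in> space path_space. e\<^sup>2 \<le> (Z y - J n y)\<^sup>2}" for n
    have Dm[measurable]: "D n \<in> sets path_space" for n unfolding D_def by measurable
    have "(\<lambda>n. measure (law f) (D n)) \<longlonglongrightarrow> 0"
    proof -
      have le: "ennreal (measure (law f) (D n)) \<le> ennreal (1 / e\<^sup>2) * (\<integral>\<^sup>+y. ennreal ((Z y - J n y)\<^sup>2) \<partial>law f)" for n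
      proof -
        have "{y \<in> space (law f). 1 \<le> ennreal (1 / e\<^sup>2) * ennreal ((Z y - J n y)\<^sup>2)} = D n"
          using e by (auto simp: D_def ennreal_mult'[symmetric] ennreal_1[symmetric] pos_le_divide_eq simp del: ennreal_1)
        moreover have "(\<integral>\<^sup>+y. ennreal ((Z y - J n y)\<^sup>2) * indicator (space path_space) y \<partial>law f)
            = (\<integral>\<^sup>+y. ennreal ((Z y - J n y)\<^sup>2) \<partial>law f)"
          by (intro nn_integral_cong) simp
        ultimately show ?thesis
          using nn_integral_Markov_inequality[of "\<lambda>y. ennreal ((Z y - J n y)\<^sup>2)" "space (law f)" "law f" "ennreal (1 / e\<^sup>2)"]
          by (simp add: F.emeasure_eq_measure)
      qed
      have "(\<lambda>n. ennreal (1 / e\<^sup>2) * (\<integral>\<^sup>+y. ennreal ((Z y - J n y)\<^sup>2) \<partial>law f)) \<longlonglongrightarrow> ennreal (1 / e\<^sup>2) * 0"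
        using limZ by (intro ennreal_tendsto_cmult) (simp_all add: J_def)
      then have "(\<lambda>n. ennreal (measure (law f) (D n))) \<longlonglongrightarrow> ennreal 0"
        by (intro tendsto_sandwich[where f="\<lambda>_. 0" and g="\<lambda>n. ennreal (measure (law f) (D n))"
            and h="\<lambda>n. ennreal (1 / e\<^sup>2) * (\<integral>\<^sup>+y. ennreal ((Z y - J n y)\<^sup>2) \<partial>law f)"]) (auto simp: le)
      then show ?thesis by (subst (asm) tendsto_ennreal_iff) auto
    qed
    then have D_lim: "(\<lambda>n. exp (2 * (separation f g)\<^sup>2) * sqrt (measure (law f) (D n))) \<longlonglongrightarrow> 0"
      using tendsto_mult_left[OF tendsto_real_sqrt, of _ 0 sequentially "exp (2 * (separation f g)\<^sup>2)"] by simp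
    let ?R = "\<lambda>n. Phi ((c * (ip (\<lambda>x. g x - f x) (s n) / \<epsilon>) - (x - e)) / sqrt (ip (s n) (s n)))
      + exp (2 * (separation f g)\<^sup>2) * sqrt (measure (law f) (D n))"
    have "?R \<longlonglongrightarrow> Phi ((c * (ip (\<lambda>x. g x - f x) \<phi> / \<epsilon>) - (x - e)) / sqrt (ip \<phi> \<phi>)) + 0"
      using \<phi>(2) \<epsilon>
      by (intro tendsto_add isCont_tendsto_compose[OF isCont_Phi] D_lim tendsto_divide tendsto_diff tendsto_mult
          tendsto_const ip_lim v_lim tendsto_real_sqrt L2_diff f g) auto
    moreover have "\<forall>\<^sub>F n in sequentially. measure (law g) {y \<in> space path_space. x \<le> c * Z y} \<le> ?R n"
      using order_tendstoD(1)[OF v_lim \<phi>(2)]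
    proof eventually_elim
      case (elim n)
      have "measure (law g) {y \<in> space path_space. x \<le> c * Z y}
        \<le> measure (law g) ({y \<in> space path_space. x - e \<le> c * J n y} \<union> D n)"
      proof (rule G.finite_measure_mono)
        show "{y \<in> space path_space. x \<le> c * Z y} \<subseteq> {y \<in> space path_space. x - e \<le> c * J n y} \<union> D n"
        proof
          fix y assume y: "y \<in> {y \<in> space path_space. x \<le> c * Z y}"
          show "y \<in> {y \<in> space path_space. x - e \<le> c * J n y} \<union> D n"
          proof (cases "e \<le> \<bar>Z y - J n y\<bar>")
            case True
            then have "e\<^sup>2 \<le> (Z y - J n y)\<^sup>2" using e power_mono[of e "\<bar>Z y - J n y\<bar>" 2] by simp
            then show ?thesis using y by (simp add: D_def)
          next
            case False
            then show ?thesis using c_abs[of "Z y" "J n y"] y by simp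
          qed
        qed
        show "{y \<in> space path_space. x - e \<le> c * J n y} \<union> D n \<in> G.events" by simp
      qed
      also have "\<dots> \<le> measure (law g) {y \<in> space path_space. x - e \<le> c * J n y} + measure (law g) (D n)"
        by (intro measure_Un_le) simp_all
      also have "\<dots> \<le> ?R n"
        using law_absolutely_continuous[OF f g Dm[of n]] step_integral_tail[OF f g ps, of n c "x - e"] elim c
        by (intro add_mono) (simp_all add: J_def s_def)
      finally show ?case .
    qed
    ultimately show ?thesis by (intro tendsto_lowerbound) auto
  qed
  let ?Q = "\<lambda>e. Phi ((c * (ip (\<lambda>x. g x - f x) \<phi> / \<epsilon>) - (x - e)) / sqrt (ip \<phi> \<phi>))"
  have "(?Q \<longlongrightarrow> Phi ((c * (ip (\<lambda>x. g x - f x) \<phi> / \<epsilon>) - (x - 0)) / sqrt (ip \<phi> \<phi>))) (at_right 0)"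
    using \<phi>(2) by (intro isCont_tendsto_compose[OF isCont_Phi] tendsto_intros) auto
  then show ?thesis
    using tendsto_lowerbound[of ?Q _ "at_right 0" "measure (law g) {y \<in> space path_space. x \<le> c * Z y}"] bound
    by (simp add: eventually_at_filter)
qed

end

section \<open>Local asymptotics of the model\<close>

lemma Phi_tendsto_0: "filterlim a at_top F \<Longrightarrow> ((\<lambda>x. Phi (- a x)) \<longlongrightarrow> 0) F"
proof -
  assume a: "filterlim a at_top F"
  interpret N: real_distribution std_normal_distribution by (rule real_dist_normal_dist)
  have "filterlim (\<lambda>x. - a x) at_bot F" using a by (simp add: filterlim_uminus_at_top)
  then show ?thesis unfolding Phi_def by (rule filterlim_compose[OF N.cdf_lim_at_bot])
qed

locale local_model =
  fixes M :: "'a measure" and W :: "real \<Rightarrow> 'a \<Rightarrow> real"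
    and S :: "real \<Rightarrow> real \<Rightarrow> real" and dS :: "real \<Rightarrow> real"
    and Par :: "real set" and \<theta>0 lam :: real and u :: "real \<Rightarrow> real"
  assumes W: "wiener_process M W"
    and Par: "open Par" "\<theta>0 \<in> Par"
    and S: "\<And>\<theta>. \<theta> \<in> Par \<Longrightarrow> L2 (\<lambda>t. S t \<theta>)"
    and lam: "0 < lam"
    and A1: "cond_A1 Par S \<theta>0 dS"
    and A2: "cond_A2 lam Par S \<theta>0 dS"
    and u_pos: "\<And>\<epsilon>. \<epsilon> > 0 \<Longrightarrow> u \<epsilon> > 0"
    and u_large: "filterlim (\<lambda>\<epsilon>. u \<epsilon> / \<epsilon>) at_top (at_right 0)"
begin

abbreviation P :: "real \<Rightarrow> real \<Rightarrow> (real \<Rightarrow> real) measure" where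
  "P \<epsilon> \<theta> \<equiv> observation_law M W \<epsilon> (\<lambda>t. S t \<theta>)"

abbreviation "I \<equiv> fisher_info dS"

definition remainder :: "real \<Rightarrow> real \<Rightarrow> real" where
  "remainder \<theta> t = S t \<theta> - S t \<theta>0 - (\<theta> - \<theta>0) * dS t"

lemma white_noise: "0 < \<epsilon> \<Longrightarrow> white_noise M W \<epsilon>"
  using W by (simp add: white_noise_def)

lemma L2_dS: "L2 dS" and I_pos: "0 < I"
  using A1 by (auto simp: cond_A1_def)

lemma I_ip: "I = ip dS dS"
  by (simp add: fisher_info_def ip_self)

lemma L2_remainder: "\<theta> \<in> Par \<Longrightarrow> L2 (remainder \<theta>)"
  unfolding remainder_def[abs_def] by (intro L2_diff L2_cmult S Par L2_dS)

text \<open>With h = \<theta> - \<theta>0 and remainder R, the second half of A2 controls 2 h <dS,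
  R> + <R, R>. Together with the first half this bounds <dS, R> by a multiple of \<bar>h\<bar>^(1 +
  lam), where Cauchy-Schwarz alone would give only the exponent 1 + lam/2.\<close>

lemma local_expansion:
  obtains K r where "0 < K" "0 < r"
    "\<And>\<theta>. \<bar>\<theta> - \<theta>0\<bar> < r \<Longrightarrow> \<theta> \<in> Par \<and> ip (remainder \<theta>) (remainder \<theta>) \<le> K * \<bar>\<theta> - \<theta>0\<bar> powr (2 + lam)
      \<and> \<bar>ip dS (remainder \<theta>)\<bar> \<le> K * \<bar>\<theta> - \<theta>0\<bar> powr (1 + lam)"
proof -
  have within: "at \<theta>0 within Par = at \<theta>0" using Par by (intro at_within_open)
  obtain c1 where c1: "0 < c1" "\<forall>\<^sub>F \<theta> in at \<theta>0. norm (\<integral>t. (S t \<theta> - S t \<theta>0 - (\<theta> - \<theta>0) * dS t)\<^sup>2 \<partial>unit_leb) \<le> c1 * norm (\<bar>\<theta> - \<theta>0\<bar> powr (2 + lam))"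
    using A2 unfolding cond_A2_def within by (auto elim!: landau_o.bigE)
  obtain c2 where c2: "0 < c2" "\<forall>\<^sub>F \<theta> in at \<theta>0. norm ((\<integral>t. (S t \<theta> - S t \<theta>0)\<^sup>2 \<partial>unit_leb) - (\<theta> - \<theta>0)\<^sup>2 * I) \<le> c2 * norm (\<bar>\<theta> - \<theta>0\<bar> powr (2 + lam))"
    using A2 unfolding cond_A2_def within by (auto elim!: landau_o.bigE)
  have "\<forall>\<^sub>F \<theta> in at \<theta>0. \<theta> \<in> Par"
    using eventually_at_topological Par by blast
  from eventually_conj[OF this eventually_conj[OF c1(2) c2(2)]]
  obtain r where r: "0 < r" "\<And>\<theta>. \<theta> \<noteq> \<theta>0 \<Longrightarrow> \<bar>\<theta> - \<theta>0\<bar> < r \<Longrightarrow> \<theta> \<in> Par \<and>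
      norm (\<integral>t. (S t \<theta> - S t \<theta>0 - (\<theta> - \<theta>0) * dS t)\<^sup>2 \<partial>unit_leb) \<le> c1 * norm (\<bar>\<theta> - \<theta>0\<bar> powr (2 + lam)) \<and>
      norm ((\<integral>t. (S t \<theta> - S t \<theta>0)\<^sup>2 \<partial>unit_leb) - (\<theta> - \<theta>0)\<^sup>2 * I) \<le> c2 * norm (\<bar>\<theta> - \<theta>0\<bar> powr (2 + lam))"
    unfolding eventually_at by (auto simp: dist_real_def)
  show ?thesis
  proof (rule that[of "c1 + c2" r])
    fix \<theta> assume \<theta>: "\<bar>\<theta> - \<theta>0\<bar> < r"
    show "\<theta> \<in> Par \<and> ip (remainder \<theta>) (remainder \<theta>) \<le> (c1 + c2) * \<bar>\<theta> - \<theta>0\<bar> powr (2 + lam)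
      \<and> \<bar>ip dS (remainder \<theta>)\<bar> \<le> (c1 + c2) * \<bar>\<theta> - \<theta>0\<bar> powr (1 + lam)"
    proof (cases "\<theta> = \<theta>0")
      case True
      then have "remainder \<theta> = (\<lambda>_. 0)" by (simp add: remainder_def fun_eq_iff)
      then show ?thesis using True Par by (simp add: ip_def)
    next
      case False
      define h where "h = \<theta> - \<theta>0"
      have h: "0 < \<bar>h\<bar>" using False by (simp add: h_def)
      define R where "R = remainder \<theta>"
      have P: "\<theta> \<in> Par" using r(2)[OF False \<theta>] by simp
      have R: "L2 R" unfolding R_def by (rule L2_remainder[OF P])
      have 1: "ip R R \<le> c1 * \<bar>h\<bar> powr (2 + lam)"
        using r(2)[OF False \<theta>] by (simp add: ip_self R_def remainder_def h_def)
      have "(\<lambda>t. S t \<theta> - S t \<theta>0) = (\<lambda>t. h * dS t + R t)"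
        by (simp add: R_def remainder_def h_def fun_eq_iff)
      then have "(\<integral>t. (S t \<theta> - S t \<theta>0)\<^sup>2 \<partial>unit_leb) = ip (\<lambda>t. h * dS t + R t) (\<lambda>t. h * dS t + R t)"
        unfolding ip_self by metis
      also have "\<dots> = h\<^sup>2 * I + 2 * h * ip dS R + ip R R"
        using R L2_dS L2_cmult[OF L2_dS, of h]
        by (simp add: ip_add_right ip_add_left L2_add ip_cmult_left ip_cmult_right I_ip ip_commute[of R dS] power2_eq_square algebra_simps)
      finally have "\<bar>2 * h * ip dS R + ip R R\<bar> \<le> c2 * \<bar>h\<bar> powr (2 + lam)"
        using r(2)[OF False \<theta>] by (simp add: h_def)
      with 1 ip_self_nonneg[of R] have "\<bar>2 * h * ip dS R\<bar> \<le> (c1 + c2) * \<bar>h\<bar> powr (2 + lam)"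
        by (simp add: distrib_right)
      also have "\<bar>h\<bar> powr (2 + lam) = \<bar>h\<bar> * \<bar>h\<bar> powr (1 + lam)"
        using h powr_add[of "\<bar>h\<bar>" 1 "1 + lam"] by simp
      finally have "\<bar>h\<bar> * (2 * \<bar>ip dS R\<bar>) \<le> \<bar>h\<bar> * ((c1 + c2) * \<bar>h\<bar> powr (1 + lam))"
        by (simp add: abs_mult ac_simps)
      then have "2 * \<bar>ip dS R\<bar> \<le> (c1 + c2) * \<bar>h\<bar> powr (1 + lam)"
        using h by (simp only: mult_le_cancel_left_pos)
      then have 2: "\<bar>ip dS R\<bar> \<le> (c1 + c2) * \<bar>h\<bar> powr (1 + lam)"
        using abs_ge_zero[of "ip dS R"] by linarith
      have "0 \<le> c2 * \<bar>h\<bar> powr (2 + lam)" using c2 by simp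
      with 1 have "ip R R \<le> (c1 + c2) * \<bar>h\<bar> powr (2 + lam)" by (simp add: distrib_right)
      then show ?thesis using P 2 by (simp add: R_def h_def)
    qed
  qed (use c1 c2 r in auto)
qed

text \<open>Radii on which the signal is linear in the parameter up to an error of order \<open>o(\<epsilon>)\<close>.\<close>

definition linear_range :: "(real \<Rightarrow> real) \<Rightarrow> bool" where
  "linear_range \<rho> \<longleftrightarrow> (\<forall>\<^sub>F \<epsilon> in at_right 0. u \<epsilon> \<le> \<rho> \<epsilon>) \<and> ((\<lambda>\<epsilon>. \<rho> \<epsilon> powr (2 + lam) / \<epsilon>\<^sup>2) \<longlongrightarrow> 0) (at_right 0)"

text \<open>The chain of parameters has spacing slightly more than twice the threshold, so that
  the boundary points of neighbouring error events need no care.\<close>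

definition half_gap :: "real \<Rightarrow> real" where
  "half_gap \<epsilon> = sqrt ((u \<epsilon>)\<^sup>2 + \<epsilon> ^ 3)"

definition level :: "real \<Rightarrow> real" where
  "level \<epsilon> = sqrt I * u \<epsilon> / \<epsilon>"

lemma ev_pos: "\<forall>\<^sub>F \<epsilon> in at_right 0. (0 :: real) < \<epsilon>"
  by (rule eventually_at_right_less)

lemma half_gap_gt: "0 < \<epsilon> \<Longrightarrow> u \<epsilon> < half_gap \<epsilon>"
  unfolding half_gap_def using u_pos[of \<epsilon>] by (intro real_less_rsqrt) simp

lemma half_gap_pos: "0 < \<epsilon> \<Longrightarrow> 0 < half_gap \<epsilon>"
  using half_gap_gt[of \<epsilon>] u_pos[of \<epsilon>] by simp

lemma half_gap_le: "\<forall>\<^sub>F \<epsilon> in at_right 0. half_gap \<epsilon> \<le> 2 * u \<epsilon>"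
proof -
  have "\<forall>\<^sub>F \<epsilon> in at_right 0. 1 \<le> u \<epsilon> / \<epsilon>" using u_large by (simp add: filterlim_at_top)
  moreover have "\<forall>\<^sub>F \<epsilon> in at_right 0. \<epsilon> < (1 :: real)" by (rule eventually_at_rightI[of 0 1]) auto
  ultimately show ?thesis using ev_pos
  proof eventually_elim
    case (elim \<epsilon>)
    then have "\<epsilon> \<le> u \<epsilon>" by (simp add: pos_le_divide_eq)
    have "\<epsilon> ^ 3 \<le> \<epsilon>\<^sup>2" using elim by (intro power_decreasing) auto
    also have "\<dots> \<le> (u \<epsilon>)\<^sup>2" using \<open>\<epsilon> \<le> u \<epsilon>\<close> elim by (intro power_mono) auto
    finally have "\<epsilon> ^ 3 \<le> (u \<epsilon>)\<^sup>2" .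
    moreover have "(2 * u \<epsilon>)\<^sup>2 = 4 * (u \<epsilon>)\<^sup>2" by simp
    ultimately have "(u \<epsilon>)\<^sup>2 + \<epsilon> ^ 3 \<le> (2 * u \<epsilon>)\<^sup>2" using zero_le_power2[of "u \<epsilon>"] by linarith
    then show ?case unfolding half_gap_def using u_pos[of \<epsilon>] elim by (intro real_le_lsqrt) auto
  qed
qed

lemma level_at_top: "filterlim level at_top (at_right 0)"
proof -
  have "filterlim (\<lambda>\<epsilon>. sqrt I * (u \<epsilon> / \<epsilon>)) at_top (at_right 0)"
    by (rule filterlim_tendsto_pos_mult_at_top[OF tendsto_const _ u_large]) (simp add: I_pos)
  then show ?thesis by (simp add: level_def[abs_def])
qed

text \<open>A chain of fixed length enlarges the radius by a constant factor only, so it stays where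
  the signal is linear enough.\<close>

lemma linear_range_cmult:
  assumes "linear_range \<rho>" "1 \<le> c"
  shows "linear_range (\<lambda>\<epsilon>. c * \<rho> \<epsilon>)"
  unfolding linear_range_def
proof
  have ev: "\<forall>\<^sub>F \<epsilon> in at_right 0. u \<epsilon> \<le> \<rho> \<epsilon>" using assms by (simp add: linear_range_def)
  with ev_pos show "\<forall>\<^sub>F \<epsilon> in at_right 0. u \<epsilon> \<le> c * \<rho> \<epsilon>"
  proof eventually_elim
    case (elim \<epsilon>)
    then have "0 \<le> \<rho> \<epsilon>" using u_pos[of \<epsilon>] by simp
    then show ?case using elim assms(2) mult_right_mono[of 1 c "\<rho> \<epsilon>"] by simp
  qed
  have lim: "((\<lambda>\<epsilon>. c powr (2 + lam) * (\<rho> \<epsilon> powr (2 + lam) / \<epsilon>\<^sup>2)) \<longlongrightarrow> c powr (2 + lam) * 0) (at_right 0)"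
    using assms by (intro tendsto_mult_left) (simp add: linear_range_def)
  have E: "\<forall>\<^sub>F \<epsilon> in at_right 0. c powr (2 + lam) * (\<rho> \<epsilon> powr (2 + lam) / \<epsilon>\<^sup>2) = (c * \<rho> \<epsilon>) powr (2 + lam) / \<epsilon>\<^sup>2"
    using ev ev_pos
  proof eventually_elim
    case (elim \<epsilon>)
    then have "0 \<le> \<rho> \<epsilon>" using u_pos[of \<epsilon>] by simp
    then show ?case using assms(2) by (simp add: powr_mult)
  qed
  show "((\<lambda>\<epsilon>. (c * \<rho> \<epsilon>) powr (2 + lam) / \<epsilon>\<^sup>2) \<longlongrightarrow> 0) (at_right 0)"
    using iffD1[OF tendsto_cong[OF E] lim] by simp
qed

lemma linear_range_tendsto_0:
  assumes "linear_range \<rho>"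
  shows "(\<rho> \<longlongrightarrow> 0) (at_right 0)"
proof -
  have lim: "((\<lambda>\<epsilon>. \<rho> \<epsilon> powr (2 + lam) / \<epsilon>\<^sup>2) \<longlongrightarrow> 0) (at_right 0)"
    and ev: "\<forall>\<^sub>F \<epsilon> in at_right 0. u \<epsilon> \<le> \<rho> \<epsilon>" using assms by (auto simp: linear_range_def)
  have sq: "((\<lambda>\<epsilon>. \<epsilon>\<^sup>2 :: real) \<longlongrightarrow> 0\<^sup>2) (at_right 0)" by (intro tendsto_intros)
  have "((\<lambda>\<epsilon>. \<rho> \<epsilon> powr (2 + lam) / \<epsilon>\<^sup>2 * \<epsilon>\<^sup>2) \<longlongrightarrow> 0) (at_right 0)"
    using tendsto_mult[OF lim sq] by simp
  then have "((\<lambda>\<epsilon>. (\<rho> \<epsilon> powr (2 + lam) / \<epsilon>\<^sup>2 * \<epsilon>\<^sup>2) powr (1 / (2 + lam))) \<longlongrightarrow> 0 powr (1 / (2 + lam))) (at_right 0)"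
    using lam by (intro tendsto_powr') auto
  moreover have "\<forall>\<^sub>F \<epsilon> in at_right 0. (\<rho> \<epsilon> powr (2 + lam) / \<epsilon>\<^sup>2 * \<epsilon>\<^sup>2) powr (1 / (2 + lam)) = \<rho> \<epsilon>"
    using ev ev_pos
  proof eventually_elim
    case (elim \<epsilon>)
    then have "0 < \<rho> \<epsilon>" using u_pos[of \<epsilon>] by simp
    then show ?case using elim lam by (simp add: powr_powr)
  qed
  ultimately show ?thesis by (simp add: tendsto_cong)
qed

text \<open>The rate \<kappa> is a multiple of \<rho>^(2 + lam) / \<epsilon>^2. The cross term is
  weighted by \<rho> because it will be multiplied by parameter differences, which are at most 2
  \<rho>.\<close>

lemma linear_range_expansion:
  assumes "linear_range \<rho>"
  obtains \<kappa> where "(\<kappa> \<longlongrightarrow> 0) (at_right 0)"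
    and "\<forall>\<^sub>F \<epsilon> in at_right 0. 0 \<le> \<kappa> \<epsilon> \<and> (\<forall>\<theta>. \<bar>\<theta> - \<theta>0\<bar> < \<rho> \<epsilon> \<longrightarrow> \<theta> \<in> Par \<and>
      ip (remainder \<theta>) (remainder \<theta>) \<le> \<kappa> \<epsilon> * \<epsilon>\<^sup>2 \<and> \<rho> \<epsilon> * \<bar>ip dS (remainder \<theta>)\<bar> \<le> \<kappa> \<epsilon> * \<epsilon>\<^sup>2)"
proof -
  obtain K r where K: "0 < K" "0 < r"
    and bound: "\<And>\<theta>. \<bar>\<theta> - \<theta>0\<bar> < r \<Longrightarrow> \<theta> \<in> Par \<and> ip (remainder \<theta>) (remainder \<theta>) \<le> K * \<bar>\<theta> - \<theta>0\<bar> powr (2 + lam)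
      \<and> \<bar>ip dS (remainder \<theta>)\<bar> \<le> K * \<bar>\<theta> - \<theta>0\<bar> powr (1 + lam)"
    using local_expansion by blast
  show ?thesis
  proof (rule that[of "\<lambda>\<epsilon>. K * (\<rho> \<epsilon> powr (2 + lam) / \<epsilon>\<^sup>2)"])
    show "((\<lambda>\<epsilon>. K * (\<rho> \<epsilon> powr (2 + lam) / \<epsilon>\<^sup>2)) \<longlongrightarrow> 0) (at_right 0)"
      using tendsto_mult_left[of "\<lambda>\<epsilon>. \<rho> \<epsilon> powr (2 + lam) / \<epsilon>\<^sup>2" 0 "at_right 0" K] assms
      by (simp add: linear_range_def)
    have small: "\<forall>\<^sub>F \<epsilon> in at_right 0. \<rho> \<epsilon> < r"
      using order_tendstoD(2)[OF linear_range_tendsto_0[OF assms] K(2)] .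
    have ev: "\<forall>\<^sub>F \<epsilon> in at_right 0. u \<epsilon> \<le> \<rho> \<epsilon>" using assms by (simp add: linear_range_def)
    from small ev ev_pos
    show "\<forall>\<^sub>F \<epsilon> in at_right 0. 0 \<le> K * (\<rho> \<epsilon> powr (2 + lam) / \<epsilon>\<^sup>2) \<and> (\<forall>\<theta>. \<bar>\<theta> - \<theta>0\<bar> < \<rho> \<epsilon> \<longrightarrow> \<theta> \<in> Par \<and>
      ip (remainder \<theta>) (remainder \<theta>) \<le> K * (\<rho> \<epsilon> powr (2 + lam) / \<epsilon>\<^sup>2) * \<epsilon>\<^sup>2 \<and>
      \<rho> \<epsilon> * \<bar>ip dS (remainder \<theta>)\<bar> \<le> K * (\<rho> \<epsilon> powr (2 + lam) / \<epsilon>\<^sup>2) * \<epsilon>\<^sup>2)"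
    proof eventually_elim
      case (elim \<epsilon>)
      then have \<rho>: "0 < \<rho> \<epsilon>" using u_pos[of \<epsilon>] by simp
      have eq: "K * (\<rho> \<epsilon> powr (2 + lam) / \<epsilon>\<^sup>2) * \<epsilon>\<^sup>2 = K * \<rho> \<epsilon> powr (2 + lam)" using elim by simp
      have eq2: "\<rho> \<epsilon> powr (2 + lam) = \<rho> \<epsilon> * \<rho> \<epsilon> powr (1 + lam)"
        using \<rho> powr_add[of "\<rho> \<epsilon>" 1 "1 + lam"] by simp
      show ?case unfolding eq
      proof (intro conjI allI impI)
        show "0 \<le> K * (\<rho> \<epsilon> powr (2 + lam) / \<epsilon>\<^sup>2)" using K by simp
        fix \<theta> assume \<theta>: "\<bar>\<theta> - \<theta>0\<bar> < \<rho> \<epsilon>"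
        then have b: "\<theta> \<in> Par" "ip (remainder \<theta>) (remainder \<theta>) \<le> K * \<bar>\<theta> - \<theta>0\<bar> powr (2 + lam)"
          "\<bar>ip dS (remainder \<theta>)\<bar> \<le> K * \<bar>\<theta> - \<theta>0\<bar> powr (1 + lam)" using bound[of \<theta>] elim by auto
        show "\<theta> \<in> Par" by fact
        have "K * \<bar>\<theta> - \<theta>0\<bar> powr (2 + lam) \<le> K * \<rho> \<epsilon> powr (2 + lam)"
          using \<theta> K lam by (intro mult_left_mono powr_mono2) auto
        with b show "ip (remainder \<theta>) (remainder \<theta>) \<le> K * \<rho> \<epsilon> powr (2 + lam)" by linarith
        have "K * \<bar>\<theta> - \<theta>0\<bar> powr (1 + lam) \<le> K * \<rho> \<epsilon> powr (1 + lam)"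
          using \<theta> K lam by (intro mult_left_mono powr_mono2) auto
        with b have "\<bar>ip dS (remainder \<theta>)\<bar> \<le> K * \<rho> \<epsilon> powr (1 + lam)" by linarith
        then have "\<rho> \<epsilon> * \<bar>ip dS (remainder \<theta>)\<bar> \<le> \<rho> \<epsilon> * (K * \<rho> \<epsilon> powr (1 + lam))"
          using \<rho> by (intro mult_left_mono) auto
        then show "\<rho> \<epsilon> * \<bar>ip dS (remainder \<theta>)\<bar> \<le> K * \<rho> \<epsilon> powr (2 + lam)"
          unfolding eq2 by (simp add: ac_simps)
      qed
    qed
  qed
qed

text \<open>The constant is 8 + 4. With d = \<theta>2 - \<theta>1, \<bar>d\<bar> \<le> 2 \<rho>, and
  R the difference of two remainders, the cross term 2 d <dS, R> is at most 8 k and the square of R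
  at most 4 k.\<close>

lemma separation_expansion:
  assumes P: "\<theta>1 \<in> Par" "\<theta>2 \<in> Par"
    and \<rho>: "\<bar>\<theta>1 - \<theta>0\<bar> < \<rho>" "\<bar>\<theta>2 - \<theta>0\<bar> < \<rho>"
    and R1: "ip (remainder \<theta>1) (remainder \<theta>1) \<le> k" "\<rho> * \<bar>ip dS (remainder \<theta>1)\<bar> \<le> k"
    and R2: "ip (remainder \<theta>2) (remainder \<theta>2) \<le> k" "\<rho> * \<bar>ip dS (remainder \<theta>2)\<bar> \<le> k"
  shows "\<bar>ip (\<lambda>t. S t \<theta>2 - S t \<theta>1) (\<lambda>t. S t \<theta>2 - S t \<theta>1) - (\<theta>2 - \<theta>1)\<^sup>2 * I\<bar> \<le> 12 * k"
proof -
  define d where "d = \<theta>2 - \<theta>1"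
  define R where "R t = remainder \<theta>2 t - remainder \<theta>1 t" for t
  note L2R = L2_remainder[OF P(1)] L2_remainder[OF P(2)]
  have R: "L2 R" unfolding R_def[abs_def] by (intro L2_diff L2R)
  have "(\<lambda>t. S t \<theta>2 - S t \<theta>1) = (\<lambda>t. d * dS t + R t)"
    by (simp add: R_def remainder_def d_def fun_eq_iff algebra_simps)
  then have eq: "ip (\<lambda>t. S t \<theta>2 - S t \<theta>1) (\<lambda>t. S t \<theta>2 - S t \<theta>1) = d\<^sup>2 * I + 2 * d * ip dS R + ip R R"
    using R L2_dS L2_cmult[OF L2_dS, of d]
    by (simp add: ip_add_right ip_add_left L2_add ip_cmult_left ip_cmult_right I_ip ip_commute[of R dS] power2_eq_square algebra_simps)
  have "ip dS R = ip dS (remainder \<theta>2) - ip dS (remainder \<theta>1)"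
    unfolding R_def[abs_def] by (rule ip_diff_right[OF L2_dS L2R(2,1)])
  then have "\<bar>ip dS R\<bar> \<le> \<bar>ip dS (remainder \<theta>2)\<bar> + \<bar>ip dS (remainder \<theta>1)\<bar>" by simp
  then have "\<rho> * \<bar>ip dS R\<bar> \<le> \<rho> * (\<bar>ip dS (remainder \<theta>2)\<bar> + \<bar>ip dS (remainder \<theta>1)\<bar>)"
    using \<rho> by (intro mult_left_mono) auto
  also have "\<dots> \<le> 2 * k" using R1 R2 by (simp add: distrib_left)
  finally have \<rho>R: "\<rho> * \<bar>ip dS R\<bar> \<le> 2 * k" .
  have "\<bar>d\<bar> \<le> 2 * \<rho>" using \<rho> by (simp add: d_def)
  then have "\<bar>d\<bar> * \<bar>ip dS R\<bar> \<le> 2 * \<rho> * \<bar>ip dS R\<bar>" by (intro mult_right_mono) auto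
  with \<rho>R have 1: "\<bar>2 * d * ip dS R\<bar> \<le> 8 * k" by (simp add: abs_mult)
  have "ip R R = ip (remainder \<theta>2) (remainder \<theta>2) - 2 * ip (remainder \<theta>2) (remainder \<theta>1) + ip (remainder \<theta>1) (remainder \<theta>1)"
    unfolding R_def[abs_def] using L2R
    by (simp add: ip_diff_right ip_diff_left L2_diff ip_commute[of "remainder \<theta>1" "remainder \<theta>2"])
  moreover have "- 2 * ip (remainder \<theta>2) (remainder \<theta>1) \<le> 2 * k"
  proof -
    have "(ip (remainder \<theta>2) (remainder \<theta>1))\<^sup>2 \<le> k * k"
      using ip_Cauchy_Schwarz[OF L2R(2,1)] mult_mono[OF R2(1) R1(1)] ip_self_nonneg[of "remainder \<theta>1"] ip_self_nonneg[of "remainder \<theta>2"] R1 R2 by linarith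
    moreover have "0 \<le> k" using R1(1) ip_self_nonneg[of "remainder \<theta>1"] by linarith
    ultimately have "\<bar>ip (remainder \<theta>2) (remainder \<theta>1)\<bar> \<le> k"
      by (simp add: power2_eq_square[symmetric] abs_le_square_iff[symmetric])
    then show ?thesis by linarith
  qed
  ultimately have 2: "ip R R \<le> 4 * k" using R1 R2 by linarith
  show ?thesis unfolding eq d_def[symmetric] using 1 2 ip_self_nonneg[of R] by linarith
qed

text \<open>In units of 4 \<epsilon>^2 the squared distance of neighbouring signals differs from
  level^2 by I \<epsilon>, which stems from the cube in \<open>half_gap\<close>, and by at most 3
  \<kappa>. Both vanish, so the slightly larger spacing is invisible at the relative precision
  needed.\<close>

lemma separation_asymptotics:
  assumes \<rho>: "linear_range \<rho>" and \<eta>: "0 < \<eta>"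
  shows "\<forall>\<^sub>F \<epsilon> in at_right 0. \<forall>\<theta>1 \<theta>2. \<bar>\<theta>1 - \<theta>0\<bar> < \<rho> \<epsilon> \<longrightarrow> \<bar>\<theta>2 - \<theta>0\<bar> < \<rho> \<epsilon> \<longrightarrow> \<bar>\<theta>2 - \<theta>1\<bar> = 2 * half_gap \<epsilon> \<longrightarrow>
    \<theta>1 \<in> Par \<and> \<theta>2 \<in> Par \<and>
    (1 - \<eta>) * Phi (- level \<epsilon>) \<le> Phi (- (sqrt (ip (\<lambda>t. S t \<theta>2 - S t \<theta>1) (\<lambda>t. S t \<theta>2 - S t \<theta>1)) / (2 * \<epsilon>))) \<and>
    Phi (- (sqrt (ip (\<lambda>t. S t \<theta>2 - S t \<theta>1) (\<lambda>t. S t \<theta>2 - S t \<theta>1)) / (2 * \<epsilon>))) \<le> (1 + \<eta>) * Phi (- level \<epsilon>)"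
proof -
  obtain \<kappa> where \<kappa>: "(\<kappa> \<longlongrightarrow> 0) (at_right 0)"
    and ev: "\<forall>\<^sub>F \<epsilon> in at_right 0. 0 \<le> \<kappa> \<epsilon> \<and> (\<forall>\<theta>. \<bar>\<theta> - \<theta>0\<bar> < \<rho> \<epsilon> \<longrightarrow> \<theta> \<in> Par \<and>
      ip (remainder \<theta>) (remainder \<theta>) \<le> \<kappa> \<epsilon> * \<epsilon>\<^sup>2 \<and> \<rho> \<epsilon> * \<bar>ip dS (remainder \<theta>)\<bar> \<le> \<kappa> \<epsilon> * \<epsilon>\<^sup>2)"
    using linear_range_expansion[OF \<rho>] by blast
  \<comment> \<open>The envelopes s = 1 and s = -1 enclose the separation of every admissible pair,
    which makes the estimate uniform in the pair. The term 3 \<kappa> is 12 \<kappa> \<epsilon>^2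
    divided by 4 \<epsilon>^2.\<close>
  define b where "b s \<epsilon> = sqrt ((level \<epsilon>)\<^sup>2 + I * \<epsilon> + s * 3 * \<kappa> \<epsilon>)" for s \<epsilon>
  have lim0: "((\<lambda>\<epsilon>. I * \<epsilon> + s * 3 * \<kappa> \<epsilon>) \<longlongrightarrow> 0) (at_right 0)" for s
    using tendsto_add[OF tendsto_mult_left[OF tendsto_ident_at[of 0 "{0<..}"], of I] tendsto_mult_left[OF \<kappa>, of "s * 3"]] by simp
  have nonneg: "\<forall>\<^sub>F \<epsilon> in at_right 0. 0 \<le> (level \<epsilon>)\<^sup>2 + I * \<epsilon> + s * 3 * \<kappa> \<epsilon>" for s
  proof -
    have "\<forall>\<^sub>F \<epsilon> in at_right 0. 1 \<le> level \<epsilon>" using level_at_top by (simp add: filterlim_at_top)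
    moreover have "\<forall>\<^sub>F \<epsilon> in at_right 0. -1 < I * \<epsilon> + s * 3 * \<kappa> \<epsilon>"
      using order_tendstoD(1)[OF lim0] by simp
    ultimately show ?thesis
    proof eventually_elim
      case (elim \<epsilon>)
      then have "1 \<le> (level \<epsilon>)\<^sup>2" by (simp add: one_le_power)
      then show ?case using elim by linarith
    qed
  qed
  have ratio: "((\<lambda>\<epsilon>. Phi (- b s \<epsilon>) / Phi (- level \<epsilon>)) \<longlongrightarrow> 1) (at_right 0)" for s
  proof (rule Phi_ratio_tendsto_sq[OF level_at_top])
    show "\<forall>\<^sub>F \<epsilon> in at_right 0. 0 \<le> b s \<epsilon>"
      using nonneg[of s] by eventually_elim (simp add: b_def)
    have "\<forall>\<^sub>F \<epsilon> in at_right 0. I * \<epsilon> + s * 3 * \<kappa> \<epsilon> = (b s \<epsilon>)\<^sup>2 - (level \<epsilon>)\<^sup>2"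
      using nonneg[of s] by eventually_elim (simp add: b_def)
    with lim0[of s] show "((\<lambda>\<epsilon>. (b s \<epsilon>)\<^sup>2 - (level \<epsilon>)\<^sup>2) \<longlongrightarrow> 0) (at_right 0)"
      by (simp add: tendsto_cong)
  qed
  have up: "\<forall>\<^sub>F \<epsilon> in at_right 0. Phi (- b (-1) \<epsilon>) / Phi (- level \<epsilon>) < 1 + \<eta>"
    using order_tendstoD(2)[OF ratio] \<eta> by simp
  have low: "\<forall>\<^sub>F \<epsilon> in at_right 0. 1 - \<eta> < Phi (- b 1 \<epsilon>) / Phi (- level \<epsilon>)"
    using order_tendstoD(1)[OF ratio] \<eta> by simp
  show ?thesis
    using ev up low ev_pos
  proof eventually_elim
    case (elim \<epsilon>)
    show ?case
    proof (intro allI impI)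
      fix \<theta>1 \<theta>2 assume \<theta>: "\<bar>\<theta>1 - \<theta>0\<bar> < \<rho> \<epsilon>" "\<bar>\<theta>2 - \<theta>0\<bar> < \<rho> \<epsilon>" and d: "\<bar>\<theta>2 - \<theta>1\<bar> = 2 * half_gap \<epsilon>"
      define q where "q = ip (\<lambda>t. S t \<theta>2 - S t \<theta>1) (\<lambda>t. S t \<theta>2 - S t \<theta>1)"
      have Par12: "\<theta>1 \<in> Par" "\<theta>2 \<in> Par" using elim \<theta> by auto
      have q: "\<bar>q - (\<theta>2 - \<theta>1)\<^sup>2 * I\<bar> \<le> 12 * (\<kappa> \<epsilon> * \<epsilon>\<^sup>2)"
        unfolding q_def using elim \<theta> by (intro separation_expansion[where \<rho>="\<rho> \<epsilon>"]) auto
      have "(\<theta>2 - \<theta>1)\<^sup>2 = (2 * half_gap \<epsilon>)\<^sup>2" using d by (metis power2_abs)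
      also have "\<dots> = 4 * ((u \<epsilon>)\<^sup>2 + \<epsilon> ^ 3)"
        using elim by (simp add: half_gap_def power_mult_distrib)
      also have "\<dots> * I = 4 * \<epsilon>\<^sup>2 * ((level \<epsilon>)\<^sup>2 + I * \<epsilon>)"
        using elim I_pos by (simp add: level_def power_mult_distrib power_divide power2_eq_square power3_eq_cube field_simps)
      finally have "\<bar>q - 4 * \<epsilon>\<^sup>2 * ((level \<epsilon>)\<^sup>2 + I * \<epsilon>)\<bar> \<le> 12 * (\<kappa> \<epsilon> * \<epsilon>\<^sup>2)" using q by simp
      then have "q \<le> 4 * \<epsilon>\<^sup>2 * ((level \<epsilon>)\<^sup>2 + I * \<epsilon> + 1 * 3 * \<kappa> \<epsilon>)" "4 * \<epsilon>\<^sup>2 * ((level \<epsilon>)\<^sup>2 + I * \<epsilon> + (-1) * 3 * \<kappa> \<epsilon>) \<le> q"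
        unfolding distrib_left by (simp_all add: algebra_simps)
      then have "q / (4 * \<epsilon>\<^sup>2) \<le> (level \<epsilon>)\<^sup>2 + I * \<epsilon> + 1 * 3 * \<kappa> \<epsilon>" "(level \<epsilon>)\<^sup>2 + I * \<epsilon> + (-1) * 3 * \<kappa> \<epsilon> \<le> q / (4 * \<epsilon>\<^sup>2)"
        using elim by (simp_all add: pos_divide_le_eq pos_le_divide_eq mult.commute)
      then have "sqrt (q / (4 * \<epsilon>\<^sup>2)) \<le> b 1 \<epsilon>" "b (-1) \<epsilon> \<le> sqrt (q / (4 * \<epsilon>\<^sup>2))"
        unfolding b_def by (auto intro: real_sqrt_le_mono)
      moreover have "sqrt (q / (4 * \<epsilon>\<^sup>2)) = sqrt q / (2 * \<epsilon>)"
        using elim by (simp add: real_sqrt_divide real_sqrt_mult)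
      ultimately have "Phi (- b 1 \<epsilon>) \<le> Phi (- (sqrt q / (2 * \<epsilon>)))" "Phi (- (sqrt q / (2 * \<epsilon>))) \<le> Phi (- b (-1) \<epsilon>)"
        by (auto intro!: Phi_mono)
      moreover have "Phi (- b (-1) \<epsilon>) \<le> (1 + \<eta>) * Phi (- level \<epsilon>)" "(1 - \<eta>) * Phi (- level \<epsilon>) \<le> Phi (- b 1 \<epsilon>)"
        using elim Phi_pos[of "- level \<epsilon>"] by (simp_all add: pos_divide_less_eq pos_less_divide_eq)
      ultimately show "\<theta>1 \<in> Par \<and> \<theta>2 \<in> Par \<and>
        (1 - \<eta>) * Phi (- level \<epsilon>) \<le> Phi (- (sqrt (ip (\<lambda>t. S t \<theta>2 - S t \<theta>1) (\<lambda>t. S t \<theta>2 - S t \<theta>1)) / (2 * \<epsilon>))) \<and>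
        Phi (- (sqrt (ip (\<lambda>t. S t \<theta>2 - S t \<theta>1) (\<lambda>t. S t \<theta>2 - S t \<theta>1)) / (2 * \<epsilon>))) \<le> (1 + \<eta>) * Phi (- level \<epsilon>)"
        using Par12 unfolding q_def by auto
    qed
  qed
qed

end

section \<open>The test based on the efficient statistic and the stability of tests between
  neighbours\<close>

context local_model
begin

text \<open>The sign \<open>\<tau>\<close> selects the side of \<open>\<theta>\<close>.\<close>

definition efficient_region :: "((real \<Rightarrow> real) \<Rightarrow> real) \<Rightarrow> real \<Rightarrow> real \<Rightarrow> real \<Rightarrow> (real \<Rightarrow> real) set" where
  "efficient_region z \<tau> \<epsilon> \<theta> = {y \<in> space path_space. u \<epsilon> < \<tau> * (\<epsilon> / I * z y - (\<theta> - \<theta>0))}"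

text \<open>Under \<theta> the integral z has mean ((\<theta> - \<theta>0) I + <dS, remainder>) /
  \<epsilon>. Nonlinearity of the signal thus enters through the cross term alone and lowers the
  level by at most \<zeta> / (\<epsilon> sqrt I).\<close>

lemma efficient_region_error:
  assumes \<epsilon>: "0 < \<epsilon>" and z: "has_wiener_integral (P \<epsilon> \<theta>0) (noise \<epsilon> (\<lambda>t. S t \<theta>0)) dS z"
    and \<tau>: "\<bar>\<tau>\<bar> = 1" and \<theta>: "\<theta> \<in> Par" "\<theta> + 2 * \<tau> * half_gap \<epsilon> \<in> Par"
    and r: "\<bar>ip dS (remainder \<theta>)\<bar> \<le> \<zeta>" "\<bar>ip dS (remainder (\<theta> + 2 * \<tau> * half_gap \<epsilon>))\<bar> \<le> \<zeta>"
  shows "efficient_region z \<tau> \<epsilon> \<theta> \<in> sets path_space"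
    and "measure (P \<epsilon> \<theta>) (efficient_region z \<tau> \<epsilon> \<theta>) \<le> Phi (- (level \<epsilon> - \<zeta> / (\<epsilon> * sqrt I)))"
    and "measure (P \<epsilon> (\<theta> + 2 * \<tau> * half_gap \<epsilon>)) (space path_space - efficient_region z \<tau> \<epsilon> \<theta>) \<le> Phi (- (level \<epsilon> - \<zeta> / (\<epsilon> * sqrt I)))"
proof -
  interpret white_noise M W \<epsilon> by (rule white_noise[OF \<epsilon>])
  have \<tau>2: "\<tau> * \<tau> = 1" using \<tau> by (metis abs_mult_self_eq mult_1)
  have \<tau>\<tau>: "\<tau> * (\<tau> * x) = x" for x using \<tau>2 by (simp add: mult.assoc[symmetric])
  have zm[measurable]: "z \<in> borel_measurable path_space" using z by (simp add: has_wiener_integral_def)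
  show B: "efficient_region z \<tau> \<epsilon> \<theta> \<in> sets path_space"
    unfolding efficient_region_def by measurable
  note S0 = S[OF Par(2)]
  have mean: "ip (\<lambda>t. S t \<theta>' - S t \<theta>0) dS = (\<theta>' - \<theta>0) * I + ip dS (remainder \<theta>')" if "\<theta>' \<in> Par" for \<theta>'
  proof -
    have "(\<lambda>t. S t \<theta>' - S t \<theta>0) = (\<lambda>t. (\<theta>' - \<theta>0) * dS t + remainder \<theta>' t)"
      by (simp add: remainder_def fun_eq_iff)
    then show ?thesis
      using ip_add_right[OF L2_dS L2_cmult[OF L2_dS, of "\<theta>' - \<theta>0"] L2_remainder[OF that]]
      by (simp add: ip_commute[of "\<lambda>t. _ t + _ t" dS] ip_cmult_right I_ip)
  qed
  have sI: "0 < sqrt I" using I_pos by simp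
  have tail: "measure (P \<epsilon> \<theta>') {y \<in> space path_space. x \<le> c * z y}
      \<le> Phi (- (level \<epsilon> - \<zeta> / (\<epsilon> * sqrt I)))"
    if "\<theta>' \<in> Par" "\<bar>c\<bar> = 1" "\<bar>ip dS (remainder \<theta>')\<bar> \<le> \<zeta>" "c * ((\<theta>' - \<theta>0) * I) - x * \<epsilon> \<le> - I * u \<epsilon>" for \<theta>' c x
  proof -
    have "c * ip dS (remainder \<theta>') \<le> \<bar>c * ip dS (remainder \<theta>')\<bar>" by simp
    then have "c * ip dS (remainder \<theta>') \<le> \<zeta>" using that by (simp add: abs_mult)
    with that(4) have "c * ip (\<lambda>t. S t \<theta>' - S t \<theta>0) dS - x * \<epsilon> \<le> - I * u \<epsilon> + \<zeta>"
      unfolding mean[OF that(1)] by (simp add: distrib_left)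
    then have "(c * ip (\<lambda>t. S t \<theta>' - S t \<theta>0) dS - x * \<epsilon>) / (\<epsilon> * sqrt I) \<le> (- I * u \<epsilon> + \<zeta>) / (\<epsilon> * sqrt I)"
      using \<epsilon> sI by (intro divide_right_mono) auto
    also have "\<dots> = - (level \<epsilon> - \<zeta> / (\<epsilon> * sqrt I))"
      using \<epsilon> sI I_pos by (simp add: level_def add_divide_distrib) (simp add: field_simps)
    also have "(c * ip (\<lambda>t. S t \<theta>' - S t \<theta>0) dS - x * \<epsilon>) / (\<epsilon> * sqrt I)
        = (c * (ip (\<lambda>t. S t \<theta>' - S t \<theta>0) dS / \<epsilon>) - x) / sqrt I"
      using \<epsilon> sI by (simp add: field_simps)
    finally have "Phi ((c * (ip (\<lambda>t. S t \<theta>' - S t \<theta>0) dS / \<epsilon>) - x) / sqrt I) \<le> Phi (- (level \<epsilon> - \<zeta> / (\<epsilon> * sqrt I)))"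
      by (rule Phi_mono)
    moreover have "measure (P \<epsilon> \<theta>') {y \<in> space path_space. x \<le> c * z y}
        \<le> Phi ((c * (ip (\<lambda>t. S t \<theta>' - S t \<theta>0) dS / \<epsilon>) - x) / sqrt I)"
      unfolding I_ip using that(2) L2_dS I_pos
      by (intro wiener_integral_tail[OF S0 S[OF that(1)] _ _ _ z]) (auto simp: I_ip[symmetric])
    ultimately show ?thesis by linarith
  qed
  have conv: "\<tau> * (\<epsilon> / I * w - (\<theta> - \<theta>0)) = \<epsilon> / I * (\<tau> * w - I * (\<tau> * (\<theta> - \<theta>0)) / \<epsilon>)" for w
    using \<epsilon> I_pos by (simp add: field_simps)
  define x where "x = I * (u \<epsilon> + \<tau> * (\<theta> - \<theta>0)) / \<epsilon>"
  have x\<epsilon>: "x * \<epsilon> = I * (u \<epsilon> + \<tau> * (\<theta> - \<theta>0))" using \<epsilon> by (simp add: x_def)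
  have lt: "u \<epsilon> < \<tau> * (\<epsilon> / I * w - (\<theta> - \<theta>0)) \<longleftrightarrow> x < \<tau> * w" for w
  proof -
    have "u \<epsilon> < \<epsilon> / I * v \<longleftrightarrow> I * u \<epsilon> / \<epsilon> < v" for v
      using \<epsilon> I_pos by (simp add: field_simps)
    moreover have "x = I * u \<epsilon> / \<epsilon> + I * (\<tau> * (\<theta> - \<theta>0)) / \<epsilon>"
      by (simp add: x_def distrib_left add_divide_distrib)
    ultimately show ?thesis unfolding conv by (simp add: less_diff_eq)
  qed
  interpret F: prob_space "P \<epsilon> \<theta>" by (rule prob_space_law[OF S[OF \<theta>(1)]])
  interpret G: prob_space "P \<epsilon> (\<theta> + 2 * \<tau> * half_gap \<epsilon>)" by (rule prob_space_law[OF S[OF \<theta>(2)]])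
  have "measure (P \<epsilon> \<theta>) (efficient_region z \<tau> \<epsilon> \<theta>) \<le> measure (P \<epsilon> \<theta>) {y \<in> space path_space. x \<le> \<tau> * z y}"
    unfolding efficient_region_def lt by (intro F.finite_measure_mono) auto
  also have "\<dots> \<le> Phi (- (level \<epsilon> - \<zeta> / (\<epsilon> * sqrt I)))"
    using x\<epsilon> by (intro tail \<theta> \<tau> r) (simp add: algebra_simps)
  finally show "measure (P \<epsilon> \<theta>) (efficient_region z \<tau> \<epsilon> \<theta>) \<le> Phi (- (level \<epsilon> - \<zeta> / (\<epsilon> * sqrt I)))" .
  have "measure (P \<epsilon> (\<theta> + 2 * \<tau> * half_gap \<epsilon>)) (space path_space - efficient_region z \<tau> \<epsilon> \<theta>)
      \<le> measure (P \<epsilon> (\<theta> + 2 * \<tau> * half_gap \<epsilon>)) {y \<in> space path_space. - x \<le> - \<tau> * z y}"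
    unfolding efficient_region_def lt by (intro G.finite_measure_mono) auto
  also have "\<dots> \<le> Phi (- (level \<epsilon> - \<zeta> / (\<epsilon> * sqrt I)))"
  proof (intro tail \<theta> r)
    \<comment> \<open>The threshold lies at distance u from \<theta> and 2 \<open>half_gap\<close> -
      u from the neighbour. The latter is the larger, so one bound serves both errors.\<close>
    have "- \<tau> * ((\<theta> + 2 * \<tau> * half_gap \<epsilon> - \<theta>0) * I) - - x * \<epsilon> = I * u \<epsilon> - 2 * I * half_gap \<epsilon>"
      using x\<epsilon> \<tau>\<tau> by (simp add: algebra_simps)
    also have "\<dots> \<le> - I * u \<epsilon>"
      using mult_left_mono[OF less_imp_le[OF half_gap_gt[OF \<epsilon>]], of I] I_pos by (simp add: algebra_simps)
    finally show "- \<tau> * ((\<theta> + 2 * \<tau> * half_gap \<epsilon> - \<theta>0) * I) - - x * \<epsilon> \<le> - I * u \<epsilon>" .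
  qed (use \<tau> in simp)
  finally show "measure (P \<epsilon> (\<theta> + 2 * \<tau> * half_gap \<epsilon>)) (space path_space - efficient_region z \<tau> \<epsilon> \<theta>) \<le> Phi (- (level \<epsilon> - \<zeta> / (\<epsilon> * sqrt I)))" .
qed

lemma efficient_region_asymptotics:
  assumes \<rho>: "linear_range \<rho>" and \<eta>: "0 < \<eta>"
    and z: "\<forall>\<epsilon>>0. has_wiener_integral (P \<epsilon> \<theta>0) (noise \<epsilon> (\<lambda>t. S t \<theta>0)) dS (z \<epsilon>)"
  shows "\<forall>\<^sub>F \<epsilon> in at_right 0. \<forall>\<theta> \<tau>. \<bar>\<tau>\<bar> = 1 \<longrightarrow> \<bar>\<theta> - \<theta>0\<bar> < \<rho> \<epsilon> \<longrightarrow> \<bar>\<theta> + 2 * \<tau> * half_gap \<epsilon> - \<theta>0\<bar> < \<rho> \<epsilon> \<longrightarrow>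
    efficient_region (z \<epsilon>) \<tau> \<epsilon> \<theta> \<in> sets path_space \<and>
    measure (P \<epsilon> \<theta>) (efficient_region (z \<epsilon>) \<tau> \<epsilon> \<theta>) \<le> (1 + \<eta>) * Phi (- level \<epsilon>) \<and>
    measure (P \<epsilon> (\<theta> + 2 * \<tau> * half_gap \<epsilon>)) (space path_space - efficient_region (z \<epsilon>) \<tau> \<epsilon> \<theta>) \<le> (1 + \<eta>) * Phi (- level \<epsilon>)"
proof -
  obtain \<kappa> where \<kappa>: "(\<kappa> \<longlongrightarrow> 0) (at_right 0)"
    and ev: "\<forall>\<^sub>F \<epsilon> in at_right 0. 0 \<le> \<kappa> \<epsilon> \<and> (\<forall>\<theta>. \<bar>\<theta> - \<theta>0\<bar> < \<rho> \<epsilon> \<longrightarrow> \<theta> \<in> Par \<and>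
      ip (remainder \<theta>) (remainder \<theta>) \<le> \<kappa> \<epsilon> * \<epsilon>\<^sup>2 \<and> \<rho> \<epsilon> * \<bar>ip dS (remainder \<theta>)\<bar> \<le> \<kappa> \<epsilon> * \<epsilon>\<^sup>2)"
    using linear_range_expansion[OF \<rho>] by blast
  have u\<rho>: "\<forall>\<^sub>F \<epsilon> in at_right 0. u \<epsilon> \<le> \<rho> \<epsilon>" using \<rho> by (simp add: linear_range_def)
  \<comment> \<open>Since u \<le> \<rho>, the weighted cross term bound may be divided by u. The
    product of the level with the shift \<zeta> / (\<epsilon> sqrt I) is then exactly \<kappa>, so
    \<open>Phi_ratio_tendsto\<close> applies.\<close>
  define \<zeta> where "\<zeta> \<epsilon> = \<kappa> \<epsilon> * \<epsilon>\<^sup>2 / u \<epsilon>" for \<epsilon>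
  have "\<forall>\<^sub>F \<epsilon> in at_right 0. - \<kappa> \<epsilon> = level \<epsilon> * ((level \<epsilon> - \<zeta> \<epsilon> / (\<epsilon> * sqrt I)) - level \<epsilon>)"
    using ev_pos
  proof eventually_elim
    case (elim \<epsilon>)
    then show ?case using u_pos[of \<epsilon>] I_pos by (simp add: level_def \<zeta>_def field_simps power2_eq_square)
  qed
  moreover have "((\<lambda>\<epsilon>. - \<kappa> \<epsilon>) \<longlongrightarrow> 0) (at_right 0)" using tendsto_minus[OF \<kappa>] by simp
  ultimately have "((\<lambda>\<epsilon>. level \<epsilon> * ((level \<epsilon> - \<zeta> \<epsilon> / (\<epsilon> * sqrt I)) - level \<epsilon>)) \<longlongrightarrow> 0) (at_right 0)"
    using tendsto_cong by fast
  from order_tendstoD(2)[OF Phi_ratio_tendsto[OF level_at_top this], of "1 + \<eta>"] \<eta>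
  have "\<forall>\<^sub>F \<epsilon> in at_right 0. Phi (- (level \<epsilon> - \<zeta> \<epsilon> / (\<epsilon> * sqrt I))) / Phi (- level \<epsilon>) < 1 + \<eta>" by simp
  then show ?thesis using ev u\<rho> ev_pos
  proof eventually_elim
    case (elim \<epsilon>)
    have le: "Phi (- (level \<epsilon> - \<zeta> \<epsilon> / (\<epsilon> * sqrt I))) \<le> (1 + \<eta>) * Phi (- level \<epsilon>)"
      using elim Phi_pos[of "- level \<epsilon>"] by (simp add: pos_divide_less_eq)
    have r: "\<bar>ip dS (remainder \<theta>)\<bar> \<le> \<zeta> \<epsilon>" "\<theta> \<in> Par" if "\<bar>\<theta> - \<theta>0\<bar> < \<rho> \<epsilon>" for \<theta>
    proof -
      have "u \<epsilon> * \<bar>ip dS (remainder \<theta>)\<bar> \<le> \<rho> \<epsilon> * \<bar>ip dS (remainder \<theta>)\<bar>"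
        using elim by (intro mult_right_mono) auto
      also have "\<dots> \<le> \<kappa> \<epsilon> * \<epsilon>\<^sup>2" using elim that by auto
      finally show "\<bar>ip dS (remainder \<theta>)\<bar> \<le> \<zeta> \<epsilon>"
        using elim u_pos[of \<epsilon>] by (simp add: \<zeta>_def pos_le_divide_eq mult.commute)
      show "\<theta> \<in> Par" using elim that by auto
    qed
    show ?case
    proof (intro allI impI)
      fix \<theta> \<tau> :: real assume A: "\<bar>\<tau>\<bar> = 1" "\<bar>\<theta> - \<theta>0\<bar> < \<rho> \<epsilon>" "\<bar>\<theta> + 2 * \<tau> * half_gap \<epsilon> - \<theta>0\<bar> < \<rho> \<epsilon>"
      note E = efficient_region_error[OF \<open>0 < \<epsilon>\<close> z[rule_format, OF \<open>0 < \<epsilon>\<close>] A(1) r(2)[OF A(2)] r(2)[OF A(3)] r(1)[OF A(2)] r(1)[OF A(3)]]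
      show "efficient_region (z \<epsilon>) \<tau> \<epsilon> \<theta> \<in> sets path_space \<and>
        measure (P \<epsilon> \<theta>) (efficient_region (z \<epsilon>) \<tau> \<epsilon> \<theta>) \<le> (1 + \<eta>) * Phi (- level \<epsilon>) \<and>
        measure (P \<epsilon> (\<theta> + 2 * \<tau> * half_gap \<epsilon>)) (space path_space - efficient_region (z \<epsilon>) \<tau> \<epsilon> \<theta>) \<le> (1 + \<eta>) * Phi (- level \<epsilon>)"
        using E(1) order_trans[OF E(2) le] order_trans[OF E(3) le] by (intro conjI)
    qed
  qed
qed

lemma neighbour_test_lower:
  assumes \<rho>: "linear_range \<rho>" and \<eta>: "0 < \<eta>"
  shows "\<forall>\<^sub>F \<epsilon> in at_right 0. \<forall>\<theta>1 \<theta>2. \<bar>\<theta>1 - \<theta>0\<bar> < \<rho> \<epsilon> \<longrightarrow> \<bar>\<theta>2 - \<theta>0\<bar> < \<rho> \<epsilon> \<longrightarrow> \<bar>\<theta>2 - \<theta>1\<bar> = 2 * half_gap \<epsilon> \<longrightarrow>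
    (\<forall>A\<in>sets path_space. 2 * (1 - \<eta>) * Phi (- level \<epsilon>) \<le> measure (P \<epsilon> \<theta>1) A + measure (P \<epsilon> \<theta>2) (space path_space - A))"
  using separation_asymptotics[OF \<rho> \<eta>] ev_pos
proof eventually_elim
  case (elim \<epsilon>)
  interpret white_noise M W \<epsilon> by (rule white_noise[OF \<open>0 < \<epsilon>\<close>])
  show ?case
  proof (intro allI impI ballI)
    fix \<theta>1 \<theta>2 A assume \<theta>: "\<bar>\<theta>1 - \<theta>0\<bar> < \<rho> \<epsilon>" "\<bar>\<theta>2 - \<theta>0\<bar> < \<rho> \<epsilon>" "\<bar>\<theta>2 - \<theta>1\<bar> = 2 * half_gap \<epsilon>"
      and A: "A \<in> sets path_space"
    then have "\<theta>1 \<in> Par" "\<theta>2 \<in> Par"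
      and "(1 - \<eta>) * Phi (- level \<epsilon>) \<le> Phi (- separation (\<lambda>t. S t \<theta>1) (\<lambda>t. S t \<theta>2))"
      using elim by blast+
    then show "2 * (1 - \<eta>) * Phi (- level \<epsilon>) \<le> measure (P \<epsilon> \<theta>1) A + measure (P \<epsilon> \<theta>2) (space path_space - A)"
      using test_lower[OF S S A, of \<theta>1 \<theta>2] by linarith
  qed
qed

text \<open>The radius is quantified inside, so the admissible slack s depends on the accuracy w
  alone. This order matters: the length of the chain is chosen from s, and the radius from the
  length.\<close>

definition stable_within :: "real \<Rightarrow> real \<Rightarrow> bool" where
  "stable_within s w \<longleftrightarrow> (\<forall>\<rho> z. linear_range \<rho> \<longrightarrow>
    (\<forall>\<epsilon>>0. has_wiener_integral (P \<epsilon> \<theta>0) (noise \<epsilon> (\<lambda>t. S t \<theta>0)) dS (z \<epsilon>)) \<longrightarrow>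
    (\<forall>\<^sub>F \<epsilon> in at_right 0. \<forall>\<theta> \<tau>. \<bar>\<tau>\<bar> = 1 \<longrightarrow> \<bar>\<theta> - \<theta>0\<bar> < \<rho> \<epsilon> \<longrightarrow> \<bar>\<theta> + 2 * \<tau> * half_gap \<epsilon> - \<theta>0\<bar> < \<rho> \<epsilon> \<longrightarrow>
      efficient_region (z \<epsilon>) \<tau> \<epsilon> \<theta> \<in> sets path_space \<and>
      (\<forall>A\<in>sets path_space. measure (P \<epsilon> \<theta>) A + measure (P \<epsilon> (\<theta> + 2 * \<tau> * half_gap \<epsilon>)) (space path_space - A) \<le> (2 + s) * Phi (- level \<epsilon>) \<longrightarrow>
       measure (P \<epsilon> \<theta>) (sym_diff A (efficient_region (z \<epsilon>) \<tau> \<epsilon> \<theta>)) \<le> w * Phi (- level \<epsilon>) \<and>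
       \<bar>measure (P \<epsilon> \<theta>) A - Phi (- level \<epsilon>)\<bar> \<le> w * Phi (- level \<epsilon>))))"

text \<open>The efficient region is itself a nearly optimal test between the two neighbours, so a
  second nearly optimal test must be close to it. The region has error about
  \<open>Phi (- level \<epsilon>)\<close> on each side, hence so does the other test: optimality of
  the sum fixes how it is divided.\<close>

lemma neighbour_test_stability:
  assumes w: "0 < w"
  shows "\<exists>s>0. s \<le> w \<and> stable_within s w"
proof -
  \<comment> \<open>The three terms 4 exp 2 d, 8 r/d and r of \<open>test_stability\<close> become
    at most w/16 each, hence w/4 together, and w/2 after q \<le> 2 p. The margin \<eta> = r/8 pays
    for exchanging p and q: (2 + 2 \<eta>) (1 + 2 \<eta>) \<le> 2 + 8 \<eta>.\<close>
  define d where "d = min 1 (w / (64 * exp 2))"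
  define r where "r = min (1 / 2) (min (w * d / 128) (w / 16))"
  define \<eta> where "\<eta> = r / 8"
  have d: "0 < d" "d \<le> 1" using w by (auto simp: d_def)
  have r: "0 < r" "r \<le> 1 / 2" "r \<le> w / 16"
    unfolding r_def using w d by (simp, simp, meson min.cobounded2 order_trans)
  have "4 * exp 2 * d \<le> 4 * exp 2 * (w / (64 * exp 2))" by (intro mult_left_mono) (auto simp: d_def)
  then have k1: "4 * exp 2 * d \<le> w / 16" by simp
  have "r \<le> w * d / 128" unfolding r_def by (meson min.cobounded1 min.cobounded2 order_trans)
  then have k2: "8 * r / d \<le> w / 16" using d by (simp add: pos_divide_le_eq)
  have \<eta>: "0 < \<eta>" "\<eta> \<le> 1 / 16" "8 * \<eta> = r" using r by (auto simp: \<eta>_def)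
  show ?thesis
    unfolding stable_within_def
  proof (intro exI conjI allI impI)
    show "0 < \<eta>" "\<eta> \<le> w" using \<eta> r w by auto
    fix \<rho> z assume \<rho>: "linear_range \<rho>"
      and z: "\<forall>\<epsilon>>0. has_wiener_integral (P \<epsilon> \<theta>0) (noise \<epsilon> (\<lambda>t. S t \<theta>0)) dS (z \<epsilon>)"
    have far: "\<forall>\<^sub>F \<epsilon> in at_right 0. Phi (- level \<epsilon>) < Phi (- 1) / 3"
      using order_tendstoD(2)[OF Phi_tendsto_0[OF level_at_top], of "Phi (- 1) / 3"] Phi_pos[of "- 1"] by simp
    show "\<forall>\<^sub>F \<epsilon> in at_right 0. \<forall>\<theta> \<tau>. \<bar>\<tau>\<bar> = 1 \<longrightarrow> \<bar>\<theta> - \<theta>0\<bar> < \<rho> \<epsilon> \<longrightarrow> \<bar>\<theta> + 2 * \<tau> * half_gap \<epsilon> - \<theta>0\<bar> < \<rho> \<epsilon> \<longrightarrow>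
      efficient_region (z \<epsilon>) \<tau> \<epsilon> \<theta> \<in> sets path_space \<and>
      (\<forall>A\<in>sets path_space. measure (P \<epsilon> \<theta>) A + measure (P \<epsilon> (\<theta> + 2 * \<tau> * half_gap \<epsilon>)) (space path_space - A) \<le> (2 + \<eta>) * Phi (- level \<epsilon>) \<longrightarrow>
       measure (P \<epsilon> \<theta>) (sym_diff A (efficient_region (z \<epsilon>) \<tau> \<epsilon> \<theta>)) \<le> w * Phi (- level \<epsilon>) \<and>
       \<bar>measure (P \<epsilon> \<theta>) A - Phi (- level \<epsilon>)\<bar> \<le> w * Phi (- level \<epsilon>))"
      using separation_asymptotics[OF \<rho> \<eta>(1)] efficient_region_asymptotics[OF \<rho> \<eta>(1) z] far ev_pos
    proof eventually_elim
      case (elim \<epsilon>)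
      interpret white_noise M W \<epsilon> by (rule white_noise[OF \<open>0 < \<epsilon>\<close>])
      define p where "p = Phi (- level \<epsilon>)"
      have p: "0 < p" by (simp add: p_def Phi_pos)
      show ?case unfolding p_def[symmetric]
      proof (intro allI impI)
        fix \<theta> \<tau> :: real
        define \<theta>' where "\<theta>' = \<theta> + 2 * \<tau> * half_gap \<epsilon>"
        define B where "B = efficient_region (z \<epsilon>) \<tau> \<epsilon> \<theta>"
        assume \<tau>: "\<bar>\<tau>\<bar> = 1" and \<theta>: "\<bar>\<theta> - \<theta>0\<bar> < \<rho> \<epsilon>" and "\<bar>\<theta> + 2 * \<tau> * half_gap \<epsilon> - \<theta>0\<bar> < \<rho> \<epsilon>"
        then have \<theta>'_range: "\<bar>\<theta>' - \<theta>0\<bar> < \<rho> \<epsilon>" by (simp add: \<theta>'_def)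
        have B: "B \<in> sets path_space" "measure (P \<epsilon> \<theta>) B \<le> (1 + \<eta>) * p" "measure (P \<epsilon> \<theta>') (space path_space - B) \<le> (1 + \<eta>) * p"
          using elim(2) \<tau> \<theta> \<theta>'_range unfolding B_def \<theta>'_def p_def by blast+
        have "\<bar>\<theta>' - \<theta>\<bar> = 2 * half_gap \<epsilon>"
          using \<tau> half_gap_pos[OF \<open>0 < \<epsilon>\<close>] by (simp add: \<theta>'_def abs_mult)
        define q where "q = Phi (- separation (\<lambda>t. S t \<theta>) (\<lambda>t. S t \<theta>'))"
        have Par12: "\<theta> \<in> Par" "\<theta>' \<in> Par" and q: "(1 - \<eta>) * p \<le> q" "q \<le> (1 + \<eta>) * p"
          using elim(1) \<theta> \<theta>'_range \<open>\<bar>\<theta>' - \<theta>\<bar> = 2 * half_gap \<epsilon>\<close> unfolding q_def p_def by blast+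
        have q_pos: "0 < q" by (simp add: q_def Phi_pos)
        note SS = S[OF Par12(1)] S[OF Par12(2)]
        interpret F: prob_space "P \<epsilon> \<theta>" by (rule prob_space_law[OF SS(1)])
        have low: "2 * q \<le> measure (P \<epsilon> \<theta>) B + measure (P \<epsilon> \<theta>') (space path_space - B)"
          unfolding q_def by (rule test_lower[OF SS B(1)])
        have pq: "p \<le> (1 + 2 * \<eta>) * q"
        proof -
          have "\<eta> * (1 - 2 * \<eta>) \<ge> 0" using \<eta> by (intro mult_nonneg_nonneg) auto
          then have "1 \<le> (1 + 2 * \<eta>) * (1 - \<eta>)" by (simp add: algebra_simps)
          then have "p \<le> (1 + 2 * \<eta>) * (1 - \<eta>) * p" using p mult_right_mono[of 1 "(1 + 2 * \<eta>) * (1 - \<eta>)" p] by simp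
          also have "\<dots> = (1 + 2 * \<eta>) * ((1 - \<eta>) * p)" by simp
          also have "\<dots> \<le> (1 + 2 * \<eta>) * q" using q \<eta> by (intro mult_left_mono) auto
          finally show ?thesis .
        qed
        have scale: "c * p \<le> (2 + r) * q" if c: "0 \<le> c" "c \<le> 2 + 2 * \<eta>" for c
        proof -
          have "c * p \<le> (2 + 2 * \<eta>) * ((1 + 2 * \<eta>) * q)"
            using c p pq \<eta> q_pos by (intro mult_mono) auto
          also have "\<dots> = ((2 + 2 * \<eta>) * (1 + 2 * \<eta>)) * q" by simp
          also have "\<dots> \<le> (2 + r) * q"
          proof (rule mult_right_mono)
            have "\<eta> * \<eta> \<le> \<eta> * (1 / 16)" using \<eta> by (intro mult_left_mono) auto
            moreover have "(2 + 2 * \<eta>) * (1 + 2 * \<eta>) = 2 + 6 * \<eta> + 4 * (\<eta> * \<eta>)" by (simp add: algebra_simps)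
            ultimately show "(2 + 2 * \<eta>) * (1 + 2 * \<eta>) \<le> 2 + r" using \<eta> by linarith
          qed (use q_pos in simp)
          finally show ?thesis .
        qed
        have far': "3 * q < 2 * Phi (- 1)"
        proof -
          have "3 * q \<le> 3 * ((1 + \<eta>) * p)" using q by simp
          also have "\<dots> \<le> 3 * ((2 :: real) * p)" using \<eta> p by (intro mult_left_mono mult_right_mono) auto
          also have "\<dots> < 2 * Phi (- 1)" using elim(3) by (simp add: p_def)
          finally show ?thesis .
        qed
        have B_sum: "measure (P \<epsilon> \<theta>) B + measure (P \<epsilon> \<theta>') (space path_space - B) \<le> (2 + r) * q"
        proof -
          have "measure (P \<epsilon> \<theta>) B + measure (P \<epsilon> \<theta>') (space path_space - B) \<le> (2 + 2 * \<eta>) * p"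
            using B by (simp add: algebra_simps)
          also have "\<dots> \<le> (2 + r) * q" using \<eta> by (intro scale) auto
          finally show ?thesis .
        qed
        have stab: "measure (P \<epsilon> \<theta>) (sym_diff A B) \<le> w * p \<and> \<bar>measure (P \<epsilon> \<theta>) A - p\<bar> \<le> w * p"
          if A: "A \<in> sets path_space" and sum: "measure (P \<epsilon> \<theta>) A + measure (P \<epsilon> \<theta>') (space path_space - A) \<le> (2 + \<eta>) * p" for A
        proof -
          have A_sum: "measure (P \<epsilon> \<theta>) A + measure (P \<epsilon> \<theta>') (space path_space - A) \<le> (2 + r) * q"
            using sum scale[of "2 + \<eta>"] \<eta> by linarith
          have "measure (P \<epsilon> \<theta>) (sym_diff A B) \<le> (4 * exp 2 * d + 8 * r / d + r) * q"
            using test_stability[OF SS A B(1) _ r(1,2) d] far' A_sum B_sum by (simp add: q_def)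
          also have "\<dots> \<le> (w / 4) * q" using k1 k2 r q_pos by (intro mult_right_mono) auto
          also have "\<dots> \<le> (w / 4) * (2 * p)"
          proof (rule mult_left_mono)
            have "(1 + \<eta>) * p \<le> 2 * p" using \<eta> p by (intro mult_right_mono) auto
            then show "q \<le> 2 * p" using q by linarith
          qed (use w in simp)
          finally have D: "measure (P \<epsilon> \<theta>) (sym_diff A B) \<le> w / 2 * p" by (simp add: mult.commute)
          have "measure (P \<epsilon> \<theta>) A \<le> measure (P \<epsilon> \<theta>) (B \<union> sym_diff A B)"
            using A B by (intro F.finite_measure_mono) auto
          also have "\<dots> \<le> measure (P \<epsilon> \<theta>) B + measure (P \<epsilon> \<theta>) (sym_diff A B)"
            using A B by (intro measure_Un_le) auto
          finally have up: "measure (P \<epsilon> \<theta>) A \<le> (1 + \<eta>) * p + w / 2 * p" using B D by linarith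
          have "measure (P \<epsilon> \<theta>) B \<le> measure (P \<epsilon> \<theta>) (A \<union> sym_diff A B)"
            using A B by (intro F.finite_measure_mono) auto
          also have "\<dots> \<le> measure (P \<epsilon> \<theta>) A + measure (P \<epsilon> \<theta>) (sym_diff A B)"
            using A B by (intro measure_Un_le) auto
          \<comment> \<open>A lower bound for one error of the region comes from
            \<open>test_lower\<close>: the sum is at least 2 (1 - \<eta>) p and the other error at
            most (1 + \<eta>) p.\<close>
          finally have "2 * ((1 - \<eta>) * p) - (1 + \<eta>) * p \<le> measure (P \<epsilon> \<theta>) A + w / 2 * p"
            using B D low q by linarith
          then have down: "p - 3 * \<eta> * p - w / 2 * p \<le> measure (P \<epsilon> \<theta>) A"
            by (simp add: algebra_simps)
          have "3 * \<eta> * p \<le> w / 2 * p" using \<eta> r p by (intro mult_right_mono) auto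
          moreover have "0 \<le> \<eta> * p" using \<eta> p by simp
          ultimately have "\<bar>measure (P \<epsilon> \<theta>) A - p\<bar> \<le> w * p" using up down by (simp add: algebra_simps abs_le_iff)
          moreover have "measure (P \<epsilon> \<theta>) (sym_diff A B) \<le> w * p"
          proof -
            have "0 < w * p" using w p by simp
            then show ?thesis using D by linarith
          qed
          ultimately show ?thesis by simp
        qed
        then show "efficient_region (z \<epsilon>) \<tau> \<epsilon> \<theta> \<in> sets path_space \<and>
         (\<forall>A\<in>sets path_space. measure (P \<epsilon> \<theta>) A + measure (P \<epsilon> (\<theta> + 2 * \<tau> * half_gap \<epsilon>)) (space path_space - A) \<le> (2 + \<eta>) * p \<longrightarrow>
           measure (P \<epsilon> \<theta>) (sym_diff A (efficient_region (z \<epsilon>) \<tau> \<epsilon> \<theta>)) \<le> w * p \<and>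
           \<bar>measure (P \<epsilon> \<theta>) A - p\<bar> \<le> w * p)"
          using B(1) unfolding B_def \<theta>'_def by blast
      qed
    qed
  qed
qed

end

section \<open>Chains of parameters\<close>

text \<open>\<open>y\<close> is almost increasing along the chain, and bounded, so the slack of some link to the
  left and of some link to the right of the centre is small. There \<open>y\<close> is close to \<open>1\<close>, hence it is nearly
  constant in between, which forces small slack at the centre.\<close>

lemma chain_slack:
  fixes x y :: "nat \<Rightarrow> real"
  assumes N: "0 < N" and \<eta>: "0 \<le> \<eta>"
    and nonneg: "\<And>k. k \<le> 2 * N \<Longrightarrow> 0 \<le> x k" "\<And>k. k \<le> 2 * N \<Longrightarrow> 0 \<le> y k"
    and up: "\<And>k. k \<le> 2 * N \<Longrightarrow> x k + y k \<le> 2 + \<eta>"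
    and low: "\<And>k. k < 2 * N \<Longrightarrow> 2 - \<eta> \<le> x k + y (Suc k)"
    and stab: "\<And>k. k < 2 * N \<Longrightarrow> x k + y (Suc k) \<le> 2 + s \<Longrightarrow> \<bar>y (Suc k) - 1\<bar> \<le> w"
    and budget: "2 + \<eta> \<le> real N * (s - \<eta>)"
    and i: "i = N \<or> Suc i = N"
  shows "x i + y (Suc i) \<le> 2 + max s (2 * w + (4 * real N + 1) * \<eta>)"
proof -
  \<comment> \<open>Subtracting x k + y k \<le> 2 + \<eta> from 2 - \<eta> \<le> x k + y (k + 1)
    shows that y falls by at most 2 \<eta> per link.\<close>
  have drop: "y j \<le> y (j + d) + 2 * \<eta> * real d" if "j + d \<le> 2 * N" for j d
    using that
  proof (induction d)
    case (Suc d)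
    then have "y (j + d) \<le> y (Suc (j + d)) + 2 * \<eta>"
      using up[of "j + d"] low[of "j + d"] by simp
    with Suc show ?case by (simp add: algebra_simps)
  qed simp
  \<comment> \<open>If all N links had slack above s, each would raise y by more than s - \<eta>,
    and y would exceed its bound 2 + \<eta>.\<close>
  have pigeonhole: "\<exists>k\<in>{m..<m + N}. x k + y (Suc k) \<le> 2 + s" if m: "m \<le> N" for m
  proof (rule ccontr)
    assume "\<not> ?thesis"
    then have gt: "s - \<eta> < y (Suc k) - y k" if "k \<in> {m..<m + N}" for k
      using that up[of k] m by force
    have "real N * (s - \<eta>) = (\<Sum>k\<in>{m..<m + N}. s - \<eta>)" by simp
    also have "\<dots> < (\<Sum>k\<in>{m..<m + N}. y (Suc k) - y k)"
      using N gt by (intro sum_strict_mono) auto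
    also have "\<dots> = y (m + N) - y m" by (rule sum_Suc_diff') simp
    also have "\<dots> \<le> 2 + \<eta>" using up[of "m + N"] nonneg(1)[of "m + N"] nonneg(2)[of m] m by simp
    finally show False using budget by simp
  qed
  obtain j where j: "j < N" "x j + y (Suc j) \<le> 2 + s" using pigeonhole[of 0] by auto
  obtain k where k: "N \<le> k" "k < 2 * N" "x k + y (Suc k) \<le> 2 + s" using pigeonhole[of N] by auto
  have yj: "\<bar>y (Suc j) - 1\<bar> \<le> w" and yk: "\<bar>y (Suc k) - 1\<bar> \<le> w" using stab j k by auto
  show ?thesis
  proof (cases "i = j")
    case True
    then show ?thesis using j by simp
  next
    case False
    then have ij: "Suc j \<le> i" "i \<le> k" using i j k by auto
    have "x i + y i \<le> 2 + \<eta>" using up[of i] ij k by simp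
    moreover have "y (Suc j) - 2 * \<eta> * real (i - Suc j) \<le> y i"
      using drop[of "Suc j" "i - Suc j"] ij k by simp
    moreover have "y (Suc i) \<le> y (Suc k) + 2 * \<eta> * real (k - i)"
      using drop[of "Suc i" "k - i"] ij k by simp
    moreover have "2 * \<eta> * real (k - i) + 2 * \<eta> * real (i - Suc j) \<le> 4 * real N * \<eta>"
    proof -
      have "real (k - i) + real (i - Suc j) \<le> 2 * real N" using ij k by linarith
      from mult_left_mono[OF this, of "2 * \<eta>"] \<eta> show ?thesis by (simp add: algebra_simps)
    qed
    ultimately have "x i + y (Suc i) \<le> 2 + (2 * w + (4 * real N + 1) * \<eta>)"
      using yj yk by (simp add: algebra_simps)
    then show ?thesis by simp
  qed
qed

section \<open>One-sided errors of an estimator along a chain\<close>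

context local_model
begin

text \<open>The weak inequality here and the strict one in \<open>left_error\<close> assign the
  midpoint to one side only: the right event at \<theta> and the left event at \<theta> + 2
  \<open>half_gap\<close> are exact complements, that is, one test. Both are genuine errors, because
  \<open>half_gap\<close> exceeds u.\<close>

definition right_error :: "((real \<Rightarrow> real) \<Rightarrow> real) \<Rightarrow> real \<Rightarrow> real \<Rightarrow> real" where
  "right_error e \<epsilon> \<theta> = measure (P \<epsilon> \<theta>) {y \<in> space path_space. \<theta> + half_gap \<epsilon> \<le> e y}"

definition left_error :: "((real \<Rightarrow> real) \<Rightarrow> real) \<Rightarrow> real \<Rightarrow> real \<Rightarrow> real" where
  "left_error e \<epsilon> \<theta> = measure (P \<epsilon> \<theta>) {y \<in> space path_space. e y < \<theta> - half_gap \<epsilon>}"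

definition total_error :: "((real \<Rightarrow> real) \<Rightarrow> real) \<Rightarrow> real \<Rightarrow> real \<Rightarrow> real" where
  "total_error e \<epsilon> \<theta> = measure (P \<epsilon> \<theta>) {y \<in> space path_space. \<bar>e y - \<theta>\<bar> > u \<epsilon>}"

lemma error_split:
  assumes "0 < \<epsilon>" "\<theta> \<in> Par" and e: "e \<in> borel_measurable path_space"
  shows "right_error e \<epsilon> \<theta> + left_error e \<epsilon> \<theta> \<le> total_error e \<epsilon> \<theta>"
proof -
  interpret white_noise M W \<epsilon> by (rule white_noise[OF \<open>0 < \<epsilon>\<close>])
  interpret F: prob_space "P \<epsilon> \<theta>" by (rule prob_space_law[OF S[OF assms(2)]])
  note e[measurable]
  have "right_error e \<epsilon> \<theta> + left_error e \<epsilon> \<theta>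
      = measure (P \<epsilon> \<theta>) ({y \<in> space path_space. \<theta> + half_gap \<epsilon> \<le> e y} \<union> {y \<in> space path_space. e y < \<theta> - half_gap \<epsilon>})"
    unfolding right_error_def left_error_def using half_gap_pos[OF assms(1)]
    by (intro F.finite_measure_Union[symmetric]) auto
  also have "\<dots> \<le> total_error e \<epsilon> \<theta>"
    unfolding total_error_def using half_gap_gt[OF assms(1)]
    by (intro F.finite_measure_mono) auto
  finally show ?thesis .
qed

lemma link_lower:
  assumes \<rho>: "linear_range \<rho>" and \<eta>: "0 < \<eta>" and e: "\<forall>\<epsilon>>0. e \<epsilon> \<in> borel_measurable path_space"
  shows "\<forall>\<^sub>F \<epsilon> in at_right 0. \<forall>\<theta>. \<bar>\<theta> - \<theta>0\<bar> < \<rho> \<epsilon> \<longrightarrow> \<bar>\<theta> + 2 * half_gap \<epsilon> - \<theta>0\<bar> < \<rho> \<epsilon> \<longrightarrow>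
    2 * (1 - \<eta>) * Phi (- level \<epsilon>) \<le> right_error (e \<epsilon>) \<epsilon> \<theta> + left_error (e \<epsilon>) \<epsilon> (\<theta> + 2 * half_gap \<epsilon>)"
  using neighbour_test_lower[OF \<rho> \<eta>] ev_pos
proof eventually_elim
  case (elim \<epsilon>)
  show ?case
  proof (intro allI impI)
    fix \<theta> assume \<theta>: "\<bar>\<theta> - \<theta>0\<bar> < \<rho> \<epsilon>" "\<bar>\<theta> + 2 * half_gap \<epsilon> - \<theta>0\<bar> < \<rho> \<epsilon>"
    define A where "A = {y \<in> space path_space. \<theta> + half_gap \<epsilon> \<le> e \<epsilon> y}"
    note e[rule_format, OF elim(2), measurable]
    have A: "A \<in> sets path_space" unfolding A_def by measurable
    have gap: "\<bar>\<theta> + 2 * half_gap \<epsilon> - \<theta>\<bar> = 2 * half_gap \<epsilon>" using half_gap_pos[OF elim(2)] by simp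
    have "space path_space - A = {y \<in> space path_space. e \<epsilon> y < (\<theta> + 2 * half_gap \<epsilon>) - half_gap \<epsilon>}"
      by (auto simp: A_def)
    with elim(1) \<theta> gap A
    show "2 * (1 - \<eta>) * Phi (- level \<epsilon>) \<le> right_error (e \<epsilon>) \<epsilon> \<theta> + left_error (e \<epsilon>) \<epsilon> (\<theta> + 2 * half_gap \<epsilon>)"
      unfolding right_error_def left_error_def A_def[symmetric] by fastforce
  qed
qed

lemma sup_ratio_upper:
  assumes "sup_ratio Par (P \<epsilon>) e I \<epsilon> \<theta>0 (u \<epsilon>) r < ereal (1 + \<eta>)" "\<theta> \<in> Par" "\<bar>\<theta> - \<theta>0\<bar> < r" "0 < \<epsilon>"
  shows "total_error e \<epsilon> \<theta> \<le> 2 * (1 + \<eta>) * Phi (- level \<epsilon>)"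
proof -
  interpret white_noise M W \<epsilon> by (rule white_noise[OF \<open>0 < \<epsilon>\<close>])
  have "ereal (total_error e \<epsilon> \<theta> / (2 * Phi (- level \<epsilon>))) \<le> sup_ratio Par (P \<epsilon>) e I \<epsilon> \<theta>0 (u \<epsilon>) r"
    unfolding sup_ratio_def total_error_def level_def using assms(2,3)
    by (intro SUP_upper2[of \<theta>]) auto
  with assms(1) have "ereal (total_error e \<epsilon> \<theta> / (2 * Phi (- level \<epsilon>))) < ereal (1 + \<eta>)"
    by (rule le_less_trans[rotated])
  then have "total_error e \<epsilon> \<theta> < (1 + \<eta>) * (2 * Phi (- level \<epsilon>))"
    using Phi_pos[of "- level \<epsilon>"] by (simp add: pos_divide_less_eq)
  then show ?thesis by (simp only: mult.commute[of 2] mult.assoc less_imp_le)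
qed

lemma sup_ratio_lower:
  assumes "total_error e \<epsilon> \<theta> > 2 * c * Phi (- level \<epsilon>)" "\<theta> \<in> Par" "\<bar>\<theta> - \<theta>0\<bar> < r" "0 < \<epsilon>"
  shows "ereal c < sup_ratio Par (P \<epsilon>) e I \<epsilon> \<theta>0 (u \<epsilon>) r"
proof -
  interpret white_noise M W \<epsilon> by (rule white_noise[OF \<open>0 < \<epsilon>\<close>])
  have "ereal c < ereal (total_error e \<epsilon> \<theta> / (2 * Phi (- level \<epsilon>)))"
    using assms(1) Phi_pos[of "- level \<epsilon>"] by (simp add: pos_less_divide_eq mult.left_commute)
  also have "\<dots> \<le> sup_ratio Par (P \<epsilon>) e I \<epsilon> \<theta>0 (u \<epsilon>) r"
    unfolding sup_ratio_def total_error_def level_def using assms(2,3)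
    by (intro SUP_upper2[of \<theta>]) auto
  finally show ?thesis .
qed

lemma linear_range_in_Par:
  assumes "linear_range \<rho>"
  shows "\<forall>\<^sub>F \<epsilon> in at_right 0. \<forall>\<theta>. \<bar>\<theta> - \<theta>0\<bar> < \<rho> \<epsilon> \<longrightarrow> \<theta> \<in> Par"
proof -
  obtain r where r: "0 < r" "\<And>\<theta>. \<bar>\<theta> - \<theta>0\<bar> < r \<Longrightarrow> \<theta> \<in> Par" using local_expansion by metis
  have "\<forall>\<^sub>F \<epsilon> in at_right 0. \<rho> \<epsilon> < r"
    using order_tendstoD(2)[OF linear_range_tendsto_0[OF assms] r(1)] .
  then show ?thesis by eventually_elim (use r(2) in auto)
qed

lemma Liminf_sup_ratio:
  assumes small: "linear_range u" and e: "\<forall>\<epsilon>>0. e \<epsilon> \<in> borel_measurable path_space"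
    and C: "filterlim C at_top (at_right 0)"
  shows "1 \<le> Liminf (at_right 0) (\<lambda>\<epsilon>. sup_ratio Par (P \<epsilon>) (e \<epsilon>) I \<epsilon> \<theta>0 (u \<epsilon>) (C \<epsilon> * u \<epsilon>))"
  unfolding le_Liminf_iff
proof (intro allI impI)
  fix l :: ereal assume "l < 1"
  then obtain c where c: "l < ereal c" "c < 1"
    using ereal_dense2[of l 1] by (auto simp: one_ereal_def)
  \<comment> \<open>The chain must give N (1 - \<eta>) > (N + 1) c. With \<eta> = 1/(N + 1) the
    losses are N \<eta> \<le> 1 and c < 1, so N (1 - c) > 2 is enough.\<close>
  obtain N :: nat where "max 1 (2 / (1 - c)) < real N"
    using reals_Archimedean2 by blast
  then have N: "0 < N" "2 / (1 - c) < real N" by auto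
  define \<eta> where "\<eta> = 1 / (real N + 1)"
  have \<eta>: "0 < \<eta>" by (simp add: \<eta>_def)
  have cN: "(real N + 1) * c < real N * (1 - \<eta>)"
  proof -
    have "2 < real N * (1 - c)" using N c by (simp add: pos_divide_less_eq)
    moreover have "real N * \<eta> \<le> 1" by (simp add: \<eta>_def)
    ultimately show ?thesis using c by (simp add: algebra_simps)
  qed
  \<comment> \<open>N links of length 2 \<open>half_gap\<close> \<le> 4 u reach 4 N u; one more u
    makes the inclusion strict. This is a fixed multiple of u, which C u eventually exceeds.\<close>
  define \<rho> where "\<rho> \<epsilon> = (4 * real N + 1) * u \<epsilon>" for \<epsilon>
  have \<rho>: "linear_range \<rho>" unfolding \<rho>_def[abs_def] using linear_range_cmult[OF small] by simp
  have "\<forall>\<^sub>F \<epsilon> in at_right 0. 4 * real N + 1 \<le> C \<epsilon>" using C by (simp add: filterlim_at_top)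
  with link_lower[OF \<rho> \<eta> e] linear_range_in_Par[OF \<rho>] half_gap_le ev_pos
  show "\<forall>\<^sub>F \<epsilon> in at_right 0. l < sup_ratio Par (P \<epsilon>) (e \<epsilon>) I \<epsilon> \<theta>0 (u \<epsilon>) (C \<epsilon> * u \<epsilon>)"
  proof eventually_elim
    case (elim \<epsilon>)
    define p where "p = Phi (- level \<epsilon>)"
    have p: "0 < p" by (simp add: p_def Phi_pos)
    define t where "t k = \<theta>0 + 2 * half_gap \<epsilon> * real k" for k
    have range: "\<bar>t k - \<theta>0\<bar> < \<rho> \<epsilon>" if "k \<le> N" for k
    proof -
      have "2 * half_gap \<epsilon> * real k \<le> 2 * (2 * u \<epsilon>) * real N"
        using elim half_gap_pos[of \<epsilon>] that by (intro mult_mono) auto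
      then show ?thesis using half_gap_pos[of \<epsilon>] u_pos[of \<epsilon>] elim by (simp add: t_def \<rho>_def algebra_simps)
    qed
    have tSuc: "t (Suc k) = t k + 2 * half_gap \<epsilon>" for k by (simp add: t_def algebra_simps)
    have "\<exists>k\<le>N. 2 * c * p < total_error (e \<epsilon>) \<epsilon> (t k)"
    proof (rule ccontr)
      assume "\<not> ?thesis"
      then have le: "total_error (e \<epsilon>) \<epsilon> (t k) \<le> 2 * c * p" if "k \<le> N" for k using that by force
      let ?x = "\<lambda>k. right_error (e \<epsilon>) \<epsilon> (t k)" and ?y = "\<lambda>k. left_error (e \<epsilon>) \<epsilon> (t k)"
      have "real N * (2 * (1 - \<eta>) * p) = (\<Sum>k<N. 2 * (1 - \<eta>) * p)" by simp
      also have "\<dots> \<le> (\<Sum>k<N. ?x k + ?y (Suc k))"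
      proof (rule sum_mono)
        fix k assume "k \<in> {..<N}"
        then show "2 * (1 - \<eta>) * p \<le> ?x k + ?y (Suc k)"
          using elim(1)[rule_format, of "t k"] range[of k] range[of "Suc k"] by (simp add: tSuc p_def)
      qed
      \<comment> \<open>The right error of the last point and the left error of the first belong to
        no link; adding them regroups the sum by points and costs one point more than there are
        links.\<close>
      also have "\<dots> \<le> (\<Sum>k\<le>N. ?x k) + (\<Sum>k\<le>N. ?y k)"
      proof -
        have "(\<Sum>k\<le>N. ?x k) = (\<Sum>k<N. ?x k) + ?x N" by (simp add: lessThan_Suc_atMost[symmetric])
        moreover have "(\<Sum>k\<le>N. ?y k) = ?y 0 + (\<Sum>k<N. ?y (Suc k))"
          by (simp add: lessThan_Suc_atMost[symmetric] sum.lessThan_Suc_shift del: sum.lessThan_Suc)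
        moreover have "0 \<le> ?x N" "0 \<le> ?y 0" by (simp_all add: right_error_def left_error_def)
        ultimately show ?thesis by (simp add: sum.distrib)
      qed
      also have "\<dots> = (\<Sum>k\<le>N. ?x k + ?y k)" by (simp add: sum.distrib)
      also have "\<dots> \<le> (\<Sum>k\<le>N. 2 * c * p)"
      proof (rule sum_mono)
        fix k assume "k \<in> {..N}"
        then have "k \<le> N" by simp
        then show "?x k + ?y k \<le> 2 * c * p"
          using error_split[OF elim(4), of "t k" "e \<epsilon>"] e[rule_format, OF elim(4)] elim(2) range[of k] le[of k] by force
      qed
      also have "\<dots> = (real N + 1) * c * (2 * p)" by simp
      finally have "(real N * (1 - \<eta>)) * (2 * p) \<le> ((real N + 1) * c) * (2 * p)" by (simp add: ac_simps)
      then show False using cN p by simp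
    qed
    then obtain k where k: "k \<le> N" "2 * c * p < total_error (e \<epsilon>) \<epsilon> (t k)" by auto
    have "\<rho> \<epsilon> \<le> C \<epsilon> * u \<epsilon>" unfolding \<rho>_def using elim u_pos[of \<epsilon>] by (intro mult_right_mono) auto
    then have "ereal c < sup_ratio Par (P \<epsilon>) (e \<epsilon>) I \<epsilon> \<theta>0 (u \<epsilon>) (C \<epsilon> * u \<epsilon>)"
      using k range[OF k(1)] elim by (intro sup_ratio_lower[where \<theta>="t k"]) (auto simp: p_def)
    with c(1) show ?case by (rule less_trans)
  qed
qed

lemmas stable_withinD = stable_within_def[THEN iffD1, THEN spec, THEN spec, THEN mp, THEN mp]

text \<open>A chain centred at the given parameter has small slack at both links meeting there. Each
  one-sided error event is then close to the efficient region on its side and has probability about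
  p = \<open>Phi (- level \<epsilon>)\<close>. The total error is at most about 2 p, so errors
  between u and \<open>half_gap\<close> have negligible probability.\<close>

lemma efficient_estimator_region:
  assumes C: "filterlim C at_top (at_right 0)" and \<rho>: "linear_range (\<lambda>\<epsilon>. C \<epsilon> * u \<epsilon>)"
    and e: "\<forall>\<epsilon>>0. e \<epsilon> \<in> borel_measurable path_space"
    and eff: "\<And>C. filterlim C at_top (at_right 0) \<Longrightarrow> linear_range (\<lambda>\<epsilon>. C \<epsilon> * u \<epsilon>) \<Longrightarrow>
      ((\<lambda>\<epsilon>. sup_ratio Par (P \<epsilon>) (e \<epsilon>) I \<epsilon> \<theta>0 (u \<epsilon>) (C \<epsilon> * u \<epsilon>)) \<longlongrightarrow> 1) (at_right 0)"
    and \<theta>': "\<forall>\<^sub>F \<epsilon> in at_right 0. \<theta>' \<epsilon> \<in> Par \<and> \<bar>\<theta>' \<epsilon> - \<theta>0\<bar> < C \<epsilon> * u \<epsilon>"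
    and z: "\<forall>\<epsilon>>0. has_wiener_integral (P \<epsilon> \<theta>0) (noise \<epsilon> (\<lambda>t. S t \<theta>0)) dS (z \<epsilon>)"
    and v: "0 < v"
  shows "\<forall>\<^sub>F \<epsilon> in at_right 0. measure (P \<epsilon> (\<theta>' \<epsilon>)) (sym_diff {y \<in> space path_space. \<bar>e \<epsilon> y - \<theta>' \<epsilon>\<bar> > u \<epsilon>}
      (efficient_region (z \<epsilon>) 1 \<epsilon> (\<theta>' \<epsilon>) \<union> efficient_region (z \<epsilon>) (-1) \<epsilon> (\<theta>' \<epsilon>))) \<le> v * Phi (- level \<epsilon>)"
proof -
  have v8: "0 < v / 8" using v by simp
  obtain s1 where s1: "0 < s1" "s1 \<le> v / 8" and stab1: "stable_within s1 (v / 8)"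
    using neighbour_test_stability[OF v8] by blast
  \<comment> \<open>Stability is used twice. At the outer links accuracy w2 locates the left errors
    near 1; \<open>chain_slack\<close> then gives central slack at most max s2 (3 w2) \<le> s1, for
    which stability with accuracy v/8 applies at the centre.\<close>
  define w2 where "w2 = s1 / 4"
  have w2: "0 < w2" using s1 by (simp add: w2_def)
  obtain s2 where s2: "0 < s2" "s2 \<le> w2" and stab2: "stable_within s2 w2"
    using neighbour_test_stability[OF w2] by blast
  \<comment> \<open>For the budget of the pigeonhole argument: \<eta> \<le> s2/2 and \<eta> \<le> 1
    give N (s2 - \<eta>) \<ge> N s2/2 > 3 \<ge> 2 + \<eta>.\<close>
  obtain N :: nat where "max 1 (6 / s2) < real N"
    using reals_Archimedean2 by blast
  then have N: "0 < N" "6 / s2 < real N" by auto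
  define \<eta> where "\<eta> = min (min (s2 / 2) (w2 / (4 * real N + 1))) (min 1 (v / 8))"
  have \<eta>: "0 < \<eta>" using s2 w2 v by (simp add: \<eta>_def)
  have \<eta>_le: "\<eta> \<le> s2 / 2" "\<eta> \<le> w2 / (4 * real N + 1)" "\<eta> \<le> 1" "\<eta> \<le> v / 8"
    unfolding \<eta>_def by (meson min.cobounded1 min.cobounded2 order_trans)+
  have budget: "2 + \<eta> \<le> real N * (s2 - \<eta>)"
  proof -
    have "6 < real N * s2" using N s2 by (simp add: pos_divide_less_eq)
    moreover have "real N * (s2 / 2) \<le> real N * (s2 - \<eta>)" using \<eta>_le by (intro mult_left_mono) auto
    ultimately show ?thesis using \<eta>_le by simp
  qed
  have slack_le: "max s2 (2 * w2 + (4 * real N + 1) * \<eta>) \<le> s1"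
  proof -
    have "(4 * real N + 1) * \<eta> \<le> w2" using \<eta>_le(2) by (simp add: pos_le_divide_eq mult.commute)
    then show ?thesis using s2 w2 by (simp add: w2_def)
  qed
  \<comment> \<open>The centre lies within C u of \<theta>0 and the chain extends at most 4 N u to
    either side, which is at most 4 N C u once C \<ge> 1. Efficiency is therefore needed for this
    larger family of radii.\<close>
  define D where "D \<epsilon> = (4 * real N + 5) * C \<epsilon>" for \<epsilon>
  define r where "r \<epsilon> = D \<epsilon> * u \<epsilon>" for \<epsilon>
  have D: "filterlim D at_top (at_right 0)"
    unfolding D_def[abs_def] by (rule filterlim_tendsto_pos_mult_at_top[OF tendsto_const _ C]) simp
  have lr: "linear_range (\<lambda>\<epsilon>. D \<epsilon> * u \<epsilon>)"
    using linear_range_cmult[OF \<rho>, of "4 * real N + 5"] by (simp add: D_def mult.assoc)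
  then have r: "linear_range r" by (simp add: r_def[abs_def])
  have "\<forall>\<^sub>F \<epsilon> in at_right 0. sup_ratio Par (P \<epsilon>) (e \<epsilon>) I \<epsilon> \<theta>0 (u \<epsilon>) (D \<epsilon> * u \<epsilon>) < ereal (1 + \<eta> / 2)"
    using order_tendstoD(2)[OF eff[OF D lr], of "ereal (1 + \<eta> / 2)"] \<eta> by (simp add: one_ereal_def)
  moreover have "\<forall>\<^sub>F \<epsilon> in at_right 0. 1 \<le> C \<epsilon>" using C by (simp add: filterlim_at_top)
  moreover have "\<forall>\<^sub>F \<epsilon> in at_right 0. \<forall>\<theta>. \<bar>\<theta> - \<theta>0\<bar> < r \<epsilon> \<longrightarrow> \<bar>\<theta> + 2 * half_gap \<epsilon> - \<theta>0\<bar> < r \<epsilon> \<longrightarrow>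
      2 * (1 - \<eta> / 2) * Phi (- level \<epsilon>) \<le> right_error (e \<epsilon>) \<epsilon> \<theta> + left_error (e \<epsilon>) \<epsilon> (\<theta> + 2 * half_gap \<epsilon>)"
    by (rule link_lower[OF r _ e]) (use \<eta> in auto)
  ultimately show ?thesis
    using stable_withinD[OF stab1 r z] stable_withinD[OF stab2 r z] linear_range_in_Par[OF r] \<theta>' half_gap_le ev_pos
  proof eventually_elim
    case (elim \<epsilon>)
    note sup = elim(1) and C1 = elim(2) and link = elim(3) and st1 = elim(4) and st2 = elim(5)
      and inPar = elim(6) and \<theta>'\<epsilon> = elim(7) and hg_le = elim(8) and \<epsilon> = elim(9)
    interpret white_noise M W \<epsilon> by (rule white_noise[OF \<epsilon>])
    note em[measurable] = e[rule_format, OF \<epsilon>]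
    define h where "h = half_gap \<epsilon>"
    have h: "0 < h" "h \<le> 2 * u \<epsilon>" "u \<epsilon> < h" using half_gap_pos[OF \<epsilon>] half_gap_gt[OF \<epsilon>] hg_le by (auto simp: h_def)
    define p where "p = Phi (- level \<epsilon>)"
    have p: "0 < p" by (simp add: p_def Phi_pos)
    define t where "t k = \<theta>' \<epsilon> + 2 * h * (real k - real N)" for k
    have tSuc: "t (Suc k) = t k + 2 * h" for k by (simp add: t_def algebra_simps)
    have range: "\<bar>t k - \<theta>0\<bar> < r \<epsilon>" if "k \<le> 2 * N" for k
    proof -
      have "\<bar>real k - real N\<bar> \<le> real N" using that by simp
      then have "2 * h * \<bar>real k - real N\<bar> \<le> 2 * (2 * u \<epsilon>) * real N"
        using h u_pos[OF \<epsilon>] by (intro mult_mono) auto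
      also have "\<dots> = 4 * real N * u \<epsilon> * 1" by simp
      also have "\<dots> \<le> 4 * real N * u \<epsilon> * C \<epsilon>" using C1 u_pos[OF \<epsilon>] by (intro mult_left_mono) auto
      finally have "\<bar>2 * h * (real k - real N)\<bar> \<le> 4 * real N * u \<epsilon> * C \<epsilon>" using h by (simp add: abs_mult)
      moreover have "0 \<le> C \<epsilon> * u \<epsilon>" using C1 u_pos[OF \<epsilon>] by simp
      moreover have "r \<epsilon> = 4 * real N * u \<epsilon> * C \<epsilon> + 5 * (C \<epsilon> * u \<epsilon>)" by (simp add: r_def D_def algebra_simps)
      ultimately show ?thesis using \<theta>'\<epsilon> unfolding t_def by linarith
    qed
    define x where "x k = right_error (e \<epsilon>) \<epsilon> (t k) / p" for k
    define y where "y k = left_error (e \<epsilon>) \<epsilon> (t k) / p" for k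
    have total: "total_error (e \<epsilon>) \<epsilon> (t k) \<le> (2 + \<eta>) * p" if "k \<le> 2 * N" for k
    proof -
      have "total_error (e \<epsilon>) \<epsilon> (t k) \<le> 2 * (1 + \<eta> / 2) * p"
        unfolding p_def using range[OF that] inPar by (intro sup_ratio_upper[OF sup _ _ \<epsilon>]) (auto simp: r_def)
      then show ?thesis by (simp add: algebra_simps)
    qed
    define Ap where "Ap k = {y \<in> space path_space. t k + h \<le> e \<epsilon> y}" for k
    define Am where "Am k = {y \<in> space path_space. e \<epsilon> y < t k - h}" for k
    have Ap: "Ap k \<in> sets path_space" and Am: "Am k \<in> sets path_space" for k
      unfolding Ap_def Am_def by measurable
    have compl: "space path_space - Ap k = Am (Suc k)" "space path_space - Am (Suc k) = Ap k" for k
      by (auto simp: Ap_def Am_def tSuc)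
    have xm: "measure (P \<epsilon> (t k)) (Ap k) = x k * p" and ym: "measure (P \<epsilon> (t k)) (Am k) = y k * p" for k
      using p by (simp_all add: x_def y_def right_error_def left_error_def Ap_def Am_def h_def)
    \<comment> \<open>A link can be read from either end: from the left with \<tau> = 1, which
      controls the right error there, or from the right with \<tau> = -1, which controls the left
      error there.\<close>
    have down: "t (Suc k) + 2 * (- 1) * half_gap \<epsilon> = t k" and up': "t k + 2 * 1 * half_gap \<epsilon> = t (Suc k)" for k
      by (simp_all add: tSuc h_def)
    have slack: "x i + y (Suc i) \<le> 2 + s1" if i: "i = N \<or> Suc i = N" for i
    proof -
      have "x i + y (Suc i) \<le> 2 + max s2 (2 * w2 + (4 * real N + 1) * \<eta>)"
      proof (rule chain_slack[OF N(1) _ _ _ _ _ _ budget i])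
        show "0 \<le> \<eta>" using \<eta> by simp
        show "0 \<le> x k" "0 \<le> y k" for k
          using p by (simp_all add: x_def y_def right_error_def left_error_def)
        show "x k + y k \<le> 2 + \<eta>" if "k \<le> 2 * N" for k
          using error_split[OF \<epsilon> _ em, of "t k"] total[OF that] inPar range[OF that] p
          by (simp add: x_def y_def add_divide_distrib[symmetric] pos_divide_le_eq) 
        show "2 - \<eta> \<le> x k + y (Suc k)" if "k < 2 * N" for k
        proof -
          have "2 * (1 - \<eta> / 2) * p \<le> right_error (e \<epsilon>) \<epsilon> (t k) + left_error (e \<epsilon>) \<epsilon> (t (Suc k))"
            using link[rule_format, of "t k"] range[of k] range[of "Suc k"] that by (simp add: tSuc h_def p_def)
          then have "(2 - \<eta>) * p \<le> (x k + y (Suc k)) * p"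
            using p by (simp add: x_def y_def distrib_right left_diff_distrib)
          then show ?thesis by (simp only: mult_le_cancel_right_pos[OF p])
        qed
        \<comment> \<open>The left error belongs to the right end of the link, so stability is
          applied from that end, with the complementary event.\<close>
        show "\<bar>y (Suc k) - 1\<bar> \<le> w2" if k: "k < 2 * N" and sl: "x k + y (Suc k) \<le> 2 + s2" for k
        proof -
          have "measure (P \<epsilon> (t (Suc k))) (Am (Suc k)) + measure (P \<epsilon> (t k)) (space path_space - Am (Suc k)) \<le> (2 + s2) * p"
            unfolding compl xm ym using mult_right_mono[OF sl, of p] p by (simp add: algebra_simps)
          then have "\<bar>y (Suc k) * p - p\<bar> \<le> w2 * p"
            using st2[rule_format, of "- 1" "t (Suc k)"] range[of k] range[of "Suc k"] k Am[of "Suc k"]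
            unfolding down p_def[symmetric] ym[symmetric] by simp
          moreover have "\<bar>y (Suc k) * p - p\<bar> = \<bar>y (Suc k) - 1\<bar> * p"
            using p by (simp add: abs_mult[symmetric, of _ p, unfolded abs_of_pos[OF p]] left_diff_distrib)
          ultimately show ?thesis using p by simp
        qed
      qed
      then show ?thesis using slack_le by linarith
    qed
    have tN: "t N = \<theta>' \<epsilon>" by (simp add: t_def)
    obtain N' where N': "N = Suc N'" using N by (cases N) auto
    have rN: "\<bar>\<theta>' \<epsilon> - \<theta>0\<bar> < r \<epsilon>" "\<bar>t (Suc N) - \<theta>0\<bar> < r \<epsilon>" "\<bar>t N' - \<theta>0\<bar> < r \<epsilon>"
      using range[of N] range[of "Suc N"] range[of N'] N' tN by auto
    define Bp where "Bp = efficient_region (z \<epsilon>) 1 \<epsilon> (\<theta>' \<epsilon>)"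
    define Bm where "Bm = efficient_region (z \<epsilon>) (- 1) \<epsilon> (\<theta>' \<epsilon>)"
    have upN: "\<theta>' \<epsilon> + 2 * 1 * half_gap \<epsilon> = t (Suc N)" and downN: "\<theta>' \<epsilon> + 2 * (- 1) * half_gap \<epsilon> = t N'"
      using up'[of N] down[of N'] unfolding N'[symmetric] tN by auto
    have "measure (P \<epsilon> (\<theta>' \<epsilon>)) (Ap N) + measure (P \<epsilon> (t (Suc N))) (space path_space - Ap N) \<le> (2 + s1) * p"
      using mult_right_mono[OF slack[of N], of p] p xm[of N] unfolding compl ym tN by (simp add: algebra_simps)
    then have right: "Bp \<in> sets path_space" "measure (P \<epsilon> (\<theta>' \<epsilon>)) (sym_diff (Ap N) Bp) \<le> v / 8 * p"
      "\<bar>measure (P \<epsilon> (\<theta>' \<epsilon>)) (Ap N) - p\<bar> \<le> v / 8 * p"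
      using st1[rule_format, of 1 "\<theta>' \<epsilon>", unfolded upN] rN Ap[of N]
      unfolding Bp_def p_def[symmetric] by auto
    have "measure (P \<epsilon> (\<theta>' \<epsilon>)) (Am N) + measure (P \<epsilon> (t N')) (space path_space - Am N) \<le> (2 + s1) * p"
      using mult_right_mono[OF slack[of N'], of p] p ym[of N] compl(2)[of N'] xm[of N'] N'
      unfolding tN by (simp add: algebra_simps)
    then have left: "Bm \<in> sets path_space" "measure (P \<epsilon> (\<theta>' \<epsilon>)) (sym_diff (Am N) Bm) \<le> v / 8 * p"
      "\<bar>measure (P \<epsilon> (\<theta>' \<epsilon>)) (Am N) - p\<bar> \<le> v / 8 * p"
      using st1[rule_format, of "- 1" "\<theta>' \<epsilon>", unfolded downN] rN Am[of N]
      unfolding Bm_def p_def[symmetric] by auto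
    interpret F: prob_space "P \<epsilon> (\<theta>' \<epsilon>)" using \<theta>'\<epsilon> by (intro prob_space_law S) simp
    define E where "E = {y \<in> space path_space. \<bar>e \<epsilon> y - \<theta>' \<epsilon>\<bar> > u \<epsilon>}"
    have E: "E \<in> sets path_space" unfolding E_def by measurable
    have sub: "Ap N \<union> Am N \<subseteq> E" using h unfolding Ap_def Am_def E_def tN by auto
    have disj: "Ap N \<inter> Am N = {}" using h unfolding Ap_def Am_def tN by auto
    \<comment> \<open>The one-sided events take at least 2 p - v p/4 of a total error of at most (2
      + \<eta>) p. This is where the lower bounds for the individual errors are needed, not only
      closeness to the efficient regions.\<close>
    have rest: "measure (P \<epsilon> (\<theta>' \<epsilon>)) (E - (Ap N \<union> Am N)) \<le> (\<eta> + v / 4) * p"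
    proof -
      have "measure (P \<epsilon> (\<theta>' \<epsilon>)) (E - (Ap N \<union> Am N)) = measure (P \<epsilon> (\<theta>' \<epsilon>)) E - (measure (P \<epsilon> (\<theta>' \<epsilon>)) (Ap N) + measure (P \<epsilon> (\<theta>' \<epsilon>)) (Am N))"
        using sub disj E Ap[of N] Am[of N] by (simp add: F.finite_measure_Diff F.finite_measure_Union)
      also have "\<dots> \<le> (2 + \<eta>) * p - (2 * p - 2 * (v / 8 * p))"
        using total[of N, unfolded tN total_error_def E_def[symmetric]] right(3) left(3) by linarith
      also have "\<dots> = (\<eta> + v / 4) * p" by (simp add: algebra_simps)
      finally show ?thesis .
    qed
    have "measure (P \<epsilon> (\<theta>' \<epsilon>)) (sym_diff E (Bp \<union> Bm))
        \<le> measure (P \<epsilon> (\<theta>' \<epsilon>)) ((E - (Ap N \<union> Am N)) \<union> (sym_diff (Ap N) Bp \<union> sym_diff (Am N) Bm))"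
      using E Ap[of N] Am[of N] right(1) left(1) sub by (intro F.finite_measure_mono) auto
    also have "\<dots> \<le> measure (P \<epsilon> (\<theta>' \<epsilon>)) (E - (Ap N \<union> Am N)) + measure (P \<epsilon> (\<theta>' \<epsilon>)) (sym_diff (Ap N) Bp \<union> sym_diff (Am N) Bm)"
      using E Ap[of N] Am[of N] right(1) left(1) by (intro measure_Un_le) auto
    finally have 1: "measure (P \<epsilon> (\<theta>' \<epsilon>)) (sym_diff E (Bp \<union> Bm))
      \<le> measure (P \<epsilon> (\<theta>' \<epsilon>)) (E - (Ap N \<union> Am N)) + measure (P \<epsilon> (\<theta>' \<epsilon>)) (sym_diff (Ap N) Bp \<union> sym_diff (Am N) Bm)" .
    have 2: "measure (P \<epsilon> (\<theta>' \<epsilon>)) (sym_diff (Ap N) Bp \<union> sym_diff (Am N) Bm) \<le> measure (P \<epsilon> (\<theta>' \<epsilon>)) (sym_diff (Ap N) Bp) + measure (P \<epsilon> (\<theta>' \<epsilon>)) (sym_diff (Am N) Bm)"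
      using E Ap[of N] Am[of N] right(1) left(1) by (intro measure_Un_le) auto
    have "(\<eta> + v / 4) * p + (v / 8 * p + v / 8 * p) \<le> v * p"
    proof -
      have "(\<eta> + v / 4) * p + (v / 8 * p + v / 8 * p) = (\<eta> + v / 2) * p" by (simp add: algebra_simps)
      also have "\<dots> \<le> v * p" using \<eta>_le(4) v p by (intro mult_right_mono) auto
      finally show ?thesis .
    qed
    then show ?case unfolding E_def[symmetric] Bp_def[symmetric] Bm_def[symmetric] p_def[symmetric]
      using 1 2 rest right(2) left(2) by linarith
  qed
qed

end

section \<open>From error events to the limit of the normalised expectation\<close>

context local_model
begin

lemma linear_range_iff:
  assumes C: "filterlim C at_top (at_right 0)"
  shows "linear_range (\<lambda>\<epsilon>. C \<epsilon> * u \<epsilon>) \<longleftrightarrow>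
    ((\<lambda>\<epsilon>. C \<epsilon> powr (2 + lam) * u \<epsilon> powr (2 + lam) / \<epsilon>\<^sup>2) \<longlongrightarrow> 0) (at_right 0)"
proof -
  have C1: "\<forall>\<^sub>F \<epsilon> in at_right 0. 1 \<le> C \<epsilon>" using C by (simp add: filterlim_at_top)
  have ge: "\<forall>\<^sub>F \<epsilon> in at_right 0. u \<epsilon> \<le> C \<epsilon> * u \<epsilon>"
    using C1 ev_pos
  proof eventually_elim
    case (elim \<epsilon>)
    then show ?case using u_pos[of \<epsilon>] mult_right_mono[of 1 "C \<epsilon>" "u \<epsilon>"] by simp
  qed
  have "\<forall>\<^sub>F \<epsilon> in at_right 0. (C \<epsilon> * u \<epsilon>) powr (2 + lam) / \<epsilon>\<^sup>2 = C \<epsilon> powr (2 + lam) * u \<epsilon> powr (2 + lam) / \<epsilon>\<^sup>2"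
    using C1 ev_pos
  proof eventually_elim
    case (elim \<epsilon>)
    then show ?case using u_pos[of \<epsilon>] by (simp add: powr_mult)
  qed
  from tendsto_cong[OF this] ge show ?thesis by (simp add: linear_range_def)
qed

text \<open>The absolute difference of two indicators is the indicator of the symmetric difference,
  and the two-sided event of the efficient statistic splits by sign. The two factors 1/sqrt I, one
  normalising the statistic and one converting it to the parameter scale, combine to the 1/I of
  \<open>efficient_region\<close>.\<close>

lemma symmetric_difference_integral:
  assumes \<epsilon>: "0 < \<epsilon>" and \<theta>: "\<theta> \<in> Par" and e: "e \<in> borel_measurable path_space" and z: "z \<in> borel_measurable path_space"
  shows "(\<integral>y. \<bar>indicator {y. \<bar>e y - \<theta>\<bar> > u \<epsilon>} y
        - indicator {y. \<bar>\<epsilon> / sqrt I * (z y / sqrt I) - (\<theta> - \<theta>0)\<bar> > u \<epsilon>} y\<bar> \<partial>P \<epsilon> \<theta>)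
    = measure (P \<epsilon> \<theta>) (sym_diff {y \<in> space path_space. \<bar>e y - \<theta>\<bar> > u \<epsilon>}
        (efficient_region z 1 \<epsilon> \<theta> \<union> efficient_region z (-1) \<epsilon> \<theta>))"
proof -
  interpret white_noise M W \<epsilon> by (rule white_noise[OF \<epsilon>])
  interpret F: prob_space "P \<epsilon> \<theta>" by (rule prob_space_law[OF S[OF \<theta>]])
  note [measurable] = e z
  define D where "D = sym_diff {y \<in> space path_space. \<bar>e y - \<theta>\<bar> > u \<epsilon>}
        (efficient_region z 1 \<epsilon> \<theta> \<union> efficient_region z (-1) \<epsilon> \<theta>)"
  have D: "D \<in> sets path_space" unfolding D_def efficient_region_def by measurable
  have abs_gt: "u \<epsilon> < \<bar>v\<bar> \<longleftrightarrow> u \<epsilon> < v \<or> u \<epsilon> < - v" for v by linarith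
  have scale: "\<epsilon> / sqrt I * (w / sqrt I) = \<epsilon> / I * w" for w using I_pos by simp
  have "(\<integral>y. \<bar>indicator {y. \<bar>e y - \<theta>\<bar> > u \<epsilon>} y
        - indicator {y. \<bar>\<epsilon> / sqrt I * (z y / sqrt I) - (\<theta> - \<theta>0)\<bar> > u \<epsilon>} y\<bar> \<partial>P \<epsilon> \<theta>)
    = (\<integral>y. (indicator D y :: real) \<partial>P \<epsilon> \<theta>)"
  proof (rule Bochner_Integration.integral_cong[OF refl])
    fix y assume y: "y \<in> space (P \<epsilon> \<theta>)"
    define w where "w = \<epsilon> / I * z y - (\<theta> - \<theta>0)"
    have "y \<in> D \<longleftrightarrow> (u \<epsilon> < \<bar>e y - \<theta>\<bar>) \<noteq> (u \<epsilon> < \<bar>w\<bar>)"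
    proof -
      have "y \<in> efficient_region z 1 \<epsilon> \<theta> \<union> efficient_region z (-1) \<epsilon> \<theta> \<longleftrightarrow> u \<epsilon> < w \<or> u \<epsilon> < - w"
        using y by (simp add: efficient_region_def w_def)
      then show ?thesis unfolding D_def abs_gt[of w] using y by auto
    qed
    then show "\<bar>indicator {y. \<bar>e y - \<theta>\<bar> > u \<epsilon>} y
        - indicator {y. \<bar>\<epsilon> / sqrt I * (z y / sqrt I) - (\<theta> - \<theta>0)\<bar> > u \<epsilon>} y\<bar> = (indicator D y :: real)"
      using scale[of "z y"] by (auto simp: indicator_def w_def)
  qed
  also have "\<dots> = measure (P \<epsilon> \<theta>) D" using D sets.sets_into_space[OF D] by (simp add: Int_absorb2)
  finally show ?thesis unfolding D_def .
qed

lemma efficient_estimator_limit: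
  assumes e: "\<forall>\<epsilon>>0. e \<epsilon> \<in> borel_measurable path_space"
    and eff: "\<forall>C. filterlim C at_top (at_right 0) \<and>
           ((\<lambda>\<epsilon>. C \<epsilon> powr (2 + lam) * u \<epsilon> powr (2 + lam) / \<epsilon>\<^sup>2) \<longlongrightarrow> 0) (at_right 0) \<longrightarrow>
           ((\<lambda>\<epsilon>. sup_ratio Par (P \<epsilon>) (e \<epsilon>) I \<epsilon> \<theta>0 (u \<epsilon>) (C \<epsilon> * u \<epsilon>)) \<longlongrightarrow> 1) (at_right 0)"
    and C: "filterlim C at_top (at_right 0)"
      "((\<lambda>\<epsilon>. C \<epsilon> powr (2 + lam) * u \<epsilon> powr (2 + lam) / \<epsilon>\<^sup>2) \<longlongrightarrow> 0) (at_right 0)"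
    and \<theta>': "\<forall>\<^sub>F \<epsilon> in at_right 0. \<theta>' \<epsilon> \<in> Par \<and> \<bar>\<theta>' \<epsilon> - \<theta>0\<bar> < C \<epsilon> * u \<epsilon>"
    and z: "\<forall>\<epsilon>>0. has_wiener_integral (P \<epsilon> \<theta>0) (noise \<epsilon> (\<lambda>t. S t \<theta>0)) dS (z \<epsilon>)"
  shows "((\<lambda>\<epsilon>. (\<integral>y. \<bar>indicator {y. \<bar>e \<epsilon> y - \<theta>' \<epsilon>\<bar> > u \<epsilon>} y
        - indicator {y. \<bar>\<epsilon> / sqrt I * (z \<epsilon> y / sqrt I) - (\<theta>' \<epsilon> - \<theta>0)\<bar> > u \<epsilon>} y\<bar> \<partial>P \<epsilon> (\<theta>' \<epsilon>))
      / Phi (- (sqrt I * u \<epsilon> / \<epsilon>))) \<longlongrightarrow> (0 :: real)) (at_right 0)"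
proof (rule tendstoI)
  fix v :: real assume v: "0 < v"
  \<comment> \<open>Half of v turns the weak inequality of the region estimate into the strict one
    required of a limit.\<close>
  then have v2: "0 < v / 2" by simp
  have eff': "((\<lambda>\<epsilon>. sup_ratio Par (P \<epsilon>) (e \<epsilon>) I \<epsilon> \<theta>0 (u \<epsilon>) (C \<epsilon> * u \<epsilon>)) \<longlongrightarrow> 1) (at_right 0)"
    if "filterlim C at_top (at_right 0)" "linear_range (\<lambda>\<epsilon>. C \<epsilon> * u \<epsilon>)" for C
    using eff that linear_range_iff[OF that(1)] by blast
  have "linear_range (\<lambda>\<epsilon>. C \<epsilon> * u \<epsilon>)" using linear_range_iff[OF C(1)] C(2) by blast
  from efficient_estimator_region[OF C(1) this e eff' \<theta>' z v2]
  have region: "\<forall>\<^sub>F \<epsilon> in at_right 0. measure (P \<epsilon> (\<theta>' \<epsilon>)) (sym_diff {y \<in> space path_space. \<bar>e \<epsilon> y - \<theta>' \<epsilon>\<bar> > u \<epsilon>}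
      (efficient_region (z \<epsilon>) 1 \<epsilon> (\<theta>' \<epsilon>) \<union> efficient_region (z \<epsilon>) (-1) \<epsilon> (\<theta>' \<epsilon>))) \<le> v / 2 * Phi (- level \<epsilon>)"
    by blast
  show "\<forall>\<^sub>F \<epsilon> in at_right 0. dist ((\<integral>y. \<bar>indicator {y. \<bar>e \<epsilon> y - \<theta>' \<epsilon>\<bar> > u \<epsilon>} y
        - indicator {y. \<bar>\<epsilon> / sqrt I * (z \<epsilon> y / sqrt I) - (\<theta>' \<epsilon> - \<theta>0)\<bar> > u \<epsilon>} y\<bar> \<partial>P \<epsilon> (\<theta>' \<epsilon>))
      / Phi (- (sqrt I * u \<epsilon> / \<epsilon>))) 0 < v"
    using region \<theta>' ev_pos
  proof eventually_elim
    case (elim \<epsilon>)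
    interpret white_noise M W \<epsilon> by (rule white_noise[OF elim(3)])
    have zm: "z \<epsilon> \<in> borel_measurable path_space"
      using z[rule_format, OF elim(3)] by (simp add: has_wiener_integral_def)
    have "v / 2 * Phi (- level \<epsilon>) < v * Phi (- level \<epsilon>)" using v Phi_pos[of "- level \<epsilon>"] by simp
    with elim show ?case
      unfolding symmetric_difference_integral[OF elim(3) conjunct1[OF elim(2)] e[rule_format, OF elim(3)] zm] level_def[symmetric]
      using Phi_pos[of "- level \<epsilon>"] by (simp add: dist_real_def pos_divide_less_eq)
  qed
qed

end

theorem theorem2p4:
  fixes M :: "'a measure" and W :: "real \<Rightarrow> 'a \<Rightarrow> real"
    and S :: "real \<Rightarrow> real \<Rightarrow> real" and dS :: "real \<Rightarrow> real"
    and Par :: "real set" and \<theta>0 lam :: real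
    and u :: "real \<Rightarrow> real" and est :: "real \<Rightarrow> (real \<Rightarrow> real) \<Rightarrow> real"
  defines "I \<equiv> fisher_info dS"
    and "P \<equiv> \<lambda>\<epsilon> \<theta>. observation_law M W \<epsilon> (\<lambda>t. S t \<theta>)"
  assumes W: "wiener_process M W"
    and Par: "open Par" "\<theta>0 \<in> Par"
    and S: "\<And>\<theta>. \<theta> \<in> Par \<Longrightarrow> L2 (\<lambda>t. S t \<theta>)"
    and lam: "0 < lam" "lam \<le> 1"
    and A1: "cond_A1 Par S \<theta>0 dS"
    and A2: "cond_A2 lam Par S \<theta>0 dS"
    and u_pos: "\<And>\<epsilon>. \<epsilon> > 0 \<Longrightarrow> u \<epsilon> > 0"
    and u_large: "filterlim (\<lambda>\<epsilon>. u \<epsilon> / \<epsilon>) at_top (at_right 0)"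
    and u_small: "((\<lambda>\<epsilon>. u \<epsilon> powr (2 + lam) / \<epsilon>\<^sup>2) \<longlongrightarrow> 0) (at_right 0)"
    and est: "\<And>\<epsilon>. \<epsilon> > 0 \<Longrightarrow> est \<epsilon> \<in> borel_measurable path_space"
  shows
    "(\<forall>C. filterlim C at_top (at_right 0) \<longrightarrow>
        1 \<le> Liminf (at_right 0)
              (\<lambda>\<epsilon>. sup_ratio Par (P \<epsilon>) (est \<epsilon>) I \<epsilon> \<theta>0 (u \<epsilon>) (C \<epsilon> * u \<epsilon>)))
     \<and>
     ((\<forall>C. filterlim C at_top (at_right 0) \<and>
           ((\<lambda>\<epsilon>. C \<epsilon> powr (2 + lam) * u \<epsilon> powr (2 + lam) / \<epsilon>\<^sup>2) \<longlongrightarrow> 0) (at_right 0) \<longrightarrow>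
           ((\<lambda>\<epsilon>. sup_ratio Par (P \<epsilon>) (est \<epsilon>) I \<epsilon> \<theta>0 (u \<epsilon>) (C \<epsilon> * u \<epsilon>)) \<longlongrightarrow> 1) (at_right 0))
      \<longrightarrow>
      (\<forall>C \<theta>' Z.
         filterlim C at_top (at_right 0) \<and>
         ((\<lambda>\<epsilon>. C \<epsilon> powr (2 + lam) * u \<epsilon> powr (2 + lam) / \<epsilon>\<^sup>2) \<longlongrightarrow> 0) (at_right 0) \<and>
         (\<forall>\<^sub>F \<epsilon> in at_right 0. \<theta>' \<epsilon> \<in> Par \<and> \<bar>\<theta>' \<epsilon> - \<theta>0\<bar> < C \<epsilon> * u \<epsilon>) \<and>
         (\<forall>\<epsilon>>0. has_wiener_integral (P \<epsilon> \<theta>0) (noise \<epsilon> (\<lambda>t. S t \<theta>0)) dS (Z \<epsilon>))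
         \<longrightarrow>
         (let T0 = (\<lambda>\<epsilon> y. Z \<epsilon> y / sqrt I) in
          ((\<lambda>\<epsilon>. (\<integral>y. \<bar>indicator {y. \<bar>est \<epsilon> y - \<theta>' \<epsilon>\<bar> > u \<epsilon>} y
                       - indicator {y. \<bar>\<epsilon> / sqrt I * T0 \<epsilon> y - (\<theta>' \<epsilon> - \<theta>0)\<bar> > u \<epsilon>} y\<bar>
                  \<partial>(P \<epsilon> (\<theta>' \<epsilon>)))
               / Phi (- (sqrt I * u \<epsilon> / \<epsilon>)))
             \<longlongrightarrow> (0::real)) (at_right 0))))"
proof -
  have model: "local_model M W S dS Par \<theta>0 lam u"
    using W Par S lam A1 A2 u_pos u_large by unfold_locales
  \<comment> \<open>The lower bound uses chains whose number of links does not depend on \<epsilon>,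
    so it suffices that u itself is an admissible radius; no growth restriction on C enters.\<close>
  have small: "local_model.linear_range lam u u"
    using u_small by (simp add: local_model.linear_range_def[OF model])
  have e: "\<forall>\<epsilon>>0. est \<epsilon> \<in> borel_measurable path_space" using est by blast
  show ?thesis
    unfolding Let_def I_def P_def
    using local_model.Liminf_sup_ratio[OF model small e]
      local_model.efficient_estimator_limit[OF model e] by blast
qed

end
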